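(* Let $P$ be a partially ordered set and $K,L$ filtered ordered simplicial complexes (FOS-complexes) over $P$ with $K$ finite. (1) For every stratum preserving map $\phi:|K|_P\to|L|_P$ there exist $n\in\mathbb N$ and a morphism of FOS-complexes $f:\mathrm{sd}^n(K)\to L$ such that $$|f|_P\simeq_P\phi\circ|\mathrm{l.v.}^n|_P\simeq_P\phi\circ h_n,$$ where $h_n:|\mathrm{sd}^n(K)|_P\to|K|_P$ is the barycentric subdivision homeomorphism. (2) If $f_0,f_1:K\to L$ are morphisms of FOS-complexes with $|f_0|_P\simeq_P|f_1|_P$, then there exist $n\in\mathbb N$ and a morphism of FOS-complexes $H:\mathrm{sd}^n(K\otimes\Delta^1)\to L$ with $H\circ\mathrm{sd}^n(i_j)=f_j\circ\mathrm{l.v.}^n$ for $j=0,1$, where $i_j:K\to K\otimes\Delta^1$ is the inclusion at the vertex $j$.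
   Context: $P$ carries the Alexandroff topology (closed sets = down-sets). A filtered ordered simplicial complex (FOS-complex) over $P$ is an ordered simplicial complex $K$ (each simplex linearly ordered, compatibly with faces) with a map $p_K:K^{(0)}\to P$ such that $x<y$ in a common simplex implies $p_K(x)\le p_K(y)$; morphisms are order preserving simplicial maps commuting with $p$. Equivalently, FOS-complexes are the $P$-filtered simplicial sets in which every simplex is determined by the multiset of its vertices. The realization $|K|_P$ is the geometric realization with the map to $P$ sending $\sum t_x|x|$ to $\max\{p_K(x):t_x>0\}$. $\simeq_P$ denotes stratified homotopy: a homotopy $|K|\times[0,1]\to|L|$ that is stratum preserving when the source is filtered via the projection to $|K|_P$. The barycentric subdivision $\mathrm{sd}(K)$ has as vertices the nonempty simplices of $K$, as simplices the chains under inclusion, ordered by inclusion, filtered by $\sigma\mapsto\max p_K(\sigma)$; the last vertex map $\mathrm{l.v.}:\mathrm{sd}(K)\to K$ sends $\sigma$ to its maximal vertex; $\mathrm{sd}^n$ and $\mathrm{l.v.}^n$ are the iterates and composites. $K\otimes\Delta^1$ is the product of ordered simplicial complexes $K\times\Delta^1$ (vertices $(x,i)$, simplices the chains in the product order whose projections are simplices), filtered via the projection to $K$. *)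

theory Defs
  imports "HOL-Analysis.Analysis" "HOL-Library.FSet"
begin

text \<open>An FOS-complex over the poset 'p on the vertex type 'v.
  simps: the (nonempty, finite) simplices as vertex sets;
  ord x y: x is strictly below y in the linear order of a common simplex
  (the order of each simplex is the restriction of this relation, which
  encodes compatibility of the orders with faces);
  filt: the filtration map p_K.\<close>

record ('v, 'p) fos =
  verts :: "'v set"
  simps :: "'v set set"
  ord   :: "'v \<Rightarrow> 'v \<Rightarrow> bool"
  filt  :: "'v \<Rightarrow> 'p"

definition fos_complex :: "('v, 'p::order) fos \<Rightarrow> bool" where
  "fos_complex K \<longleftrightarrow>
     (\<forall>\<sigma>\<in>simps K. \<sigma> \<noteq> {} \<and> finite \<sigma> \<and> \<sigma> \<subseteq> verts K) \<and>
     (\<forall>v\<in>verts K. {v} \<in> simps K) \<and>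
     (\<forall>\<sigma>\<in>simps K. \<forall>\<tau>. \<tau> \<subseteq> \<sigma> \<and> \<tau> \<noteq> {} \<longrightarrow> \<tau> \<in> simps K) \<and>
     (\<forall>x y. ord K x y \<longrightarrow> x \<noteq> y \<and> {x, y} \<in> simps K) \<and>
     (\<forall>\<sigma>\<in>simps K. \<forall>x\<in>\<sigma>. \<forall>y\<in>\<sigma>. x \<noteq> y \<longrightarrow> ord K x y \<or> ord K y x) \<and>
     (\<forall>\<sigma>\<in>simps K. \<forall>x\<in>\<sigma>. \<forall>y\<in>\<sigma>. \<not> (ord K x y \<and> ord K y x)) \<and>
     (\<forall>\<sigma>\<in>simps K. \<forall>x\<in>\<sigma>. \<forall>y\<in>\<sigma>. \<forall>z\<in>\<sigma>. ord K x y \<and> ord K y z \<longrightarrow> ord K x z) \<and>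
     (\<forall>x y. ord K x y \<longrightarrow> filt K x \<le> filt K y)"

definition fos_finite :: "('v, 'p) fos \<Rightarrow> bool" where
  "fos_finite K \<longleftrightarrow> finite (verts K)"

definition fos_morphism :: "('v \<Rightarrow> 'w) \<Rightarrow> ('v, 'p) fos \<Rightarrow> ('w, 'p) fos \<Rightarrow> bool" where
  "fos_morphism f K L \<longleftrightarrow>
     (\<forall>v\<in>verts K. f v \<in> verts L) \<and>
     (\<forall>\<sigma>\<in>simps K. f ` \<sigma> \<in> simps L) \<and>
     (\<forall>x y. ord K x y \<longrightarrow> f x = f y \<or> ord L (f x) (f y)) \<and>
     (\<forall>v\<in>verts K. filt L (f v) = filt K v)"

text \<open>Maximum of a subset of a poset (used only for chains).\<close>

definition pmax :: "'p::order set \<Rightarrow> 'p" where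
  "pmax A = (THE q. q \<in> A \<and> (\<forall>q'\<in>A. q' \<le> q))"

definition supp :: "('v \<Rightarrow> real) \<Rightarrow> 'v set" where
  "supp t = {v. t v \<noteq> 0}"

definition real_carrier :: "('v, 'p) fos \<Rightarrow> ('v \<Rightarrow> real) set" where
  "real_carrier K = {t. (\<forall>v. 0 \<le> t v) \<and> supp t \<in> simps K \<and> sum t (supp t) = 1}"

definition closed_simplex :: "'v set \<Rightarrow> ('v \<Rightarrow> real) set" where
  "closed_simplex \<sigma> = {t. (\<forall>v. 0 \<le> t v) \<and> (\<forall>v. v \<notin> \<sigma> \<longrightarrow> t v = 0) \<and> sum t \<sigma> = 1}"

text \<open>The realization |K| with the weak (coherent) topology: a set is open iff
  its trace on every closed simplex is open in the Euclidean topology of that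
  simplex (product topology on functions with support in the finite simplex).\<close>

definition geom_top :: "('v, 'p) fos \<Rightarrow> ('v \<Rightarrow> real) topology" where
  "geom_top K = topology (\<lambda>U. U \<subseteq> real_carrier K \<and>
     (\<forall>\<sigma>\<in>simps K. openin (subtopology (powertop_real UNIV) (closed_simplex \<sigma>))
                               (U \<inter> closed_simplex \<sigma>)))"

definition realp :: "('v, 'p::order) fos \<Rightarrow> ('v \<Rightarrow> real) \<Rightarrow> 'p" where
  "realp K t = pmax (filt K ` supp t)"

definition strat_pres :: "('v, 'p::order) fos \<Rightarrow> ('w, 'p) fos \<Rightarrow> (('v \<Rightarrow> real) \<Rightarrow> ('w \<Rightarrow> real)) \<Rightarrow> bool" where
  "strat_pres K L \<phi> \<longleftrightarrow> continuous_map (geom_top K) (geom_top L) \<phi> \<and>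
     (\<forall>t\<in>real_carrier K. realp L (\<phi> t) = realp K t)"

definition strat_htpy :: "('v, 'p::order) fos \<Rightarrow> ('w, 'p) fos \<Rightarrow>
    (('v \<Rightarrow> real) \<Rightarrow> ('w \<Rightarrow> real)) \<Rightarrow> (('v \<Rightarrow> real) \<Rightarrow> ('w \<Rightarrow> real)) \<Rightarrow> bool" where
  "strat_htpy K L f g \<longleftrightarrow>
     homotopic_with (\<lambda>h. \<forall>t\<in>real_carrier K. realp L (h t) = realp K t)
       (geom_top K) (geom_top L) f g"

definition real_map :: "('v \<Rightarrow> 'w) \<Rightarrow> ('v \<Rightarrow> real) \<Rightarrow> ('w \<Rightarrow> real)" where
  "real_map f t = (\<lambda>w. sum t {v. t v \<noteq> 0 \<and> f v = w})"

text \<open>Vertices of iterated subdivisions: V x is an original vertex, S \<sigma> the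
  vertex of a subdivision corresponding to the simplex \<sigma>.\<close>

datatype 'a hv = V 'a | S "'a hv fset"

definition unV :: "'a hv \<Rightarrow> 'a" where
  "unV x = (case x of V a \<Rightarrow> a | S _ \<Rightarrow> undefined)"

definition emb :: "('a, 'p) fos \<Rightarrow> ('a hv, 'p) fos" where
  "emb K = \<lparr> verts = V ` verts K,
             simps = (\<lambda>\<sigma>. V ` \<sigma>) ` simps K,
             ord = (\<lambda>x y. \<exists>a b. x = V a \<and> y = V b \<and> ord K a b),
             filt = (\<lambda>x. filt K (unV x)) \<rparr>"

definition sdv :: "'a hv set \<Rightarrow> 'a hv" where
  "sdv \<sigma> = S (Abs_fset \<sigma>)"

definition is_chain :: "'v set set \<Rightarrow> bool" where
  "is_chain C \<longleftrightarrow> (\<forall>\<sigma>\<in>C. \<forall>\<tau>\<in>C. \<sigma> \<subseteq> \<tau> \<or> \<tau> \<subseteq> \<sigma>)"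

definition sd :: "('a hv, 'p::order) fos \<Rightarrow> ('a hv, 'p) fos" where
  "sd K = \<lparr> verts = sdv ` simps K,
            simps = {sdv ` C | C. C \<subseteq> simps K \<and> C \<noteq> {} \<and> finite C \<and> is_chain C},
            ord = (\<lambda>x y. \<exists>\<sigma> \<tau>. x = sdv \<sigma> \<and> y = sdv \<tau> \<and> \<sigma> \<in> simps K \<and> \<tau> \<in> simps K \<and> \<sigma> \<subset> \<tau>),
            filt = (\<lambda>x. case x of S a \<Rightarrow> pmax (filt K ` fset a) | V _ \<Rightarrow> undefined) \<rparr>"

definition sdn :: "('a, 'p::order) fos \<Rightarrow> nat \<Rightarrow> ('a hv, 'p) fos" where
  "sdn K n = (sd ^^ n) (emb K)"

definition top_vertex :: "('v, 'p) fos \<Rightarrow> 'v set \<Rightarrow> 'v" where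
  "top_vertex K \<sigma> = (THE v. v \<in> \<sigma> \<and> (\<forall>w\<in>\<sigma>. w \<noteq> v \<longrightarrow> ord K w v))"

definition lv :: "('a hv, 'p) fos \<Rightarrow> 'a hv \<Rightarrow> 'a hv" where
  "lv K x = (case x of S a \<Rightarrow> top_vertex K (fset a) | V _ \<Rightarrow> undefined)"

fun lvn :: "('a hv, 'p::order) fos \<Rightarrow> nat \<Rightarrow> 'a hv \<Rightarrow> 'a hv" where
  "lvn E 0 = id"
| "lvn E (Suc n) = lvn E n \<circ> lv ((sd ^^ n) E)"

definition lvK :: "('a, 'p::order) fos \<Rightarrow> nat \<Rightarrow> 'a hv \<Rightarrow> 'a" where
  "lvK K n = unV \<circ> lvn (emb K) n"

text \<open>The subdivision homeomorphism |sd(K)| \<rightarrow> |K| sends the vertex \<sigma> to the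
  barycenter of \<sigma> and is extended linearly; h_n is its n-fold iterate.\<close>

definition bary :: "'a hv \<Rightarrow> 'a hv \<Rightarrow> real" where
  "bary w v = (case w of S a \<Rightarrow> (if v |\<in>| a then 1 / real (fcard a) else 0) | V _ \<Rightarrow> 0)"

definition bary_sd :: "('a hv \<Rightarrow> real) \<Rightarrow> ('a hv \<Rightarrow> real)" where
  "bary_sd t = (\<lambda>v. \<Sum>w\<in>supp t. t w * bary w v)"

definition hn :: "nat \<Rightarrow> ('a hv \<Rightarrow> real) \<Rightarrow> ('a \<Rightarrow> real)" where
  "hn n t = (\<lambda>x. (bary_sd ^^ n) t (V x))"

definition emb_map :: "('a \<Rightarrow> 'b) \<Rightarrow> 'a hv \<Rightarrow> 'b hv" where
  "emb_map f x = (case x of V a \<Rightarrow> V (f a) | S _ \<Rightarrow> undefined)"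

definition sd_map :: "('a hv \<Rightarrow> 'b hv) \<Rightarrow> 'a hv \<Rightarrow> 'b hv" where
  "sd_map g x = (case x of S a \<Rightarrow> S (g |`| a) | V _ \<Rightarrow> undefined)"

definition sdn_map :: "('a \<Rightarrow> 'b) \<Rightarrow> nat \<Rightarrow> 'a hv \<Rightarrow> 'b hv" where
  "sdn_map f n = (sd_map ^^ n) (emb_map f)"

definition prodI :: "('a, 'p) fos \<Rightarrow> ('a \<times> nat, 'p) fos" where
  "prodI K = \<lparr> verts = verts K \<times> {0, 1},
     simps = {C. C \<noteq> {} \<and> finite C \<and> C \<subseteq> verts K \<times> {0, 1} \<and> fst ` C \<in> simps K \<and>
                 (\<forall>a\<in>C. \<forall>b\<in>C. ((fst a = fst b \<or> ord K (fst a) (fst b)) \<and> snd a \<le> snd b) \<or>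
                                ((fst b = fst a \<or> ord K (fst b) (fst a)) \<and> snd b \<le> snd a))},
     ord = (\<lambda>a b. a \<noteq> b \<and> a \<in> verts K \<times> {0, 1} \<and> b \<in> verts K \<times> {0, 1} \<and>
                  (fst a = fst b \<or> ord K (fst a) (fst b)) \<and> snd a \<le> snd b),
     filt = (\<lambda>a. filt K (fst a)) \<rparr>"

end

(* Stratified simplicial approximation. Ordinary simplicial approximation fails because near a
   stratum the image of a star need not lie in the star of any vertex of the right stratum (the map
   may spiral). The strata are therefore treated one at a time, from below. Suppose the vertices of
   all lower strata already satisfy the star condition, with vertex map g. Replace the map by the
   join of g on the lower strata with its own component in the upper strata U, precomposed with a
   stretching of |K| away from the lower strata. The star condition keeps everything in common
   simplices, so this is a stratified homotopy. The stretched component factors through a compact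
   set, hence is uniformly continuous in the normalized coordinates of U. These get small mesh if the
   vertices of the iterated subdivision are moved to barycenters formed in the U-part only. Then the
   vertices in the lowest stratum of U satisfy the star condition as well.

   At the end the vertex map is simplicial, and sending a simplex to the last vertex of its image
   makes it order preserving. For (2), approximate a homotopy that is constant near both ends. The
   approximation near the ends has vertices in the images of the carriers, so it may be replaced by
   f_j composed with the last vertex map on the end itself. *)
theory Submission
  imports Defs
begin

section \<open>Ordered complexes and their realizations\<close>

text \<open>Almost every homotopy here is a straight line: two stratum preserving maps whose values
  at each point have supports in a common simplex are stratified homotopic, because each point of
  the segment keeps the support of one of the two ends. The only other deformation varies the
  parameter of the stretching.

  The stretching is forced by the normalized upper coordinates: they need not converge towards
  points without mass in \<open>U\<close>, so no uniform estimate holds on all of |K|. Stretching by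
  \<open>b\<close> moves every point with mass in \<open>U\<close> into the compact set where that
  mass is at least \<open>b\<close>. The tolerance comes from pigeonhole: the normalized coordinates
  sum to 1, so at the position of a vertex of the minimal stratum some coordinate is at least
  \<open>1 / card WU\<close> and stays positive under smaller perturbations; minimality in
  \<open>U\<close> puts the corresponding vertex of L into that stratum.

  L may be infinite and carries the weak topology. Compactness confines each image to finitely many
  vertices, after which continuity is checked one coordinate at a time.\<close>

lemma fos_axioms:
  assumes "fos_complex K"
  shows "\<forall>\<sigma>\<in>simps K. \<sigma> \<noteq> {} \<and> finite \<sigma> \<and> \<sigma> \<subseteq> verts K"
    and "\<forall>v\<in>verts K. {v} \<in> simps K"
    and "\<forall>\<sigma>\<in>simps K. \<forall>\<tau>. \<tau> \<subseteq> \<sigma> \<and> \<tau> \<noteq> {} \<longrightarrow> \<tau> \<in> simps K"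
    and "\<forall>x y. ord K x y \<longrightarrow> x \<noteq> y \<and> {x, y} \<in> simps K"
    and "\<forall>\<sigma>\<in>simps K. \<forall>x\<in>\<sigma>. \<forall>y\<in>\<sigma>. x \<noteq> y \<longrightarrow> ord K x y \<or> ord K y x"
    and "\<forall>\<sigma>\<in>simps K. \<forall>x\<in>\<sigma>. \<forall>y\<in>\<sigma>. \<not> (ord K x y \<and> ord K y x)"
    and "\<forall>\<sigma>\<in>simps K. \<forall>x\<in>\<sigma>. \<forall>y\<in>\<sigma>. \<forall>z\<in>\<sigma>. ord K x y \<and> ord K y z \<longrightarrow> ord K x z"
    and "\<forall>x y. ord K x y \<longrightarrow> filt K x \<le> filt K y"
  using assms unfolding fos_complex_def by - (elim conjE, assumption)+

lemma fos_simplexD: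
  assumes "fos_complex K" "\<sigma> \<in> simps K"
  shows "finite \<sigma>" "\<sigma> \<noteq> {}" "\<sigma> \<subseteq> verts K"
  using fos_axioms(1)[OF assms(1)] assms(2) by blast+

lemma fos_face:
  assumes "fos_complex K" "\<sigma> \<in> simps K" "\<tau> \<subseteq> \<sigma>" "\<tau> \<noteq> {}"
  shows "\<tau> \<in> simps K"
  using fos_axioms(3)[OF assms(1)] assms(2-) by blast

lemma fos_vertex: "fos_complex K \<Longrightarrow> v \<in> verts K \<Longrightarrow> {v} \<in> simps K"
  using fos_axioms(2) by blast

lemma fos_ordD:
  assumes "fos_complex K" "ord K x y"
  shows "x \<noteq> y" "{x, y} \<in> simps K" "filt K x \<le> filt K y"
  using fos_axioms(4,8)[OF assms(1)] assms(2) by blast+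

lemma fos_ord_linear:
  assumes "fos_complex K" "\<sigma> \<in> simps K" "x \<in> \<sigma>" "y \<in> \<sigma>"
  shows "x \<noteq> y \<Longrightarrow> ord K x y \<or> ord K y x" "\<not> (ord K x y \<and> ord K y x)"
    "z \<in> \<sigma> \<Longrightarrow> ord K x y \<Longrightarrow> ord K y z \<Longrightarrow> ord K x z"
  using fos_axioms(5)[OF assms(1)] assms(2-) apply blast
  using fos_axioms(6)[OF assms(1)] assms(2-) apply blast
  using fos_axioms(7)[OF assms(1)] assms(2-) apply blast
  done

text \<open>Since \<open>ord K\<close> is transitive only within a common simplex, the induction
  runs over the subsets of one fixed simplex.\<close>

lemma fos_max_exists:
  assumes "fos_complex K" "\<sigma> \<in> simps K"
  shows "\<exists>v\<in>\<sigma>. \<forall>w\<in>\<sigma>. w \<noteq> v \<longrightarrow> ord K w v"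
proof -
  have "\<exists>v\<in>\<tau>. \<forall>w\<in>\<tau>. w \<noteq> v \<longrightarrow> ord K w v" if "finite \<tau>" "\<tau> \<noteq> {}" "\<tau> \<subseteq> \<sigma>" for \<tau>
    using that
  proof (induction \<tau> rule: finite_ne_induct)
    case (insert x F)
    then obtain v where v: "v \<in> F" "\<forall>w\<in>F. w \<noteq> v \<longrightarrow> ord K w v" by auto
    have in\<sigma>: "x \<in> \<sigma>" "v \<in> \<sigma>" "F \<subseteq> \<sigma>" using insert v by auto
    have "x \<noteq> v" using insert v by auto
    show ?case
    proof (cases "ord K x v")
      case True then show ?thesis using v by auto
    next
      case False
      then have "ord K v x" using fos_ord_linear(1)[OF assms in\<sigma>(1,2) \<open>x \<noteq> v\<close>] by blast
      then have "ord K w x" if "w \<in> F" for w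
        using that v(2) in\<sigma> fos_ord_linear(3)[OF assms _ in\<sigma>(2,1), of w] by (cases "w = v") auto
      then show ?thesis by auto
    qed
  qed auto
  then show ?thesis using fos_simplexD[OF assms] by auto
qed

lemma top_vertex_eqI:
  assumes "fos_complex K" "\<sigma> \<in> simps K" "v \<in> \<sigma>" "\<And>w. w \<in> \<sigma> \<Longrightarrow> w \<noteq> v \<Longrightarrow> ord K w v"
  shows "top_vertex K \<sigma> = v"
  unfolding top_vertex_def
proof (rule the_equality)
  fix v' assume "v' \<in> \<sigma> \<and> (\<forall>w\<in>\<sigma>. w \<noteq> v' \<longrightarrow> ord K w v')"
  then show "v' = v" using assms(3,4) fos_ord_linear(2)[OF assms(1,2), of v v'] by auto
qed (use assms in auto)

lemma top_vertex:
  assumes "fos_complex K" "\<sigma> \<in> simps K"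
  shows top_vertex_in: "top_vertex K \<sigma> \<in> \<sigma>"
    and top_vertex_ord: "\<And>w. w \<in> \<sigma> \<Longrightarrow> w \<noteq> top_vertex K \<sigma> \<Longrightarrow> ord K w (top_vertex K \<sigma>)"
    and top_vertex_filt: "\<And>w. w \<in> \<sigma> \<Longrightarrow> filt K w \<le> filt K (top_vertex K \<sigma>)"
proof -
  obtain v where v: "v \<in> \<sigma>" "\<forall>w\<in>\<sigma>. w \<noteq> v \<longrightarrow> ord K w v"
    using fos_max_exists[OF assms] by auto
  then have "top_vertex K \<sigma> = v" using top_vertex_eqI[OF assms] by auto
  with v show "top_vertex K \<sigma> \<in> \<sigma>"
    and *: "\<And>w. w \<in> \<sigma> \<Longrightarrow> w \<noteq> top_vertex K \<sigma> \<Longrightarrow> ord K w (top_vertex K \<sigma>)" by auto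
  then show "\<And>w. w \<in> \<sigma> \<Longrightarrow> filt K w \<le> filt K (top_vertex K \<sigma>)"
    using fos_ordD(3)[OF assms(1)] by (metis order_refl)
qed

lemma pmax_eqI:
  assumes "q \<in> A" "\<And>q'. q' \<in> A \<Longrightarrow> q' \<le> q"
  shows "pmax A = q"
  unfolding pmax_def
  by (rule the_equality) (use assms in \<open>auto intro: antisym\<close>)

text \<open>Monotonicity of \<open>filt\<close> along \<open>ord\<close> lets the last vertex attain
  the maximal stratum, so that \<open>pmax\<close> is well defined on simplices.\<close>

lemma pmax_simplex:
  assumes "fos_complex K" "\<sigma> \<in> simps K"
  shows "pmax (filt K ` \<sigma>) = filt K (top_vertex K \<sigma>)"
  by (rule pmax_eqI) (use top_vertex[OF assms] in auto)

lemma realp_eqI: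
  assumes "u \<in> supp t" "filt K u = q" "\<And>v. v \<in> supp t \<Longrightarrow> filt K v \<le> q"
  shows "realp K t = q"
  unfolding realp_def by (rule pmax_eqI) (use assms in auto)

lemma real_carrierD:
  assumes "t \<in> real_carrier K"
  shows "0 \<le> t v" "supp t \<in> simps K" "sum t (supp t) = 1"
  using assms by (auto simp: real_carrier_def)

lemma realp_props:
  assumes "fos_complex K" "t \<in> real_carrier K"
  shows realp_attained: "\<exists>v\<in>supp t. filt K v = realp K t"
    and realp_upper: "\<And>v. v \<in> supp t \<Longrightarrow> filt K v \<le> realp K t"
  using top_vertex[OF assms(1) real_carrierD(2)[OF assms(2)]]
    pmax_simplex[OF assms(1) real_carrierD(2)[OF assms(2)]]
  unfolding realp_def by auto

lemma sum_supp_eq: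
  fixes t :: "'v \<Rightarrow> real"
  assumes "finite A" "supp t \<subseteq> A"
  shows "sum t (supp t) = sum t A"
  by (rule sum.mono_neutral_left) (use assms in \<open>auto simp: supp_def\<close>)

lemma real_carrierI:
  assumes "\<And>v. 0 \<le> t v" "finite A" "supp t \<subseteq> A" "sum t A = 1"
    and "fos_complex K" "\<sigma> \<in> simps K" "supp t \<subseteq> \<sigma>"
  shows "t \<in> real_carrier K"
proof -
  have s: "sum t (supp t) = 1" using sum_supp_eq assms by metis
  then have "supp t \<noteq> {}" by auto
  then show ?thesis
    using assms(1) s fos_face[OF assms(5-7)] by (simp add: real_carrier_def)
qed

lemma closed_simplex_iff_carrier:
  assumes "fos_complex K" "\<sigma> \<in> simps K"
  shows "t \<in> closed_simplex \<sigma> \<longleftrightarrow> t \<in> real_carrier K \<and> supp t \<subseteq> \<sigma>"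
proof
  assume t: "t \<in> closed_simplex \<sigma>"
  then have "supp t \<subseteq> \<sigma>" by (auto simp: closed_simplex_def supp_def)
  with t show "t \<in> real_carrier K \<and> supp t \<subseteq> \<sigma>"
    using real_carrierI[of t \<sigma> K \<sigma>] assms fos_simplexD[OF assms] by (auto simp: closed_simplex_def)
next
  assume "t \<in> real_carrier K \<and> supp t \<subseteq> \<sigma>"
  then show "t \<in> closed_simplex \<sigma>"
    using sum_supp_eq[of \<sigma> t] fos_simplexD[OF assms] real_carrierD[of t K]
    by (auto simp: closed_simplex_def supp_def)
qed

section \<open>The weak topology on a realization\<close>

lemma istopology_geom:
  "istopology (\<lambda>U. U \<subseteq> real_carrier K \<and>
     (\<forall>\<sigma>\<in>simps K. openin (subtopology (powertop_real UNIV) (closed_simplex \<sigma>))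
                               (U \<inter> closed_simplex \<sigma>)))"
  unfolding istopology_def
proof (rule conjI; intro allI impI)
  fix S T assume a: "S \<subseteq> real_carrier K \<and> (\<forall>\<sigma>\<in>simps K. openin (subtopology (powertop_real UNIV) (closed_simplex \<sigma>)) (S \<inter> closed_simplex \<sigma>))"
   "T \<subseteq> real_carrier K \<and> (\<forall>\<sigma>\<in>simps K. openin (subtopology (powertop_real UNIV) (closed_simplex \<sigma>)) (T \<inter> closed_simplex \<sigma>))"
  have "S \<inter> T \<inter> C = (S \<inter> C) \<inter> (T \<inter> C)" for C by auto
  with a show "S \<inter> T \<subseteq> real_carrier K \<and> (\<forall>\<sigma>\<in>simps K. openin (subtopology (powertop_real UNIV) (closed_simplex \<sigma>)) (S \<inter> T \<inter> closed_simplex \<sigma>))"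
    by (simp add: openin_Int le_infI1)
next
  fix \<K> assume a: "\<forall>S\<in>\<K>. S \<subseteq> real_carrier K \<and> (\<forall>\<sigma>\<in>simps K. openin (subtopology (powertop_real UNIV) (closed_simplex \<sigma>)) (S \<inter> closed_simplex \<sigma>))"
  have "\<Union>\<K> \<inter> C = \<Union>((\<lambda>S. S \<inter> C) ` \<K>)" for C by auto
  moreover have "openin (subtopology (powertop_real UNIV) (closed_simplex \<sigma>)) (\<Union>((\<lambda>S. S \<inter> closed_simplex \<sigma>) ` \<K>))"
    if "\<sigma> \<in> simps K" for \<sigma>
    using a that by (intro openin_Union) auto
  ultimately show "\<Union>\<K> \<subseteq> real_carrier K \<and> (\<forall>\<sigma>\<in>simps K. openin (subtopology (powertop_real UNIV) (closed_simplex \<sigma>)) (\<Union>\<K> \<inter> closed_simplex \<sigma>))"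
    using a by (metis Sup_le_iff)
qed

lemma openin_geom_top:
  "openin (geom_top K) U \<longleftrightarrow> U \<subseteq> real_carrier K \<and>
     (\<forall>\<sigma>\<in>simps K. openin (top_of_set (closed_simplex \<sigma>)) (U \<inter> closed_simplex \<sigma>))"
  unfolding geom_top_def
  by (subst topology_inverse'[OF istopology_geom]) (simp add: euclidean_product_topology)

lemma topspace_geom_top:
  assumes "fos_complex K"
  shows "topspace (geom_top K) = real_carrier K"
proof -
  have "openin (geom_top K) (real_carrier K)"
    unfolding openin_geom_top
    using closed_simplex_iff_carrier[OF assms]
    by (metis Int_absorb1 openin_subtopology_self subsetI order_refl)
  moreover have "topspace (geom_top K) \<subseteq> real_carrier K"
    using openin_geom_top openin_topspace by blast
  ultimately show ?thesis using openin_subset by blast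
qed

lemma closed_closed_simplex: "finite \<sigma> \<Longrightarrow> closed (closed_simplex \<sigma>)"
proof -
  assume f: "finite \<sigma>"
  have eq: "closed_simplex \<sigma> = (\<Inter>v. {t. 0 \<le> t v}) \<inter> (\<Inter>v\<in>-\<sigma>. {t. t v = 0}) \<inter> {t. (\<Sum>v\<in>\<sigma>. t v) = 1}"
    by (auto simp: closed_simplex_def)
  show ?thesis unfolding eq
    by (intro closed_Int closed_INT ballI closed_Collect_le closed_Collect_eq continuous_intros
        continuous_on_product_coordinates)
qed

text \<open>The trace is closed in the whole function space, since closed simplices are closed
  there; preimages can then be taken along maps into the product topology.\<close>

lemma closedin_geom_top_trace:
  assumes "fos_complex K" "closedin (geom_top K) C" "\<sigma> \<in> simps K"
  shows "closed (C \<inter> closed_simplex \<sigma>)"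
proof -
  let ?C = "closed_simplex \<sigma>"
  have o: "openin (geom_top K) (real_carrier K - C)" and sub: "C \<subseteq> real_carrier K"
    using assms(2) by (auto simp: closedin_def topspace_geom_top[OF assms(1)])
  then have "openin (top_of_set ?C) ((real_carrier K - C) \<inter> ?C)"
    using assms by (simp add: openin_geom_top)
  moreover have "(real_carrier K - C) \<inter> ?C = ?C - (C \<inter> ?C)"
    using closed_simplex_iff_carrier[OF assms(1,3)] by auto
  ultimately have "closedin (top_of_set ?C) (C \<inter> ?C)" by (auto simp: closedin_def)
  then show ?thesis
    using closed_closed_simplex fos_simplexD(1)[OF assms(1,3)] closedin_closed_trans by blast
qed

lemma closedin_geom_topI:
  assumes "fos_complex K" "C \<subseteq> real_carrier K" "\<And>\<sigma>. \<sigma> \<in> simps K \<Longrightarrow> closed (C \<inter> closed_simplex \<sigma>)"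
  shows "closedin (geom_top K) C"
  unfolding closedin_def topspace_geom_top[OF assms(1)] openin_geom_top
proof (intro conjI ballI)
  fix \<sigma> assume \<sigma>: "\<sigma> \<in> simps K"
  have "(real_carrier K - C) \<inter> closed_simplex \<sigma> = closed_simplex \<sigma> - (C \<inter> closed_simplex \<sigma>)"
    using closed_simplex_iff_carrier[OF assms(1) \<sigma>] by auto
  moreover have "closedin (top_of_set (closed_simplex \<sigma>)) (C \<inter> closed_simplex \<sigma>)"
    by (simp add: assms(3)[OF \<sigma>] closed_subset)
  ultimately show "openin (top_of_set (closed_simplex \<sigma>)) ((real_carrier K - C) \<inter> closed_simplex \<sigma>)"
    by (simp add: closedin_def)
qed (use assms in auto)

lemma continuous_map_geom_topI:
  assumes "fos_complex L" and C: "\<And>x. x \<in> topspace X \<Longrightarrow> F x \<in> real_carrier L"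
    and cont: "\<And>u. continuous_map X euclideanreal (\<lambda>x. F x u)"
    and W: "finite W" "\<And>x. x \<in> topspace X \<Longrightarrow> supp (F x) \<subseteq> W"
  shows "continuous_map X (geom_top L) F"
  unfolding continuous_map_closedin
proof (intro conjI allI impI)
  show "F \<in> topspace X \<rightarrow> topspace (geom_top L)" using C topspace_geom_top[OF assms(1)] by simp
next
  fix D assume D: "closedin (geom_top L) D"
  have c: "continuous_map X euclidean F"
    unfolding euclidean_product_topology[symmetric]
    using cont by (simp add: continuous_map_componentwise_UNIV)
  let ?\<S> = "{\<sigma>\<in>simps L. \<sigma> \<subseteq> W}"
  have fin: "finite ?\<S>" using W(1) by simp
  have eq: "{x \<in> topspace X. F x \<in> D} = (\<Union>\<sigma>\<in>?\<S>. {x \<in> topspace X. F x \<in> D \<inter> closed_simplex \<sigma>})"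
  proof (intro equalityI subsetI)
    fix x assume x: "x \<in> {x \<in> topspace X. F x \<in> D}"
    then have "F x \<in> closed_simplex (supp (F x))" "supp (F x) \<in> simps L"
      using closed_simplex_iff_carrier[OF assms(1)] C real_carrierD(2) by blast+
    with x W show "x \<in> (\<Union>\<sigma>\<in>?\<S>. {x \<in> topspace X. F x \<in> D \<inter> closed_simplex \<sigma>})" by auto
  qed auto
  have "closedin X {x \<in> topspace X. F x \<in> D \<inter> closed_simplex \<sigma>}" if "\<sigma> \<in> ?\<S>" for \<sigma>
    using closedin_continuous_map_preimage[OF c, of "D \<inter> closed_simplex \<sigma>"]
      closedin_geom_top_trace[OF assms(1) D] that by simp
  then show "closedin X {x \<in> topspace X. F x \<in> D}"
    unfolding eq using fin by (intro closedin_Union) auto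
qed

lemma continuous_map_geom_coordinate:
  assumes "fos_complex L"
  shows "continuous_map (geom_top L) euclideanreal (\<lambda>t. t u)"
  unfolding continuous_map_def topspace_geom_top[OF assms] openin_geom_top
proof (intro conjI allI impI ballI)
  fix V :: "real set" and \<sigma> assume V: "openin euclideanreal V" and \<sigma>: "\<sigma> \<in> simps L"
  have "open ((\<lambda>t. t u) -` V)"
    using V continuous_on_open_vimage[OF open_UNIV, of "\<lambda>t. t u"] continuous_on_product_coordinates[of u]
    by (metis Int_UNIV_right open_openin)
  moreover have "{x \<in> real_carrier L. x u \<in> V} \<inter> closed_simplex \<sigma> = closed_simplex \<sigma> \<inter> ((\<lambda>t. t u) -` V)"
    using closed_simplex_iff_carrier[OF assms \<sigma>] by auto
  ultimately show "openin (top_of_set (closed_simplex \<sigma>)) ({x \<in> real_carrier L. x u \<in> V} \<inter> closed_simplex \<sigma>)"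
    by (simp add: openin_open_Int)
qed auto

text \<open>One point per open simplex that is met gives a closed discrete set, which must be finite
  by compactness.\<close>

lemma compact_finite_support:
  fixes L :: "('w, 'p::order) fos"
  assumes "fos_complex L" "compact_space X" "continuous_map X (geom_top L) F"
  shows "\<exists>W. finite W \<and> (\<forall>x\<in>topspace X. supp (F x) \<subseteq> W)"
proof -
  let ?I = "F ` topspace X"
  have comp: "compactin (geom_top L) ?I"
    using image_compactin[OF _ assms(3)] assms(2) by (simp add: compact_space_def)
  have Isub: "?I \<subseteq> real_carrier L"
    using compactin_subset_topspace[OF comp] topspace_geom_top[OF assms(1)] by simp
  define c where "c = inv_into ?I supp"
  have c: "c \<sigma> \<in> ?I \<and> supp (c \<sigma>) = \<sigma>" if "\<sigma> \<in> supp ` ?I" for \<sigma>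
    unfolding c_def using inv_into_into[OF that] f_inv_into_f[OF that] by simp
  define Y where "Y = c ` supp ` ?I"
  have YI: "Y \<subseteq> ?I" unfolding Y_def using c by blast
  have injY: "inj_on supp Y" unfolding Y_def inj_on_def using c by auto
  \<comment> \<open>Distinct points of \<open>Y\<close> have distinct supports, so a closed simplex,
    having finitely many faces, meets \<open>Y\<close> in a finite set.\<close>
  have cl: "closedin (geom_top L) Y'" if "Y' \<subseteq> Y" for Y'
  proof (rule closedin_geom_topI[OF assms(1)])
    show "Y' \<subseteq> real_carrier L" using that YI Isub by auto
    fix \<sigma> assume \<sigma>: "\<sigma> \<in> simps L"
    have "supp ` (Y' \<inter> closed_simplex \<sigma>) \<subseteq> Pow \<sigma>"
      using closed_simplex_iff_carrier[OF assms(1) \<sigma>] by auto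
    then have "finite (supp ` (Y' \<inter> closed_simplex \<sigma>))"
      using fos_simplexD(1)[OF assms(1) \<sigma>] finite_subset by blast
    moreover have "inj_on supp (Y' \<inter> closed_simplex \<sigma>)"
      using injY that by (meson inf_le1 inj_on_subset order_trans)
    ultimately have "finite (Y' \<inter> closed_simplex \<sigma>)" by (rule finite_imageD)
    moreover have cl1: "closed {y}" for y :: "'w \<Rightarrow> real"
    proof -
      have "{y} = (\<Inter>v. {t. t v = y v})" by auto
      also have "closed \<dots>"
        by (intro closed_INT ballI closed_Collect_eq continuous_intros continuous_on_product_coordinates)
      finally show ?thesis .
    qed
    ultimately have "closed (\<Union>y\<in>Y' \<inter> closed_simplex \<sigma>. {y})"
      by (intro closed_UN ballI cl1)
    then show "closed (Y' \<inter> closed_simplex \<sigma>)" by simp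
  qed
  have "finite Y"
  proof (cases "Y = {}")
    case False
    \<comment> \<open>\<open>?U y\<close> is an open set meeting \<open>Y\<close> only in
      \<open>y\<close>, so a finite subcover of the image bounds \<open>Y\<close>.\<close>
    let ?U = "\<lambda>y. real_carrier L - (Y - {y})"
    have "openin (geom_top L) (?U y)" for y
      using cl[of "Y - {y}"] topspace_geom_top[OF assms(1)] by (auto simp: closedin_def)
    moreover have "?I \<subseteq> \<Union>(?U ` Y)" using Isub False by auto
    ultimately obtain \<F> where \<F>: "finite \<F>" "\<F> \<subseteq> ?U ` Y" "?I \<subseteq> \<Union>\<F>"
      using comp unfolding compactin_def by (metis (no_types, lifting) imageE)
    then obtain Z where Z: "finite Z" "Z \<subseteq> Y" "\<F> = ?U ` Z" by (meson finite_subset_image)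
    have "Y \<subseteq> Z"
    proof
      fix y assume "y \<in> Y"
      then have "y \<in> \<Union>\<F>" using \<F>(3) YI by blast
      then obtain z where "z \<in> Z" "y \<in> ?U z" unfolding Z(3) by blast
      then show "y \<in> Z" using \<open>y \<in> Y\<close> by auto
    qed
    then show ?thesis using Z finite_subset by auto
  qed auto
  then have "finite (supp ` Y)" by simp
  moreover have "supp ` Y = supp ` ?I"
  proof -
    have "supp ` c ` supp ` ?I = (\<lambda>\<sigma>. \<sigma>) ` supp ` ?I"
      unfolding image_image[of supp c] by (rule image_cong) (use c in auto)
    then show ?thesis unfolding Y_def by simp
  qed
  ultimately have f: "finite (supp ` ?I)" by simp
  have "finite \<sigma>" if "\<sigma> \<in> supp ` ?I" for \<sigma>
    using that Isub fos_simplexD(1)[OF assms(1)] real_carrierD(2) by blast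
  with f have "finite (\<Union>(supp ` ?I))" by (rule finite_Union)
  then show ?thesis by (intro exI[of _ "\<Union>(supp ` ?I)"]) auto
qed

section \<open>Finite complexes and stratified homotopies\<close>

lemma fos_finite_simps:
  assumes "fos_complex E" "fos_finite E"
  shows "finite (simps E)"
proof -
  have "simps E \<subseteq> Pow (verts E)" using fos_simplexD(3)[OF assms(1)] by blast
  then show ?thesis using assms(2) by (meson finite_Pow_iff finite_subset fos_finite_def)
qed

text \<open>Coordinates range over the whole type, which may be infinite, so compactness comes from
  Tychonoff's theorem for the cube.\<close>

lemma compact_closed_simplex:
  fixes \<sigma> :: "'v set"
  assumes "finite \<sigma>"
  shows "compact (closed_simplex \<sigma>)"
proof -
  have "compact (PiE UNIV (\<lambda>_::'v. {0..1::real}))"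
    using compactin_PiE[of "\<lambda>_. euclideanreal" UNIV "\<lambda>_. {0..1::real}"]
    by (simp add: euclidean_product_topology)
  then have "compact (PiE UNIV (\<lambda>_::'v. {0..1::real}) \<inter> closed_simplex \<sigma>)"
    using closed_closed_simplex[OF assms] by (rule compact_Int_closed)
  moreover have "closed_simplex \<sigma> \<subseteq> PiE UNIV (\<lambda>_::'v. {0..1::real})"
  proof
    fix t :: "'v \<Rightarrow> real" assume t: "t \<in> closed_simplex \<sigma>"
    have "t v \<le> 1" for v
    proof (cases "v \<in> \<sigma>")
      case True
      then have "t v \<le> sum t \<sigma>"
        using t assms by (intro member_le_sum) (auto simp: closed_simplex_def)
      then show ?thesis using t by (simp add: closed_simplex_def)
    qed (use t in \<open>simp add: closed_simplex_def\<close>)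
    then show "t \<in> PiE UNIV (\<lambda>_. {0..1})" using t by (simp add: closed_simplex_def PiE_UNIV_domain)
  qed
  ultimately show ?thesis by (simp add: Int_absorb1)
qed

lemma compact_real_carrier:
  assumes "fos_complex E" "fos_finite E"
  shows "compact (real_carrier E)"
proof -
  have "real_carrier E = (\<Union>\<sigma>\<in>simps E. closed_simplex \<sigma>)"
    using closed_simplex_iff_carrier[OF assms(1)] real_carrierD(2) by blast
  moreover have "compact (closed_simplex \<sigma>)" if "\<sigma> \<in> simps E" for \<sigma>
    using compact_closed_simplex fos_simplexD(1)[OF assms(1) that] by blast
  ultimately show ?thesis using fos_finite_simps[OF assms] by auto
qed

lemma supp_verts:
  assumes "fos_complex K" "t \<in> real_carrier K"
  shows "supp t \<subseteq> verts K" "finite (supp t)" "supp t \<noteq> {}"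
  using real_carrierD(2)[OF assms(2)] fos_simplexD[OF assms(1)] by blast+

text \<open>On a finite complex the vertex set bounds all supports, so the coordinates determine the
  weak topology and continuity on it becomes \<open>continuous_on\<close>.\<close>

lemma geom_top_finite:
  assumes "fos_complex E" "fos_finite E"
  shows "geom_top E = top_of_set (real_carrier E)"
proof -
  let ?C = "real_carrier E"
  have "continuous_map (geom_top E) euclidean (\<lambda>t. t)"
    unfolding euclidean_product_topology[symmetric]
    using continuous_map_geom_coordinate[OF assms(1)] by (simp add: continuous_map_componentwise_UNIV)
  then have "continuous_map (geom_top E) (top_of_set ?C) (\<lambda>t. t)"
    by (rule continuous_map_into_subtopology) (simp add: topspace_geom_top[OF assms(1)])
  moreover have "continuous_map (top_of_set ?C) (geom_top E) (\<lambda>t. t)"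
  proof (rule continuous_map_geom_topI[OF assms(1)])
    show "continuous_map (top_of_set ?C) euclideanreal (\<lambda>x. x u)" for u
      by (simp add: continuous_on_subset[OF continuous_on_product_coordinates])
  qed (use assms supp_verts[OF assms(1)] in \<open>auto simp: fos_finite_def\<close>)
  moreover have "{t \<in> ?C. t \<in> U} = U" if "openin (geom_top E) U \<or> openin (top_of_set ?C) U" for U
    using that openin_subset[of "geom_top E" U] openin_subset[of "top_of_set ?C" U]
    by (auto simp: topspace_geom_top[OF assms(1)])
  ultimately have "openin (geom_top E) U \<longleftrightarrow> openin (top_of_set ?C) U" for U
    using openin_continuous_map_preimage[of "geom_top E" "top_of_set ?C" "\<lambda>t. t" U]
      openin_continuous_map_preimage[of "top_of_set ?C" "geom_top E" "\<lambda>t. t" U]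
    by (auto simp: topspace_geom_top[OF assms(1)])
  then show ?thesis by (simp add: topology_eq)
qed

lemma strat_presI:
  assumes "fos_complex E" "fos_finite E" "fos_complex L"
    and "\<And>t. t \<in> real_carrier E \<Longrightarrow> \<phi> t \<in> real_carrier L"
    and "\<And>u. continuous_on (real_carrier E) (\<lambda>t. \<phi> t u)"
    and "finite W" "\<And>t. t \<in> real_carrier E \<Longrightarrow> supp (\<phi> t) \<subseteq> W"
    and "\<And>t. t \<in> real_carrier E \<Longrightarrow> realp L (\<phi> t) = realp E t"
  shows "strat_pres E L \<phi>"
  unfolding strat_pres_def geom_top_finite[OF assms(1,2)]
  by (intro conjI ballI continuous_map_geom_topI[where W = W]) (use assms in auto)

lemma strat_presD:
  assumes "fos_complex E" "fos_complex L" "strat_pres E L \<phi>" "t \<in> real_carrier E"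
  shows "\<phi> t \<in> real_carrier L" "realp L (\<phi> t) = realp E t"
  using assms continuous_map_funspace[of "geom_top E" "geom_top L" \<phi>]
  by (auto simp: strat_pres_def topspace_geom_top)

lemma strat_pres_coordinate:
  assumes "fos_complex E" "fos_finite E" "fos_complex L" "strat_pres E L \<phi>"
  shows "continuous_on (real_carrier E) (\<lambda>t. \<phi> t u)"
  using continuous_map_compose[OF _ continuous_map_geom_coordinate[OF assms(3)], of "geom_top E" \<phi> u]
    assms(4) unfolding strat_pres_def geom_top_finite[OF assms(1,2)] by (simp add: o_def)

lemma strat_pres_finite_support:
  assumes "fos_complex E" "fos_finite E" "fos_complex L" "strat_pres E L \<phi>"
  shows "\<exists>W. finite W \<and> (\<forall>t\<in>real_carrier E. supp (\<phi> t) \<subseteq> W)"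
proof -
  have "compact_space (geom_top E)"
    using compact_real_carrier[OF assms(1,2)] by (simp add: geom_top_finite[OF assms(1,2)] compact_space_subtopology)
  then show ?thesis
    using compact_finite_support[OF assms(3), of "geom_top E" \<phi>] assms(4)
    unfolding strat_pres_def topspace_geom_top[OF assms(1)] by blast
qed

text \<open>Joint continuity of each single coordinate is enough, because all values are supported
  in the finite set \<open>W\<close>.\<close>

lemma strat_htpyI:
  fixes E :: "('v, 'p::order) fos" and L :: "('w, 'p) fos" and H :: "real \<Rightarrow> ('v \<Rightarrow> real) \<Rightarrow> 'w \<Rightarrow> real"
  assumes "fos_complex E" "fos_finite E" "fos_complex L"
    and C: "\<And>s t. 0 \<le> s \<Longrightarrow> s \<le> 1 \<Longrightarrow> t \<in> real_carrier E \<Longrightarrow> H s t \<in> real_carrier L"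
    and cont: "\<And>u. continuous_on ({0..1} \<times> real_carrier E) (\<lambda>(s, t). H s t u)"
    and W: "finite W" "\<And>s t. 0 \<le> s \<Longrightarrow> s \<le> 1 \<Longrightarrow> t \<in> real_carrier E \<Longrightarrow> supp (H s t) \<subseteq> W"
    and P: "\<And>s t. 0 \<le> s \<Longrightarrow> s \<le> 1 \<Longrightarrow> t \<in> real_carrier E \<Longrightarrow> realp L (H s t) = realp E t"
    and 0: "\<And>t. t \<in> real_carrier E \<Longrightarrow> H 0 t = f t"
    and 1: "\<And>t. t \<in> real_carrier E \<Longrightarrow> H 1 t = g t"
  shows "strat_htpy E L f g"
  unfolding strat_htpy_def
proof (subst homotopic_with)
  fix h k :: "('v \<Rightarrow> real) \<Rightarrow> 'w \<Rightarrow> real"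
  assume "\<And>x. x \<in> topspace (geom_top E) \<Longrightarrow> h x = k x"
  then show "(\<forall>t\<in>real_carrier E. realp L (h t) = realp E t) \<longleftrightarrow> (\<forall>t\<in>real_carrier E. realp L (k t) = realp E t)"
    by (simp add: topspace_geom_top[OF assms(1)])
next
  have "continuous_map (prod_topology (top_of_set {0..1::real}) (geom_top E)) (geom_top L) (\<lambda>(s, t). H s t)"
    unfolding geom_top_finite[OF assms(1,2)] prod_topology_subtopology_eu
  proof (rule continuous_map_geom_topI[OF assms(3) _ _ W(1)])
    show "supp (case z of (s, t) \<Rightarrow> H s t) \<subseteq> W"
      if "z \<in> topspace (top_of_set ({0..1} \<times> real_carrier E))" for z
      using that W(2)[of "fst z" "snd z"] by (simp add: case_prod_unfold mem_Times_iff)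
  qed (use C cont in \<open>auto simp: case_prod_unfold\<close>)
  then show "\<exists>h. continuous_map (prod_topology (top_of_set {0..1::real}) (geom_top E)) (geom_top L) h \<and>
      (\<forall>x\<in>topspace (geom_top E). h (0, x) = f x) \<and> (\<forall>x\<in>topspace (geom_top E). h (1, x) = g x) \<and>
      (\<forall>s\<in>{0..1}. \<forall>t\<in>real_carrier E. realp L (h (s, t)) = realp E t)"
    unfolding topspace_geom_top[OF assms(1)] using P 0 1
    by - (rule exI[of _ "\<lambda>(s, t). H s t"], auto)
qed

lemma strat_htpy_cong:
  assumes "fos_complex E" "strat_htpy E L f g"
    and "\<And>t. t \<in> real_carrier E \<Longrightarrow> f' t = f t" "\<And>t. t \<in> real_carrier E \<Longrightarrow> g' t = g t"
  shows "strat_htpy E L f' g'"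
  using assms(2) unfolding strat_htpy_def
  by (rule homotopic_with_eq) (use assms topspace_geom_top[OF assms(1)] in auto)

lemma strat_htpy_sym: "strat_htpy E L f g \<Longrightarrow> strat_htpy E L g f"
  unfolding strat_htpy_def by (rule homotopic_with_symD)

lemma strat_htpy_trans [trans]: "strat_htpy E L f g \<Longrightarrow> strat_htpy E L g h \<Longrightarrow> strat_htpy E L f h"
  unfolding strat_htpy_def by (rule homotopic_with_trans)

lemma strat_pres_compose:
  assumes "fos_complex E" "fos_complex F" "strat_pres E F f" "strat_pres F L g"
  shows "strat_pres E L (g \<circ> f)"
  unfolding strat_pres_def
proof (intro conjI ballI)
  show "continuous_map (geom_top E) (geom_top L) (g \<circ> f)"
    using assms(3,4) continuous_map_compose unfolding strat_pres_def by blast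
  show "realp L ((g \<circ> f) t) = realp E t" if "t \<in> real_carrier E" for t
    using strat_presD[OF assms(1-3) that] assms(4) by (simp add: strat_pres_def)
qed

lemma strat_htpy_compose_left:
  assumes "fos_complex E" "fos_complex F" "strat_htpy E F f g" "strat_pres F L \<phi>"
    "strat_pres E F f"
  shows "strat_htpy E L (\<phi> \<circ> f) (\<phi> \<circ> g)"
proof -
  obtain h where h: "continuous_map (prod_topology (top_of_set {0..1::real}) (geom_top E)) (geom_top F) h"
    "\<And>x. h (0, x) = f x" "\<And>x. h (1, x) = g x"
    "\<And>s t. s \<in> {0..1} \<Longrightarrow> t \<in> real_carrier E \<Longrightarrow> realp F (h (s, t)) = realp E t"
    using assms(3) unfolding strat_htpy_def homotopic_with_def by metis
  have C: "h (s, t) \<in> real_carrier F" if "s \<in> {0..1}" "t \<in> real_carrier E" for s t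
    using continuous_map_funspace[OF h(1)] that
    by (auto simp: topspace_geom_top[OF assms(1)] topspace_geom_top[OF assms(2)])
  have "continuous_map (prod_topology (top_of_set {0..1::real}) (geom_top E)) (geom_top L) (\<phi> \<circ> h)"
    using assms(4) unfolding strat_pres_def by (intro continuous_map_compose[OF h(1)]) simp
  then show ?thesis
    unfolding strat_htpy_def homotopic_with_def
    using h C assms(4) by (intro exI[of _ "\<phi> \<circ> h"]) (auto simp: strat_pres_def)
qed

lemma strat_htpy_compose_right:
  assumes "fos_complex E" "fos_complex F" "strat_htpy F L f g" "strat_pres E F \<psi>"
  shows "strat_htpy E L (f \<circ> \<psi>) (g \<circ> \<psi>)"
  unfolding strat_htpy_def
  by (rule homotopic_with_compose_continuous_map_right[OF assms(3)[unfolded strat_htpy_def]])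
    (use assms(4) strat_presD[OF assms(1,2,4)] in \<open>auto simp: strat_pres_def\<close>)

text \<open>All vertices of both supports have strata at most \<open>q\<close>, and each support
  attains \<open>q\<close>; keeping either support therefore keeps the stratum.\<close>

lemma realp_Un_eqI:
  assumes "fos_complex L" "y \<in> real_carrier L" "y' \<in> real_carrier L" "realp L y = q" "realp L y' = q"
    and "supp z \<subseteq> supp y \<union> supp y'" "supp y \<subseteq> supp z \<or> supp y' \<subseteq> supp z"
  shows "realp L z = q"
proof -
  obtain u where "u \<in> supp z" "filt L u = q"
    using assms(7) realp_attained[OF assms(1,2)] realp_attained[OF assms(1,3)]
    unfolding assms(4,5) by (meson subsetD)
  moreover have "filt L v \<le> q" if "v \<in> supp z" for v
    using that assms(6) realp_upper[OF assms(1,2), of v] realp_upper[OF assms(1,3), of v]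
    unfolding assms(4,5) by (meson UnE subsetD)
  ultimately show ?thesis by (rule realp_eqI)
qed

lemma straight_line_htpy:
  assumes "fos_complex E" "fos_finite E" "fos_complex L" "strat_pres E L f" "strat_pres E L g"
    and S: "\<And>t. t \<in> real_carrier E \<Longrightarrow> supp (f t) \<union> supp (g t) \<in> simps L"
  shows "strat_htpy E L f g"
proof -
  let ?H = "\<lambda>s t u. (1 - s) * f t u + s * g t u"
  obtain V where V: "finite V" "\<And>t. t \<in> real_carrier E \<Longrightarrow> supp (f t) \<subseteq> V"
    using strat_pres_finite_support[OF assms(1-4)] by blast
  obtain W where W: "finite W" "\<And>t. t \<in> real_carrier E \<Longrightarrow> supp (g t) \<subseteq> W"
    using strat_pres_finite_support[OF assms(1-3,5)] by blast
  note f = strat_presD[OF assms(1,3,4)] and g = strat_presD[OF assms(1,3,5)]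
  have H: "?H s t \<in> real_carrier L \<and> supp (?H s t) \<subseteq> V \<union> W \<and> realp L (?H s t) = realp E t"
    if s: "0 \<le> s" "s \<le> 1" and t: "t \<in> real_carrier E" for s t
  proof -
    have nn: "0 \<le> f t u" "0 \<le> g t u" for u
      using real_carrierD(1)[OF f(1)[OF t]] real_carrierD(1)[OF g(1)[OF t]] by simp_all
    have sub: "supp (?H s t) \<subseteq> supp (f t) \<union> supp (g t)" by (auto simp: supp_def)
    \<comment> \<open>For \<open>s > 0\<close> no vertex of \<open>supp (g t)\<close> is lost, by
      nonnegativity; at \<open>s = 0\<close> the point is \<open>f t\<close>.\<close>
    have "supp (f t) \<subseteq> supp (?H s t) \<or> supp (g t) \<subseteq> supp (?H s t)"
    proof (cases "s = 0")
      case False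
      then have "?H s t u \<noteq> 0" if "g t u \<noteq> 0" for u
        using s nn[of u] that add_nonneg_pos[of "(1 - s) * f t u" "s * g t u"] by (simp add: less_le)
      then show ?thesis by (auto simp: supp_def)
    qed auto
    then have r: "realp L (?H s t) = realp E t"
      by (rule realp_Un_eqI[OF assms(3) f(1)[OF t] g(1)[OF t] f(2)[OF t] g(2)[OF t] sub])
    let ?U = "V \<union> W"
    have "sum (?H s t) ?U = (1 - s) * sum (f t) ?U + s * sum (g t) ?U"
      by (simp add: sum.distrib sum_distrib_left)
    also have "sum (f t) ?U = 1"
      using sum_supp_eq[of ?U "f t"] V W t real_carrierD(3)[OF f(1)[OF t]] by force
    also have "sum (g t) ?U = 1"
      using sum_supp_eq[of ?U "g t"] V W t real_carrierD(3)[OF g(1)[OF t]] by force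
    finally have s1: "sum (?H s t) ?U = 1" by simp
    have VW: "supp (f t) \<union> supp (g t) \<subseteq> V \<union> W" using V(2)[OF t] W(2)[OF t] by blast
    have "?H s t \<in> real_carrier L"
      by (rule real_carrierI[of _ ?U, OF _ _ _ s1 assms(3) S[OF t]])
        (use nn s V(1) W(1) sub subset_trans[OF sub VW] in \<open>auto simp: add_nonneg_nonneg\<close>)
    then show ?thesis using r subset_trans[OF sub VW] by simp
  qed
  show ?thesis
  proof (rule strat_htpyI[OF assms(1-3), of ?H "V \<union> W"])
    fix u
    have "continuous_on ({0..1} \<times> real_carrier E) (\<lambda>z. f (snd z) u)"
      by (rule continuous_on_compose2[OF strat_pres_coordinate[OF assms(1-4)]])
        (auto intro: continuous_intros)
    moreover have "continuous_on ({0..1} \<times> real_carrier E) (\<lambda>z. g (snd z) u)"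
      by (rule continuous_on_compose2[OF strat_pres_coordinate[OF assms(1-3,5)]])
        (auto intro: continuous_intros)
    ultimately show "continuous_on ({0..1} \<times> real_carrier E) (\<lambda>(s, t). ?H s t u)"
      unfolding case_prod_unfold by (intro continuous_intros)
  qed (use H V W in auto)
qed

section \<open>Affine maps\<close>

text \<open>Affine extension of a placement \<open>p\<close> of the vertices. It unifies
  \<open>real_map\<close>, \<open>bary_sd\<close> and the modified subdivision maps, which differ
  only in \<open>p\<close>.\<close>

definition aff :: "('v \<Rightarrow> 'w \<Rightarrow> real) \<Rightarrow> ('v \<Rightarrow> real) \<Rightarrow> 'w \<Rightarrow> real" where
  "aff p x = (\<lambda>c. \<Sum>w\<in>supp x. x w * p w c)"

text \<open>Nonnegativity excludes cancellation.\<close>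

lemma supp_aff:
  assumes "finite (supp x)" "\<And>w. 0 \<le> x w" "\<And>w c. w \<in> supp x \<Longrightarrow> 0 \<le> p w c"
  shows "supp (aff p x) = (\<Union>w\<in>supp x. supp (p w))"
proof -
  have "aff p x c = 0 \<longleftrightarrow> (\<forall>w\<in>supp x. p w c = 0)" for c
    unfolding aff_def using assms
    by (subst sum_nonneg_eq_0_iff) (auto simp: supp_def)
  then show ?thesis by (auto simp: supp_def)
qed

lemma aff_superset: "finite A \<Longrightarrow> supp x \<subseteq> A \<Longrightarrow> aff p x c = (\<Sum>w\<in>A. x w * p w c)"
  unfolding aff_def by (rule sum.mono_neutral_left) (auto simp: supp_def)

text \<open>Composites of affine extensions are affine; this turns the iterated subdivision map into
  a single placement of vertices.\<close>

lemma aff_aff: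
  assumes "finite (supp x)" "\<And>w. w \<in> supp x \<Longrightarrow> finite (supp (r w))"
  shows "aff p (aff r x) c = aff (\<lambda>w. aff p (r w)) x c"
proof -
  let ?A = "\<Union>w\<in>supp x. supp (r w)"
  have fin: "finite ?A" using assms by auto
  have "supp (aff r x) \<subseteq> ?A"
  proof
    fix v assume "v \<in> supp (aff r x)"
    then have "(\<Sum>w\<in>supp x. x w * r w v) \<noteq> 0" by (simp add: supp_def aff_def)
    then obtain w where "w \<in> supp x" "x w * r w v \<noteq> 0" by (rule sum.not_neutral_contains_not_neutral)
    then show "v \<in> ?A" by (auto simp: supp_def)
  qed
  then have "aff p (aff r x) c = (\<Sum>v\<in>?A. (\<Sum>w\<in>supp x. x w * r w v) * p v c)"
    using aff_superset[OF fin] by (simp add: aff_def)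
  also have "\<dots> = (\<Sum>w\<in>supp x. x w * (\<Sum>v\<in>?A. r w v * p v c))"
    by (simp add: sum_distrib_left sum_distrib_right mult.assoc) (rule sum.swap)
  also have "\<dots> = (\<Sum>w\<in>supp x. x w * aff p (r w) c)"
  proof (rule sum.cong)
    fix w assume "w \<in> supp x"
    then have "supp (r w) \<subseteq> ?A" by auto
    show "x w * (\<Sum>v\<in>?A. r w v * p v c) = x w * aff p (r w) c"
      by (subst aff_superset[OF fin \<open>supp (r w) \<subseteq> ?A\<close>]) (rule refl)
  qed simp
  finally show ?thesis by (simp add: aff_def)
qed

lemma sum_aff:
  assumes "finite (supp x)" "finite B"
  shows "sum (aff p x) B = (\<Sum>w\<in>supp x. x w * sum (p w) B)"
  unfolding aff_def by (subst sum.swap) (simp add: sum_distrib_left)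

lemma aff_real_carrier:
  assumes E: "fos_complex E" and F: "fos_complex F" and x: "x \<in> real_carrier E"
    and p: "\<And>w. w \<in> supp x \<Longrightarrow> p w \<in> real_carrier F" and S: "(\<Union>w\<in>supp x. supp (p w)) \<in> simps F"
  shows "aff p x \<in> real_carrier F" and "supp (aff p x) = (\<Union>w\<in>supp x. supp (p w))"
proof -
  let ?A = "\<Union>w\<in>supp x. supp (p w)"
  note fin = supp_verts(2)[OF E x]
  show s: "supp (aff p x) = ?A"
    using fin real_carrierD(1)[OF x] real_carrierD(1)[OF p] by (rule supp_aff)
  have finA: "finite ?A" using fos_simplexD(1)[OF F S] .
  have "sum (p w) ?A = 1" if "w \<in> supp x" for w
  proof -
    have "sum (p w) (supp (p w)) = sum (p w) ?A" using that by (intro sum_supp_eq finA) auto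
    then show ?thesis using real_carrierD(3)[OF p[OF that]] by simp
  qed
  then have "sum (aff p x) ?A = 1"
    using real_carrierD(3)[OF x] by (simp add: sum_aff[OF fin finA])
  moreover have "0 \<le> aff p x c" for c
    unfolding aff_def using real_carrierD(1)[OF x] real_carrierD(1)[OF p] by (simp add: sum_nonneg)
  ultimately show "aff p x \<in> real_carrier F"
    using real_carrierI[of "aff p x" ?A F ?A, OF _ finA _ _ F S] s by simp
qed

text \<open>The simplex condition makes the affine combinations land in \<open>F\<close>. The
  stratum of the result is decided by a highest vertex in the support, whose position attains the
  same stratum.\<close>

lemma aff_strat_pres:
  assumes E: "fos_complex E" "fos_finite E" and F: "fos_complex F"
    and p: "\<And>w. w \<in> verts E \<Longrightarrow> p w \<in> real_carrier F"
    and f: "\<And>w. w \<in> verts E \<Longrightarrow> realp F (p w) = filt E w"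
    and S: "\<And>\<sigma>. \<sigma> \<in> simps E \<Longrightarrow> (\<Union>w\<in>\<sigma>. supp (p w)) \<in> simps F"
  shows "strat_pres E F (aff p)"
proof -
  have A: "aff p x \<in> real_carrier F" "supp (aff p x) = (\<Union>w\<in>supp x. supp (p w))"
    if "x \<in> real_carrier E" for x
    using aff_real_carrier[OF E(1) F that, of p] p S[OF real_carrierD(2)[OF that]]
      supp_verts(1)[OF E(1) that] by blast+
  have finv: "finite (verts E)" using E(2) by (simp add: fos_finite_def)
  show ?thesis
  proof (rule strat_presI[OF E F])
    show "finite (\<Union>w\<in>verts E. supp (p w))"
      using finv supp_verts(2)[OF F p] by blast
  next
    fix c
    have "continuous_on (real_carrier E) (\<lambda>x. \<Sum>w\<in>verts E. x w * p w c)"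
      by (intro continuous_intros continuous_on_subset[OF continuous_on_product_coordinates]) auto
    then show "continuous_on (real_carrier E) (\<lambda>x. aff p x c)"
      using aff_superset[OF finv supp_verts(1)[OF E(1)], of _ p c] by (simp cong: continuous_on_cong)
  next
    fix x assume x: "x \<in> real_carrier E"
    show "supp (aff p x) \<subseteq> (\<Union>w\<in>verts E. supp (p w))"
      using A(2)[OF x] supp_verts(1)[OF E(1) x] by blast
    obtain w where w: "w \<in> supp x" "filt E w = realp E x" using realp_attained[OF E(1) x] by blast
    have wv: "w \<in> verts E" using w supp_verts(1)[OF E(1) x] by blast
    obtain c where c: "c \<in> supp (p w)" "filt F c = realp F (p w)"
      using realp_attained[OF F p[OF wv]] by blast
    show "realp F (aff p x) = realp E x"
    proof (rule realp_eqI)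
      show "c \<in> supp (aff p x)" using A(2)[OF x] w c by blast
      show "filt F c = realp E x" using c f[OF wv] w by simp
      fix d assume "d \<in> supp (aff p x)"
      then obtain w' where w': "w' \<in> supp x" "d \<in> supp (p w')" using A(2)[OF x] by blast
      then have w'v: "w' \<in> verts E" using supp_verts(1)[OF E(1) x] by blast
      have "filt F d \<le> filt E w'" using realp_upper[OF F p[OF w'v] w'(2)] f[OF w'v] by simp
      also have "\<dots> \<le> realp E x" using realp_upper[OF E(1) x w'(1)] .
      finally show "filt F d \<le> realp E x" .
    qed
  qed (use A in auto)
qed

definition pt :: "'w \<Rightarrow> 'w \<Rightarrow> real" where
  "pt a = (\<lambda>c. if c = a then 1 else 0)"

lemma supp_pt [simp]: "supp (pt a) = {a}"
  by (auto simp: supp_def pt_def)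

lemma realp_pt [simp]: "realp F (pt a) = filt F a"
  by (rule realp_eqI[of a]) auto

lemma pt_real_carrier: "fos_complex F \<Longrightarrow> a \<in> verts F \<Longrightarrow> pt a \<in> real_carrier F"
  using fos_vertex[of F a] by (simp add: real_carrier_def) (simp add: pt_def)

lemma aff_pt: "aff p (pt a) = p a"
  by (simp add: aff_def) (simp add: pt_def)

lemma aff_pt_id: "finite (supp x) \<Longrightarrow> aff pt x = x"
  by (intro ext) (simp add: aff_def pt_def if_distrib[of "(*) _"] supp_def cong: if_cong)

definition unif :: "'w set \<Rightarrow> 'w \<Rightarrow> real" where
  "unif A = (\<lambda>c. if c \<in> A then 1 / real (card A) else 0)"

lemma supp_unif: "finite A \<Longrightarrow> supp (unif A) = A"
  by (auto simp: supp_def unif_def)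

lemma unif_real_carrier:
  assumes "fos_complex F" "A \<in> simps F"
  shows "unif A \<in> real_carrier F"
  using fos_simplexD[OF assms] assms(2)
  by (simp add: real_carrier_def supp_unif) (simp add: unif_def)

lemma aff_unif: "finite A \<Longrightarrow> aff p (unif A) c = (\<Sum>w\<in>A. p w c) / real (card A)"
  by (simp add: aff_def supp_unif) (simp add: unif_def sum_divide_distrib)

lemma real_map_eq_aff: "finite (supp x) \<Longrightarrow> real_map f x = aff (\<lambda>w. pt (f w)) x"
proof
  fix c assume fin: "finite (supp x)"
  have "{v. x v \<noteq> 0 \<and> f v = c} = {v \<in> supp x. f v = c}" by (auto simp: supp_def)
  then show "real_map f x c = aff (\<lambda>w. pt (f w)) x c"
    using fin unfolding real_map_def aff_def pt_def
    by (simp add: sum.inter_filter if_distrib[of "(*) _"] eq_commute[of c] cong: if_cong)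
qed

lemma real_map_comp:
  assumes "finite (supp x)"
  shows "real_map (f \<circ> g) x = real_map f (real_map g x)"
proof -
  have "supp (aff (\<lambda>w. pt (g w)) x) \<subseteq> g ` supp x"
  proof
    fix v assume "v \<in> supp (aff (\<lambda>w. pt (g w)) x)"
    then have "(\<Sum>w\<in>supp x. x w * pt (g w) v) \<noteq> 0" by (simp add: supp_def aff_def)
    then obtain w where "w \<in> supp x" "x w * pt (g w) v \<noteq> 0"
      by (rule sum.not_neutral_contains_not_neutral)
    then show "v \<in> g ` supp x" by (auto simp: pt_def split: if_splits)
  qed
  then have "finite (supp (aff (\<lambda>w. pt (g w)) x))" using assms finite_subset by blast
  then show ?thesis
    using assms by (intro ext) (simp add: real_map_eq_aff aff_aff aff_pt)
qed

text \<open>A morphism without compatibility of the orders. This is what the approximation produces,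
  and it suffices for a stratum preserving realization.\<close>

definition strat_simplicial :: "('v \<Rightarrow> 'w) \<Rightarrow> ('v, 'p::order) fos \<Rightarrow> ('w, 'p) fos \<Rightarrow> bool" where
  "strat_simplicial f E F \<longleftrightarrow> (\<forall>v\<in>verts E. f v \<in> verts F \<and> filt F (f v) = filt E v) \<and>
     (\<forall>\<sigma>\<in>simps E. f ` \<sigma> \<in> simps F)"

lemma strat_simplicialD:
  assumes "strat_simplicial f E F"
  shows "v \<in> verts E \<Longrightarrow> f v \<in> verts F" "v \<in> verts E \<Longrightarrow> filt F (f v) = filt E v"
    "\<sigma> \<in> simps E \<Longrightarrow> f ` \<sigma> \<in> simps F"
  using assms by (simp_all add: strat_simplicial_def)

lemma fos_morphism_iff:
  "fos_morphism f E F \<longleftrightarrow> strat_simplicial f E F \<and>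
     (\<forall>x y. ord E x y \<longrightarrow> f x = f y \<or> ord F (f x) (f y))"
  unfolding fos_morphism_def strat_simplicial_def ball_conj_distrib by (simp only: conj_ac)

lemma strat_simplicial_comp:
  "strat_simplicial f E F \<Longrightarrow> strat_simplicial g F G \<Longrightarrow> strat_simplicial (g \<circ> f) E G"
  unfolding strat_simplicial_def image_comp[symmetric] by simp

lemma fos_morphism_comp:
  fixes E :: "('v, 'p::order) fos"
  assumes "fos_morphism f E F" "fos_morphism g F G"
  shows "fos_morphism (g \<circ> f) E G"
proof -
  have "g (f x) = g (f y) \<or> ord G (g (f x)) (g (f y))" if "ord E x y" for x y
    using assms that unfolding fos_morphism_iff by (cases "f x = f y") auto
  then show ?thesis
    using assms strat_simplicial_comp[of f E F g G] by (simp add: fos_morphism_iff)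
qed

lemma fos_morphism_id: "fos_morphism id E E"
  by (simp add: fos_morphism_def)

lemma supp_real_map:
  assumes "fos_complex E" "x \<in> real_carrier E"
  shows "supp (real_map f x) = f ` supp x"
proof -
  have "supp (real_map f x) = (\<Union>w\<in>supp x. supp (pt (f w)))"
    unfolding real_map_eq_aff[OF supp_verts(2)[OF assms]]
    by (rule supp_aff) (use real_carrierD(1)[OF assms(2)] supp_verts(2)[OF assms] in \<open>auto simp: pt_def\<close>)
  then show ?thesis by auto
qed

lemma strat_pres_cong:
  assumes "fos_complex E" "strat_pres E L f" "\<And>t. t \<in> real_carrier E \<Longrightarrow> f' t = f t"
  shows "strat_pres E L f'"
  using assms(2,3) continuous_map_eq[of "geom_top E" "geom_top L" f f']
  by (simp add: strat_pres_def topspace_geom_top[OF assms(1)])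

lemma real_map_strat_pres:
  assumes "fos_complex E" "fos_finite E" "fos_complex F" "strat_simplicial f E F"
  shows "strat_pres E F (real_map f)"
proof (rule strat_pres_cong[OF assms(1)])
  show "strat_pres E F (aff (\<lambda>w. pt (f w)))"
  proof (rule aff_strat_pres[OF assms(1-3)])
    fix \<sigma> assume "\<sigma> \<in> simps E"
    moreover have "(\<Union>w\<in>\<sigma>. supp (pt (f w))) = f ` \<sigma>" by auto
    ultimately show "(\<Union>w\<in>\<sigma>. supp (pt (f w))) \<in> simps F"
      using assms(4) by (simp add: strat_simplicial_def)
  qed (use assms(4) in \<open>auto simp: strat_simplicial_def intro: pt_real_carrier[OF assms(3)]\<close>)
qed (simp add: real_map_eq_aff supp_verts(2)[OF assms(1)])

lemma top_vertex_image:
  assumes "fos_complex E" "fos_complex F" "fos_morphism f E F" "\<sigma> \<in> simps E"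
  shows "top_vertex F (f ` \<sigma>) = f (top_vertex E \<sigma>)"
proof (rule top_vertex_eqI[OF assms(2)])
  show "f ` \<sigma> \<in> simps F" using assms by (simp add: fos_morphism_def)
  show "f (top_vertex E \<sigma>) \<in> f ` \<sigma>" using top_vertex_in[OF assms(1,4)] by simp
  fix w assume "w \<in> f ` \<sigma>" "w \<noteq> f (top_vertex E \<sigma>)"
  then obtain v where v: "v \<in> \<sigma>" "w = f v" "f v \<noteq> f (top_vertex E \<sigma>)" by auto
  then have "ord E v (top_vertex E \<sigma>)" using top_vertex_ord[OF assms(1,4) v(1)] by auto
  then show "ord F w (f (top_vertex E \<sigma>))" using assms(3) v unfolding fos_morphism_def by blast
qed

section \<open>Barycentric subdivision\<close>

text \<open>Recovers the simplex from the subdivision vertex that stands for it; the value at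
  \<open>V a\<close> only makes the function total.\<close>

primrec elts :: "'a hv \<Rightarrow> 'a hv set" where
  "elts (V a) = {}"
| "elts (S A) = fset A"

lemma elts_sdv [simp]: "finite \<sigma> \<Longrightarrow> elts (sdv \<sigma>) = \<sigma>"
  by (simp add: sdv_def Abs_fset_inverse)

lemma sd_vertex_iff:
  assumes "fos_complex E"
  shows "w \<in> verts (sd E) \<longleftrightarrow> elts w \<in> simps E \<and> w = sdv (elts w)"
proof
  assume "w \<in> verts (sd E)"
  then obtain \<sigma> where "\<sigma> \<in> simps E" "w = sdv \<sigma>" by (auto simp: sd_def)
  then show "elts w \<in> simps E \<and> w = sdv (elts w)" using fos_simplexD(1)[OF assms] by simp
next
  assume "elts w \<in> simps E \<and> w = sdv (elts w)"
  then show "w \<in> verts (sd E)" unfolding sd_def by (metis fos.select_convs(1) imageI)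
qed

lemma sd_vertexD:
  assumes "fos_complex E" "w \<in> verts (sd E)"
  shows "elts w \<in> simps E" "w = sdv (elts w)" "w = S (Abs_fset (elts w))" "finite (elts w)"
  using assms fos_simplexD(1) by (auto simp: sd_vertex_iff sdv_def)

lemma sdv_vertex: "fos_complex E \<Longrightarrow> \<sigma> \<in> simps E \<Longrightarrow> sdv \<sigma> \<in> verts (sd E)"
  by (simp add: sd_def)

lemma elts_inj: "fos_complex E \<Longrightarrow> inj_on elts (verts (sd E))"
  by (metis inj_onI sd_vertexD(2))

lemma sd_simplex_iff:
  assumes "fos_complex E"
  shows "T \<in> simps (sd E) \<longleftrightarrow> T \<noteq> {} \<and> finite T \<and> T \<subseteq> verts (sd E) \<and>
    (\<forall>w\<in>T. \<forall>w'\<in>T. elts w \<subseteq> elts w' \<or> elts w' \<subseteq> elts w)"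
proof
  assume "T \<in> simps (sd E)"
  then obtain C where C: "T = sdv ` C" "C \<subseteq> simps E" "C \<noteq> {}" "finite C" "is_chain C"
    by (auto simp: sd_def)
  have e: "elts (sdv \<sigma>) = \<sigma>" if "\<sigma> \<in> C" for \<sigma>
    using that C(2) fos_simplexD(1)[OF assms] by auto
  show "T \<noteq> {} \<and> finite T \<and> T \<subseteq> verts (sd E) \<and>
    (\<forall>w\<in>T. \<forall>w'\<in>T. elts w \<subseteq> elts w' \<or> elts w' \<subseteq> elts w)"
    using C e sdv_vertex[OF assms] unfolding is_chain_def by auto
next
  assume T: "T \<noteq> {} \<and> finite T \<and> T \<subseteq> verts (sd E) \<and>
    (\<forall>w\<in>T. \<forall>w'\<in>T. elts w \<subseteq> elts w' \<or> elts w' \<subseteq> elts w)"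
  have "sdv ` elts ` T = (\<lambda>w. w) ` T"
    unfolding image_image by (rule image_cong) (use T sd_vertexD(2)[OF assms] in auto)
  then have "T = sdv ` (elts ` T)" by simp
  moreover have "elts ` T \<subseteq> simps E" "elts ` T \<noteq> {}" "finite (elts ` T)" "is_chain (elts ` T)"
    using T sd_vertexD(1)[OF assms] by (auto simp: is_chain_def)
  ultimately show "T \<in> simps (sd E)" unfolding sd_def by auto
qed

lemma sd_ord_iff:
  assumes "fos_complex E"
  shows "ord (sd E) x y \<longleftrightarrow> x \<in> verts (sd E) \<and> y \<in> verts (sd E) \<and> elts x \<subset> elts y"
proof
  assume "ord (sd E) x y"
  then obtain \<sigma> \<tau> where "x = sdv \<sigma>" "y = sdv \<tau>" "\<sigma> \<in> simps E" "\<tau> \<in> simps E" "\<sigma> \<subset> \<tau>"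
    by (auto simp: sd_def)
  then show "x \<in> verts (sd E) \<and> y \<in> verts (sd E) \<and> elts x \<subset> elts y"
    using sdv_vertex[OF assms] fos_simplexD(1)[OF assms] by simp
next
  assume a: "x \<in> verts (sd E) \<and> y \<in> verts (sd E) \<and> elts x \<subset> elts y"
  show "ord (sd E) x y"
    using sd_vertexD(1,2)[OF assms, of x] sd_vertexD(1,2)[OF assms, of y] a
    by (simp add: sd_def) blast
qed

lemma sd_filt:
  assumes "fos_complex E" "w \<in> verts (sd E)"
  shows "filt (sd E) w = pmax (filt E ` elts w)"
    and "filt (sd E) w = filt E (top_vertex E (elts w))"
    and "\<And>x. x \<in> elts w \<Longrightarrow> filt E x \<le> filt (sd E) w"
    and "lv E w = top_vertex E (elts w)"
proof -
  obtain A where A: "w = S A" using sd_vertexD(3)[OF assms] by blast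
  show *: "filt (sd E) w = pmax (filt E ` elts w)" "lv E w = top_vertex E (elts w)"
    by (simp_all add: A sd_def lv_def)
  show "filt (sd E) w = filt E (top_vertex E (elts w))"
    unfolding * by (rule pmax_simplex[OF assms(1) sd_vertexD(1)[OF assms]])
  then show "filt E x \<le> filt (sd E) w" if "x \<in> elts w" for x
    using top_vertex_filt[OF assms(1) sd_vertexD(1)[OF assms] that] by simp
qed

lemma fos_complex_sd:
  assumes E: "fos_complex E"
  shows "fos_complex (sd E)"
proof -
  note sv = sd_simplex_iff[OF E] and so = sd_ord_iff[OF E] and ve = sd_vertexD[OF E]
  have neq: "x = y" if "x \<in> verts (sd E)" "y \<in> verts (sd E)" "elts x = elts y" for x y
    using elts_inj[OF E] that by (meson inj_onD)
  have 1: "\<forall>T\<in>simps (sd E). T \<noteq> {} \<and> finite T \<and> T \<subseteq> verts (sd E)" using sv by simp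
  have 2: "\<forall>v\<in>verts (sd E). {v} \<in> simps (sd E)" using sv by simp
  have 3: "\<forall>T\<in>simps (sd E). \<forall>T'. T' \<subseteq> T \<and> T' \<noteq> {} \<longrightarrow> T' \<in> simps (sd E)"
  proof (intro ballI allI impI)
    fix T T' assume "T \<in> simps (sd E)" "T' \<subseteq> T \<and> T' \<noteq> {}"
    then show "T' \<in> simps (sd E)"
      unfolding sv using finite_subset[of T' T] by (meson subset_eq)
  qed
  have 4: "\<forall>x y. ord (sd E) x y \<longrightarrow> x \<noteq> y \<and> {x, y} \<in> simps (sd E)"
    unfolding so sv by auto
  have 5: "\<forall>T\<in>simps (sd E). \<forall>x\<in>T. \<forall>y\<in>T. x \<noteq> y \<longrightarrow> ord (sd E) x y \<or> ord (sd E) y x"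
  proof (intro ballI impI)
    fix T x y assume T: "T \<in> simps (sd E)" "x \<in> T" "y \<in> T" "x \<noteq> y"
    then have v: "x \<in> verts (sd E)" "y \<in> verts (sd E)" "elts x \<subseteq> elts y \<or> elts y \<subseteq> elts x"
      unfolding sv by auto
    moreover have "elts x \<noteq> elts y" using neq v T(4) by blast
    ultimately show "ord (sd E) x y \<or> ord (sd E) y x" unfolding so by auto
  qed
  have 6: "\<forall>T\<in>simps (sd E). \<forall>x\<in>T. \<forall>y\<in>T. \<not> (ord (sd E) x y \<and> ord (sd E) y x)"
    unfolding so by auto
  have 7: "\<forall>T\<in>simps (sd E). \<forall>x\<in>T. \<forall>y\<in>T. \<forall>z\<in>T. ord (sd E) x y \<and> ord (sd E) y z \<longrightarrow> ord (sd E) x z"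
    unfolding so by auto
  have 8: "\<forall>x y. ord (sd E) x y \<longrightarrow> filt (sd E) x \<le> filt (sd E) y"
  proof (intro allI impI)
    fix x y assume "ord (sd E) x y"
    then have v: "x \<in> verts (sd E)" "y \<in> verts (sd E)" "elts x \<subseteq> elts y" unfolding so by auto
    have "top_vertex E (elts x) \<in> elts y"
      using top_vertex_in[OF E ve(1)[OF v(1)]] v(3) by blast
    then show "filt (sd E) x \<le> filt (sd E) y"
      using sd_filt(3)[OF E v(2)] sd_filt(2)[OF E v(1)] by simp
  qed
  show ?thesis unfolding fos_complex_def using 1 2 3 4 5 6 7 8 by (intro conjI)
qed

lemma fos_finite_sd: "fos_complex E \<Longrightarrow> fos_finite E \<Longrightarrow> fos_finite (sd E)"
  using fos_finite_simps[of E] by (simp add: fos_finite_def sd_def)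

section \<open>Iterated subdivisions, last vertex maps and carriers\<close>

abbreviation sds :: "nat \<Rightarrow> ('a hv, 'p::order) fos \<Rightarrow> ('a hv, 'p) fos" where
  "sds n \<equiv> sd ^^ n"

lemma fos_complex_sds: "fos_complex E \<Longrightarrow> fos_complex (sds n E)"
  by (induction n) (auto intro: fos_complex_sd)

lemma fos_finite_sds: "fos_complex E \<Longrightarrow> fos_finite E \<Longrightarrow> fos_finite (sds n E)"
  by (induction n) (auto intro: fos_finite_sd fos_complex_sds)

text \<open>A finite chain has a largest member, so its union is again a simplex of
  \<open>E\<close>.\<close>

lemma elts_top_of_chain:
  assumes "fos_complex E" "T \<in> simps (sd E)"
  shows "w \<in> T \<Longrightarrow> elts w \<subseteq> elts (top_vertex (sd E) T)"
    and "(\<Union>w\<in>T. elts w) = elts (top_vertex (sd E) T)"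
    and "(\<Union>w\<in>T. elts w) \<in> simps E"
proof -
  let ?m = "top_vertex (sd E) T"
  have m: "?m \<in> T" by (rule top_vertex_in[OF fos_complex_sd[OF assms(1)] assms(2)])
  have *: "elts w \<subseteq> elts ?m" if "w \<in> T" for w
    using top_vertex_ord[OF fos_complex_sd[OF assms(1)] assms(2) that]
    unfolding sd_ord_iff[OF assms(1)] by blast
  then show "w \<in> T \<Longrightarrow> elts w \<subseteq> elts ?m" .
  show U: "(\<Union>w\<in>T. elts w) = elts ?m" using * m by blast
  have "?m \<in> verts (sd E)" using m assms(2) sd_simplex_iff[OF assms(1)] by blast
  then show "(\<Union>w\<in>T. elts w) \<in> simps E" unfolding U by (rule sd_vertexD(1)[OF assms(1)])
qed

lemma lv_morphism:
  assumes E: "fos_complex E"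
  shows "fos_morphism (lv E) (sd E) E"
  unfolding fos_morphism_def
proof (intro conjI ballI allI impI)
  have lv: "lv E w = top_vertex E (elts w)" "lv E w \<in> elts w" if "w \<in> verts (sd E)" for w
    using sd_filt(4)[OF E that] top_vertex_in[OF E sd_vertexD(1)[OF E that]] by auto
  show "lv E w \<in> verts E" if "w \<in> verts (sd E)" for w
    using lv(2)[OF that] fos_simplexD(3)[OF E sd_vertexD(1)[OF E that]] by blast
  show "lv E ` T \<in> simps E" if T: "T \<in> simps (sd E)" for T
  proof (rule fos_face[OF E elts_top_of_chain(3)[OF E T]])
    show "lv E ` T \<subseteq> (\<Union>w\<in>T. elts w)" "lv E ` T \<noteq> {}"
      using T lv(2) unfolding sd_simplex_iff[OF E] by blast+
  qed
  show "filt E (lv E w) = filt (sd E) w" if "w \<in> verts (sd E)" for w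
    using lv(1)[OF that] sd_filt(2)[OF E that] by simp
  fix x y assume "ord (sd E) x y"
  then have v: "x \<in> verts (sd E)" "y \<in> verts (sd E)" "elts x \<subseteq> elts y"
    unfolding sd_ord_iff[OF E] by auto
  have "lv E x \<in> elts y" using lv(2)[OF v(1)] v(3) by blast
  then show "lv E x = lv E y \<or> ord E (lv E x) (lv E y)"
    using top_vertex_ord[OF E sd_vertexD(1)[OF E v(2)]] lv(1)[OF v(2)] by auto
qed

lemma lvn_morphism: "fos_complex E \<Longrightarrow> fos_morphism (lvn E n) (sds n E) E"
proof (induction n)
  case (Suc n)
  then show ?case
    using fos_morphism_comp[OF lv_morphism[OF fos_complex_sds[OF Suc.prems, of n]] Suc.IH[OF Suc.prems]]
    by (simp add: o_def)
qed (simp add: fos_morphism_id)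

lemma sds_add: "sds n (sds m E) = sds (m + n) E"
  by (metis add.commute comp_apply funpow_add)

lemma lvn_add: "lvn E (m + n) = lvn E m \<circ> lvn (sds m E) n"
  by (induction n) (simp_all add: sds_add o_assoc)

text \<open>The carrier of \<open>w\<close>: the vertex set of the smallest simplex of the original
  complex that contains the vertex \<open>w\<close> of its \<open>n\<close>-th subdivision.\<close>

primrec car :: "nat \<Rightarrow> 'a hv \<Rightarrow> 'a hv set" where
  "car 0 w = {w}"
| "car (Suc n) w = (\<Union>x\<in>elts w. car n x)"

lemma car_add: "car (m + n) w = (\<Union>x\<in>car n w. car m x)"
  by (induction n arbitrary: w) auto

lemma car_simplex:
  assumes "fos_complex E" "T \<in> simps (sds n E)"
  shows "(\<Union>w\<in>T. car n w) \<in> simps E"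
  using assms(2)
proof (induction n arbitrary: T)
  case (Suc n)
  have T: "T \<in> simps (sd (sds n E))" using Suc.prems by simp
  have "(\<Union>w\<in>T. car (Suc n) w) = (\<Union>x\<in>(\<Union>w\<in>T. elts w). car n x)" by auto
  then show ?case using Suc.IH[OF elts_top_of_chain(3)[OF fos_complex_sds[OF assms(1)] T]] by simp
qed simp

lemma car_vertex:
  assumes "fos_complex E" "w \<in> verts (sds n E)"
  shows "car n w \<in> simps E"
  using car_simplex[OF assms(1) fos_vertex[OF fos_complex_sds[OF assms(1)] assms(2)]] by simp

lemma lvn_in_car:
  assumes "fos_complex E" "w \<in> verts (sds n E)"
  shows "lvn E n w \<in> car n w"
  using assms(2)
proof (induction n arbitrary: w)
  case (Suc n)
  have w: "w \<in> verts (sd (sds n E))" using Suc.prems by simp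
  note En = fos_complex_sds[OF assms(1), of n]
  have "lv (sds n E) w \<in> elts w"
    using sd_filt(4)[OF En w] top_vertex_in[OF En sd_vertexD(1)[OF En w]] by simp
  moreover have "lv (sds n E) w \<in> verts (sds n E)"
    using lv_morphism[OF En] w by (simp add: fos_morphism_def)
  ultimately show ?case using Suc.IH by auto
qed simp

lemma car_chain:
  assumes "fos_complex E" "T \<in> simps (sds n E)" "w \<in> T" "w' \<in> T" "0 < n"
  shows "car n w \<subseteq> car n w' \<or> car n w' \<subseteq> car n w"
proof -
  obtain m where n: "n = Suc m" using assms(5) gr0_implies_Suc by blast
  have "elts w \<subseteq> elts w' \<or> elts w' \<subseteq> elts w"
    using assms(2-4) sd_simplex_iff[OF fos_complex_sds[OF assms(1), of m], of T] unfolding n by auto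
  then show ?thesis unfolding n by auto
qed

section \<open>Barycenters in the upper strata\<close>

text \<open>Members of a chain have distinct cardinalities, so subdivision does not raise the bound
  on the number of vertices of a simplex. The bound is independent of \<open>m\<close>, hence so is
  the contraction factor of the mesh.\<close>

lemma card_sds_simplex:
  assumes "fos_complex E" "fos_finite E" "T \<in> simps (sds m E)"
  shows "card T \<le> card (verts E)"
  using assms(3)
proof (induction m arbitrary: T)
  case 0
  then show ?case
    using fos_simplexD(3)[OF assms(1)] assms(2) by (auto simp: fos_finite_def intro: card_mono)
next
  case (Suc m)
  have En: "fos_complex (sds m E)" by (rule fos_complex_sds[OF assms(1)])
  have T: "finite T" "T \<subseteq> verts (sd (sds m E))"
    "\<forall>w\<in>T. \<forall>w'\<in>T. elts w \<subseteq> elts w' \<or> elts w' \<subseteq> elts w"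
    using Suc.prems sd_simplex_iff[OF En] by auto
  have e: "elts w \<in> simps (sds m E)" "finite (elts w)" "elts w \<noteq> {}" if "w \<in> T" for w
    using sd_vertexD(1)[OF En] fos_simplexD(1,2)[OF En] T(2) that by blast+
  have "inj_on (\<lambda>w. card (elts w)) T"
  proof (rule inj_onI)
    fix w w' assume w: "w \<in> T" "w' \<in> T" "card (elts w) = card (elts w')"
    then have "elts w = elts w'" using T(3) e(2) by (metis card_subset_eq)
    then show "w = w'" using elts_inj[OF En] T(2) w by (meson inj_onD subsetD)
  qed
  moreover have "(\<lambda>w. card (elts w)) ` T \<subseteq> {1..card (verts E)}"
    using Suc.IH e by (auto simp: Suc_le_eq card_gt_0_iff)
  ultimately show ?case using card_inj_on_le[of _ T "{1..card (verts E)}"] by simp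
qed

text \<open>The classical mesh contraction of barycentric subdivision, for a single coordinate. The
  gain over \<open>D\<close> comes from the nonempty common part \<open>A\<close>, whose deviations
  from its own mean cancel.\<close>

lemma abs_average_diff_le:
  fixes f :: "'v \<Rightarrow> real"
  assumes "finite B" "A \<subseteq> B" "A \<noteq> {}" "card B \<le> N"
    and D: "\<And>x y. x \<in> B \<Longrightarrow> y \<in> B \<Longrightarrow> \<bar>f x - f y\<bar> \<le> D"
  shows "\<bar>sum f A / card A - sum f B / card B\<bar> \<le> (1 - 1 / N) * D"
proof -
  let ?a = "sum f A / card A"
  have finA: "finite A" using assms finite_subset by blast
  have cA: "0 < card A" "card A \<le> card B" using assms finA by (auto simp: card_gt_0_iff intro: card_mono)
  have D0: "0 \<le> D" using D[of "SOME x. x \<in> A" "SOME x. x \<in> A"] assms some_in_eq[of A] by auto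
  have a: "\<bar>?a - f y\<bar> \<le> D" if "y \<in> B" for y
  proof -
    have "?a - f y = (\<Sum>x\<in>A. f x - f y) / card A"
      using cA by (simp add: sum_subtractf field_simps)
    moreover have "\<bar>\<Sum>x\<in>A. f x - f y\<bar> \<le> (\<Sum>x\<in>A. D)"
      using D that assms(2) by (intro order_trans[OF sum_abs] sum_mono) auto
    ultimately show ?thesis using cA by (simp add: abs_divide divide_le_eq mult.commute)
  qed
  have "?a - sum f B / card B = (\<Sum>y\<in>B. ?a - f y) / card B"
    using cA by (simp add: sum_subtractf diff_divide_distrib)
  also have "(\<Sum>y\<in>B. ?a - f y) = (\<Sum>y\<in>B - A. ?a - f y) + (\<Sum>y\<in>A. ?a - f y)"
    by (rule sum.subset_diff[OF assms(2,1)])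
  also have "(\<Sum>y\<in>A. ?a - f y) = 0"
    using cA by (simp add: sum_subtractf)
  finally have eq: "?a - sum f B / card B = (\<Sum>y\<in>B - A. ?a - f y) / card B" by simp
  have "\<bar>\<Sum>y\<in>B - A. ?a - f y\<bar> \<le> (\<Sum>y\<in>B - A. D)"
    using a by (intro order_trans[OF sum_abs] sum_mono) auto
  also have "\<dots> = (real (card B) - card A) * D"
    using cA by (simp add: card_Diff_subset[OF finA assms(2)] of_nat_diff)
  also have "\<dots> \<le> (real (card B) - 1) * D"
    using cA D0 by (intro mult_right_mono) auto
  finally have "\<bar>?a - sum f B / card B\<bar> \<le> (real (card B) - 1) * D / card B"
    unfolding eq using cA by (simp add: abs_divide divide_right_mono)
  also have "\<dots> = (1 - 1 / card B) * D" using cA by (simp add: field_simps)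
  also have "\<dots> \<le> (1 - 1 / N) * D"
    using cA D0 assms(4) by (intro mult_right_mono) (auto simp: frac_le)
  finally show ?thesis .
qed

definition active :: "('a hv \<Rightarrow> bool) \<Rightarrow> nat \<Rightarrow> 'a hv \<Rightarrow> bool" where
  "active q m w \<longleftrightarrow> (\<exists>c\<in>car m w. q c)"

text \<open>The elements to be averaged over. Without active elements the usual barycenter is taken,
  so that every vertex gets a position.\<close>

definition core :: "('a hv \<Rightarrow> bool) \<Rightarrow> nat \<Rightarrow> 'a hv \<Rightarrow> 'a hv set" where
  "core q m w = (if active q (Suc m) w then {x \<in> elts w. active q m x} else elts w)"

text \<open>The vertices of the \<open>m\<close>-th subdivision are placed at barycenters in which only the vertices
  satisfying \<open>q\<close> count, whenever there are any; \<open>q = (\<lambda>_. True)\<close> gives the usual barycenters.\<close>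

primrec pos :: "('a hv \<Rightarrow> bool) \<Rightarrow> nat \<Rightarrow> 'a hv \<Rightarrow> 'a hv \<Rightarrow> real" where
  "pos q 0 w = pt w"
| "pos q (Suc m) w = aff (pos q m) (unif (core q m w))"

lemma active_Suc: "active q (Suc m) w \<longleftrightarrow> (\<exists>x\<in>elts w. active q m x)"
  by (auto simp: active_def)

lemma core_props: "core q m w \<subseteq> elts w" "elts w \<noteq> {} \<Longrightarrow> core q m w \<noteq> {}"
  by (auto simp: core_def active_Suc)

locale upper_fos =
  fixes E :: "('a hv, 'p::order) fos" and U :: "'p set"
  assumes E: "fos_complex E" "fos_finite E"
    and up: "\<And>a b. a \<in> U \<Longrightarrow> a \<le> b \<Longrightarrow> b \<in> U"
begin

abbreviation "q \<equiv> \<lambda>c. filt E c \<in> U"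

text \<open>Upward closure of \<open>U\<close> is decisive: a vertex of the subdivision has the
  maximal stratum of its simplex, so a single vertex in \<open>U\<close> forces it into
  \<open>U\<close>.\<close>

lemma active_iff:
  assumes "w \<in> verts (sds m E)"
  shows "active q m w \<longleftrightarrow> filt (sds m E) w \<in> U"
  using assms
proof (induction m arbitrary: w)
  case (Suc m)
  have Em: "fos_complex (sds m E)" by (rule fos_complex_sds[OF E(1)])
  have w: "w \<in> verts (sd (sds m E))" using Suc.prems by simp
  have sub: "elts w \<subseteq> verts (sds m E)" using fos_simplexD(3)[OF Em sd_vertexD(1)[OF Em w]] .
  have "active q (Suc m) w \<longleftrightarrow> (\<exists>x\<in>elts w. filt (sds m E) x \<in> U)"
    unfolding active_Suc using Suc.IH sub by blast
  also have "\<dots> \<longleftrightarrow> filt (sd (sds m E)) w \<in> U"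
  proof
    assume "\<exists>x\<in>elts w. filt (sds m E) x \<in> U"
    then obtain x where "x \<in> elts w" "filt (sds m E) x \<in> U" ..
    then show "filt (sd (sds m E)) w \<in> U" using up[OF _ sd_filt(3)[OF Em w]] by blast
  qed (use sd_filt(2)[OF Em w] top_vertex_in[OF Em sd_vertexD(1)[OF Em w]] in auto)
  finally show ?case by simp
qed (simp add: active_def)

lemma pos_simplex:
  assumes "\<sigma> \<in> simps (sds m E)"
    and "\<And>w. w \<in> \<sigma> \<Longrightarrow> supp (pos q m w) \<subseteq> car m w" "\<And>w. w \<in> \<sigma> \<Longrightarrow> supp (pos q m w) \<noteq> {}"
  shows "(\<Union>w\<in>\<sigma>. supp (pos q m w)) \<in> simps E"
proof (rule fos_face[OF E(1) car_simplex[OF E(1) assms(1)]])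
  show "(\<Union>w\<in>\<sigma>. supp (pos q m w)) \<subseteq> (\<Union>w\<in>\<sigma>. car m w)" using assms(2) by blast
  show "(\<Union>w\<in>\<sigma>. supp (pos q m w)) \<noteq> {}"
    using assms(3) fos_simplexD(2)[OF fos_complex_sds[OF E(1)] assms(1)] by blast
qed

text \<open>The claims are proved together because the step extends the previous placement by
  \<open>aff_strat_pres\<close>, which needs its strata and carriers. The last two say that an
  active vertex has all its mass in \<open>U\<close> and an inactive one has none there.\<close>

lemma pos_induction:
  assumes "w \<in> verts (sds m E)"
  shows "pos q m w \<in> real_carrier E \<and> realp E (pos q m w) = filt (sds m E) w \<and>
    supp (pos q m w) \<subseteq> car m w \<and> (active q m w \<longrightarrow> supp (pos q m w) \<subseteq> Collect q) \<and>
    (\<not> active q m w \<longrightarrow> supp (pos q m w) = car m w)"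
  using assms
proof (induction m arbitrary: w)
  case 0
  then show ?case using pt_real_carrier[OF E(1)] by (simp add: active_def)
next
  case (Suc m)
  let ?F = "sds m E"
  have Em: "fos_complex ?F" "fos_finite ?F"
    using fos_complex_sds[OF E(1)] fos_finite_sds[OF E] by auto
  have w: "w \<in> verts (sd ?F)" using Suc.prems by simp
  note e = sd_vertexD(1)[OF Em(1) w]
  let ?C = "core q m w"
  have C: "?C \<in> simps ?F"
    using fos_face[OF Em(1) e core_props] fos_simplexD(2)[OF Em(1) e] by simp
  have Cv: "?C \<subseteq> verts ?F" "finite ?C" using fos_simplexD[OF Em(1) C] by auto
  have IH: "pos q m x \<in> real_carrier E" "realp E (pos q m x) = filt ?F x" "supp (pos q m x) \<subseteq> car m x"
    "supp (pos q m x) \<noteq> {}" if "x \<in> verts ?F" for x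
    using Suc.IH[OF that] supp_verts(3)[OF E(1)] by auto
  have sp: "strat_pres ?F E (aff (pos q m))"
  proof (rule aff_strat_pres[OF Em E(1) IH(1,2)])
    fix \<sigma> assume \<sigma>: "\<sigma> \<in> simps ?F"
    then have "\<sigma> \<subseteq> verts ?F" by (rule fos_simplexD(3)[OF Em(1)])
    then show "(\<Union>w\<in>\<sigma>. supp (pos q m w)) \<in> simps E"
      using pos_simplex[OF \<sigma>] IH(3,4) by blast
  qed
  have u: "unif ?C \<in> real_carrier ?F" by (rule unif_real_carrier[OF Em(1) C])
  have s: "supp (pos q (Suc m) w) = (\<Union>x\<in>?C. supp (pos q m x))"
    using supp_aff[of "unif ?C" "pos q m"] Cv real_carrierD(1)[OF u] real_carrierD(1)[OF IH(1)]
    by (simp add: supp_unif subset_eq)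
  \<comment> \<open>Dropping inactive elements does not lower the stratum: when \<open>w\<close> is
    active, the last vertex of \<open>elts w\<close> has the stratum of \<open>w\<close>, which lies
    in \<open>U\<close>, and so it stays in the core.\<close>
  have r: "realp ?F (unif ?C) = filt (sd ?F) w"
  proof (rule realp_eqI)
    let ?t = "top_vertex ?F (elts w)"
    have t: "?t \<in> elts w" "filt ?F ?t = filt (sd ?F) w"
      using top_vertex_in[OF Em(1) e] sd_filt(2)[OF Em(1) w] by auto
    have "?t \<in> ?C"
    proof (cases "active q (Suc m) w")
      case True
      then have "active q m ?t"
        using active_iff[of w "Suc m"] active_iff[of ?t m] t w fos_simplexD(3)[OF Em(1) e] by auto
      then show ?thesis using True t by (simp add: core_def)
    qed (use t in \<open>simp add: core_def\<close>)
    then show "?t \<in> supp (unif ?C)" using Cv by (simp add: supp_unif)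
    show "filt ?F ?t = filt (sd ?F) w" by (rule t(2))
    show "filt ?F v \<le> filt (sd ?F) w" if "v \<in> supp (unif ?C)" for v
      using that sd_filt(3)[OF Em(1) w, of v] core_props(1)[of q m w] Cv by (auto simp: supp_unif)
  qed
  have "supp (pos q (Suc m) w) \<subseteq> car (Suc m) w"
    unfolding s using IH(3) Cv(1) core_props(1)[of q m w] by fastforce
  moreover have "supp (pos q (Suc m) w) \<subseteq> Collect q" if "active q (Suc m) w"
    unfolding s using that Suc.IH Cv(1) by (fastforce simp: core_def)
  moreover have "supp (pos q (Suc m) w) = car (Suc m) w" if "\<not> active q (Suc m) w"
    unfolding s using that Suc.IH Cv(1) by (auto simp: core_def active_Suc)
  ultimately show ?case
    using strat_presD[OF Em(1) E(1) sp u] r by simp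
qed

lemmas pos_real_carrier = pos_induction[THEN conjunct1]
  and realp_pos = pos_induction[THEN conjunct2, THEN conjunct1]
  and supp_pos_car = pos_induction[THEN conjunct2, THEN conjunct2, THEN conjunct1]
  and supp_pos_active = pos_induction[THEN conjunct2, THEN conjunct2, THEN conjunct2, THEN conjunct1, rule_format]
  and supp_pos_inactive = pos_induction[THEN conjunct2, THEN conjunct2, THEN conjunct2, THEN conjunct2, rule_format]

lemma supp_pos_simplex:
  assumes "\<sigma> \<in> simps (sds m E)"
  shows "(\<Union>w\<in>\<sigma>. supp (pos q m w)) \<in> simps E"
proof (rule pos_simplex[OF assms])
  fix w assume "w \<in> \<sigma>"
  then have w: "w \<in> verts (sds m E)" using fos_simplexD(3)[OF fos_complex_sds[OF E(1)] assms] by blast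
  show "supp (pos q m w) \<subseteq> car m w" by (rule supp_pos_car[OF w])
  show "supp (pos q m w) \<noteq> {}" by (rule supp_verts(3)[OF E(1) pos_real_carrier[OF w]])
qed

lemma pos_strat_pres: "strat_pres (sds m E) E (aff (pos q m))"
  by (rule aff_strat_pres[OF fos_complex_sds[OF E(1)] fos_finite_sds[OF E] E(1)
        pos_real_carrier realp_pos supp_pos_simplex])

lemma supp_aff_pos:
  assumes "x \<in> real_carrier (sds m E)"
  shows "supp (aff (pos q m) x) = (\<Union>w\<in>supp x. supp (pos q m w))"
  using aff_real_carrier(2)[OF fos_complex_sds[OF E(1)] E(1) assms
      pos_real_carrier supp_pos_simplex[OF real_carrierD(2)[OF assms]]]
    supp_verts(1)[OF fos_complex_sds[OF E(1)] assms] by blast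

lemma supp_aff_pos_car:
  assumes "x \<in> real_carrier (sds m E)"
  shows "supp (aff (pos q m) x) \<subseteq> (\<Union>w\<in>supp x. car m w)"
  unfolding supp_aff_pos[OF assms]
  using supp_pos_car supp_verts(1)[OF fos_complex_sds[OF E(1)] assms] by blast

text \<open>Nested simplices have nested sets of active elements, so the contraction of means
  applies to the cores. Only active vertices are compared: an active and an inactive position have
  disjoint supports and never approach each other.\<close>

lemma pos_mesh:
  assumes "T \<in> simps (sds m E)" "w \<in> T" "w' \<in> T" "active q m w" "active q m w'"
  shows "\<bar>pos q m w c - pos q m w' c\<bar> \<le> (1 - 1 / card (verts E)) ^ m"
  using assms
proof (induction m arbitrary: T w w')
  case 0
  then show ?case by (simp add: pt_def)
next
  case (Suc m)
  let ?F = "sds m E" and ?r = "1 - 1 / real (card (verts E))"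
  have Em: "fos_complex ?F" by (rule fos_complex_sds[OF E(1)])
  have T: "T \<subseteq> verts (sd ?F)" "\<forall>w\<in>T. \<forall>w'\<in>T. elts w \<subseteq> elts w' \<or> elts w' \<subseteq> elts w"
    using Suc.prems(1) sd_simplex_iff[OF Em] by auto
  have main: "\<bar>pos q (Suc m) w c - pos q (Suc m) w' c\<bar> \<le> ?r ^ Suc m"
    if w: "w \<in> T" "w' \<in> T" "active q (Suc m) w" "active q (Suc m) w'" and sub: "elts w \<subseteq> elts w'" for w w'
  proof -
    have e: "elts w' \<in> simps ?F" using sd_vertexD(1)[OF Em] T(1) w by blast
    have C: "core q m w = {x \<in> elts w. active q m x}" "core q m w' = {x \<in> elts w'. active q m x}"
      using w by (simp_all add: core_def)
    have fin: "finite (core q m w')" "finite (core q m w)"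
      using C fos_simplexD(1)[OF Em e] sub by (auto intro: finite_subset)
    have "card (core q m w') \<le> card (elts w')"
      using core_props(1) fos_simplexD(1)[OF Em e] by (rule card_mono[rotated])
    then have "card (core q m w') \<le> card (verts E)"
      using card_sds_simplex[OF E e] by linarith
    moreover have "core q m w \<noteq> {}" using w(3) by (auto simp: C active_Suc)
    moreover have "\<bar>pos q m x c - pos q m y c\<bar> \<le> ?r ^ m" if "x \<in> core q m w'" "y \<in> core q m w'" for x y
      using that Suc.IH[OF e] unfolding C by blast
    ultimately show ?thesis
      using abs_average_diff_le[of "core q m w'" "core q m w" "card (verts E)" "\<lambda>x. pos q m x c" "?r ^ m"]
        fin sub unfolding pos.simps by (simp add: aff_unif) (use C in blast)
  qed
  show ?case
    using T(2) Suc.prems main[of w w'] main[of w' w] by (auto simp: abs_minus_commute)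
qed

end

section \<open>The subdivision homeomorphism as a placement of vertices\<close>

lemma bary_sd_eq:
  assumes "fos_complex E" "x \<in> real_carrier (sd E)"
  shows "bary_sd x = aff (\<lambda>w. unif (elts w)) x"
proof
  fix v
  have "bary w v = unif (elts w) v" if "w \<in> supp x" for w
  proof -
    have "w \<in> verts (sd E)" using that supp_verts(1)[OF fos_complex_sd[OF assms(1)] assms(2)] by blast
    then obtain A where "w = S A" using sd_vertexD(3)[OF assms(1)] by blast
    then show ?thesis by (simp add: bary_def unif_def fcard.rep_eq)
  qed
  then show "bary_sd x v = aff (\<lambda>w. unif (elts w)) x v"
    unfolding bary_sd_def aff_def by (intro sum.cong refl) simp
qed

text \<open>With the constant predicate every element is active, so \<open>pos\<close> places each
  vertex at its usual iterated barycenter.\<close>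

lemma bary_sd_funpow:
  fixes E :: "('a hv, 'p::order) fos"
  assumes "fos_complex E" "x \<in> real_carrier (sds n E)"
  shows "(bary_sd ^^ n) x = aff (pos (\<lambda>_. True) n) x"
  using assms(2)
proof (induction n arbitrary: x)
  case 0
  then have "finite (supp x)" using supp_verts(2)[OF assms(1)] by simp
  moreover have "pos (\<lambda>_. True) 0 = (pt :: 'a hv \<Rightarrow> 'a hv \<Rightarrow> real)" by (rule ext) simp
  ultimately show ?case by (simp add: aff_pt_id)
next
  case (Suc n)
  let ?F = "sds n E"
  have F: "fos_complex ?F" by (rule fos_complex_sds[OF assms(1)])
  have x: "x \<in> real_carrier (sd ?F)" using Suc.prems by simp
  have xs: "supp x \<subseteq> verts (sd ?F)" "finite (supp x)"
    using supp_verts[OF fos_complex_sd[OF F] x] by auto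
  have e: "elts w \<in> simps ?F" "finite (elts w)" if "w \<in> supp x" for w
    using sd_vertexD(1,4)[OF F] xs that by blast+
  have "(\<Union>w\<in>supp x. supp (unif (elts w))) = (\<Union>w\<in>supp x. elts w)"
    using e by (simp add: supp_unif)
  then have "aff (\<lambda>w. unif (elts w)) x \<in> real_carrier ?F"
    using aff_real_carrier(1)[OF fos_complex_sd[OF F] F x, of "\<lambda>w. unif (elts w)"]
      unif_real_carrier[OF F e(1)] elts_top_of_chain(3)[OF F real_carrierD(2)[OF x]] by simp
  then have "(bary_sd ^^ n) (bary_sd x) = aff (pos (\<lambda>_. True) n) (aff (\<lambda>w. unif (elts w)) x)"
    using Suc.IH bary_sd_eq[OF F x] by simp
  also have "\<dots> = aff (\<lambda>w. aff (pos (\<lambda>_. True) n) (unif (elts w))) x"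
    using e xs by (intro ext aff_aff) (simp_all add: supp_unif)
  also have "\<dots> = aff (pos (\<lambda>_. True) (Suc n)) x"
  proof -
    have "active (\<lambda>_. True) n y" if "y \<in> verts ?F" for y
      using fos_simplexD(2)[OF assms(1) car_vertex[OF assms(1) that]] by (auto simp: active_def)
    then have "core (\<lambda>_. True) n w = elts w" if "w \<in> supp x" for w
      using fos_simplexD(3)[OF F e(1)[OF that]] by (auto simp: core_def)
    then show ?thesis unfolding aff_def[of _ x] by (intro ext sum.cong refl) simp
  qed
  finally show ?case by (simp add: funpow_swap1 del: pos.simps)
qed

section \<open>Straightening a map on the lower strata\<close>

text \<open>Meant for products of \<open>hE\<close> with a bounded function that is continuous only
  where \<open>hE\<close> is positive: the bound by \<open>G\<close> forces continuity at the
  zeros.\<close>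

lemma continuous_on_squeeze_zero:
  fixes F G :: "'x::topological_space \<Rightarrow> real"
  assumes G: "continuous_on T G" and FG: "\<And>z. z \<in> T \<Longrightarrow> 0 \<le> F z \<and> F z \<le> G z"
    and F: "continuous_on {z \<in> T. 0 < G z} F"
  shows "continuous_on T F"
  unfolding continuous_on_def
proof
  fix z assume z: "z \<in> T"
  show "(F \<longlongrightarrow> F z) (at z within T)"
  proof (cases "0 < G z")
    case True
    have "openin (top_of_set T) (T \<inter> G -` {0<..})"
      by (rule continuous_openin_preimage_gen[OF G]) simp
    then obtain W where W: "open W" "T \<inter> G -` {0<..} = T \<inter> W" by (auto simp: openin_open)
    have "at z within T = at z within {z \<in> T. 0 < G z}"
      by (rule at_within_nhd[of z W]) (use W z True in auto)
    then show ?thesis using F z True by (simp add: continuous_on_def)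
  next
    case False
    then have 0: "F z = 0" "G z = 0" using FG[OF z] by auto
    have "(G \<longlongrightarrow> 0) (at z within T)" using G z 0 by (auto simp: continuous_on_def)
    then show ?thesis unfolding 0
      by (rule tendsto_sandwich[rotated 3, of _ _ _ "\<lambda>_. 0"])
        (use FG in \<open>auto simp: eventually_at_topological intro!: exI[of _ UNIV]\<close>)
  qed
qed

text \<open>Closeness is measured in the finitely many coordinates of \<open>A\<close>, since the
  product topology over an arbitrary index type need not be metrizable. The pairs with values at
  least \<delta> apart form a compact set without diagonal points, so the coordinate distance has a
  positive minimum there.\<close>

lemma uniform_continuity_on_compact:
  fixes Y :: "('v \<Rightarrow> real) set" and f :: "('v \<Rightarrow> real) \<Rightarrow> real"
  assumes Y: "compact Y" and A: "finite A" "\<And>y. y \<in> Y \<Longrightarrow> supp y \<subseteq> A"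
    and f: "continuous_on Y f" and \<delta>: "0 < \<delta>"
  shows "\<exists>\<epsilon>>0. \<forall>y\<in>Y. \<forall>y'\<in>Y. (\<forall>v\<in>A. \<bar>y v - y' v\<bar> < \<epsilon>) \<longrightarrow> \<bar>f y - f y'\<bar> < \<delta>"
proof -
  let ?h = "\<lambda>z. \<bar>f (fst z) - f (snd z)\<bar>"
  let ?Z = "(Y \<times> Y) \<inter> ?h -` {\<delta>..}"
  let ?d = "\<lambda>z. \<Sum>v\<in>A. \<bar>fst z v - snd z v\<bar>"
  have "continuous_on (Y \<times> Y) ?h"
    by (intro continuous_intros continuous_on_compose2[OF f]) auto
  then have "closedin (top_of_set (Y \<times> Y)) ?Z"
    by (rule continuous_closedin_preimage) simp
  then have Z: "compact ?Z" using closedin_compact[OF compact_Times[OF Y Y]] by blast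
  have coord1: "continuous_on T (\<lambda>z. fst z v)" and coord2: "continuous_on T (\<lambda>z. snd z v)"
    for T :: "(('v \<Rightarrow> real) \<times> ('v \<Rightarrow> real)) set" and v
    by (rule continuous_on_compose2[OF continuous_on_product_coordinates[of v]];
        auto intro: continuous_intros)+
  show ?thesis
  proof (cases "?Z = {}")
    case True
    then have "\<bar>f y - f y'\<bar> < \<delta>" if "y \<in> Y" "y' \<in> Y" for y y' using that by force
    then show ?thesis by (intro exI[of _ 1]) auto
  next
    case False
    have "continuous_on ?Z ?d" by (intro continuous_intros coord1 coord2)
    then obtain z where z: "z \<in> ?Z" "\<And>z'. z' \<in> ?Z \<Longrightarrow> ?d z \<le> ?d z'"
      using continuous_attains_inf[OF Z False] by blast
    have "0 < ?d z"
    proof (rule ccontr)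
      assume "\<not> 0 < ?d z"
      moreover have "0 \<le> ?d z" by (rule sum_nonneg) simp
      ultimately have "?d z = 0" by linarith
      then have "fst z v = snd z v" if "v \<in> A" for v using A(1) that by (simp add: sum_nonneg_eq_0_iff)
      moreover have "fst z v = snd z v" if "v \<notin> A" for v
      proof -
        have "fst z \<in> Y" "snd z \<in> Y" using z(1) by auto
        then have "v \<notin> supp (fst z)" "v \<notin> supp (snd z)" using A(2) that by blast+
        then show ?thesis by (simp add: supp_def)
      qed
      ultimately have "fst z = snd z" by blast
      then show False using z(1) \<delta> by simp
    qed
    \<comment> \<open>Adding 1 makes the sum over \<open>A\<close> strictly smaller than the minimum
      and covers an empty \<open>A\<close>.\<close>
    let ?e = "?d z / (card A + 1)"
    have "\<bar>f y - f y'\<bar> < \<delta>" if y: "y \<in> Y" "y' \<in> Y" "\<forall>v\<in>A. \<bar>y v - y' v\<bar> < ?e" for y y'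
    proof (rule ccontr)
      assume "\<not> \<bar>f y - f y'\<bar> < \<delta>"
      then have "?d z \<le> ?d (y, y')" using y by (intro z(2)) auto
      also have "\<dots> \<le> (\<Sum>v\<in>A. ?e)" using y(3) by (intro sum_mono) (simp add: less_imp_le)
      also have "\<dots> < ?d z" using \<open>0 < ?d z\<close> by (simp add: field_simps)
      finally show False by simp
    qed
    then show ?thesis using \<open>0 < ?d z\<close> by (intro exI[of _ ?e]) simp
  qed
qed

text \<open>\<open>U\<close> holds the strata still to be treated. The second clause says that
  \<phi> maps the open star of \<open>v\<close> into the open star of \<open>g v\<close>, for
  vertices outside \<open>U\<close>.\<close>

definition star_cond ::
  "('v, 'p::order) fos \<Rightarrow> ('w, 'p) fos \<Rightarrow> 'p set \<Rightarrow> (('v \<Rightarrow> real) \<Rightarrow> 'w \<Rightarrow> real) \<Rightarrow> ('v \<Rightarrow> 'w) \<Rightarrow> bool" where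
  "star_cond E L U \<phi> g \<longleftrightarrow>
     (\<forall>v\<in>verts E. filt E v \<notin> U \<longrightarrow> filt L (g v) = filt E v) \<and>
     (\<forall>x\<in>real_carrier E. \<forall>v\<in>supp x. filt E v \<notin> U \<longrightarrow> g v \<in> supp (\<phi> x))"

text \<open>Locality of the new map, which part (2) relies on. As the modified barycenters may omit
  lower vertices, \<open>car m w\<close> can be larger than the support of the position; the
  nonempty sets \<open>d w\<close> give the exact support of \<open>y\<close>, and this form
  composes over stages.\<close>

definition carried ::
  "('a hv, 'p::order) fos \<Rightarrow> nat \<Rightarrow> ('a hv \<Rightarrow> 'a hv set) \<Rightarrow>
    (('a hv \<Rightarrow> real) \<Rightarrow> 'w \<Rightarrow> real) \<Rightarrow> (('a hv \<Rightarrow> real) \<Rightarrow> 'w \<Rightarrow> real) \<Rightarrow> bool" where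
  "carried E m d \<phi> \<phi>' \<longleftrightarrow>
     (\<forall>w\<in>verts (sds m E). d w \<noteq> {} \<and> d w \<subseteq> car m w) \<and>
     (\<forall>x\<in>real_carrier (sds m E). \<exists>y\<in>real_carrier E.
        supp y = (\<Union>w\<in>supp x. d w) \<and> supp (\<phi>' x) \<subseteq> supp (\<phi> y))"

section \<open>The map stretched away from the lower strata\<close>

locale star_step = upper_fos E U for E :: "('a hv, 'p::order) fos" and U +
  fixes L :: "('b, 'p) fos" and \<phi> :: "('a hv \<Rightarrow> real) \<Rightarrow> 'b \<Rightarrow> real" and g :: "'a hv \<Rightarrow> 'b"
  assumes L: "fos_complex L" and \<phi>: "strat_pres E L \<phi>" and star: "star_cond E L U \<phi> g"
begin

definition "VU = {v \<in> verts E. filt E v \<in> U}"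
definition "VN = {v \<in> verts E. filt E v \<notin> U}"
definition "W = (\<Union>x\<in>real_carrier E. supp (\<phi> x))"
definition "WU = {u \<in> W. filt L u \<in> U}"
definition "hE x = sum x VU" for x :: "'a hv \<Rightarrow> real"
definition "hL y = sum y WU" for y :: "'b \<Rightarrow> real"

text \<open>Rescales the parts inside and outside \<open>U\<close> so that the mass in
  \<open>U\<close> becomes \<open>max (hE x) s\<close>. The outer factor equals
  \<open>(1 - max (hE x) s) / (1 - hE x)\<close>, written so that for \<open>s < 1\<close> it stays
  defined at \<open>hE x = 1\<close>.\<close>

definition stretch :: "real \<Rightarrow> ('a hv \<Rightarrow> real) \<Rightarrow> 'a hv \<Rightarrow> real" where
  "stretch s x = (\<lambda>v. x v * (if filt E v \<in> U then max (hE x) s / hE x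
                                      else (1 - s) / max (1 - hE x) (1 - s)))"

text \<open>Normalized so that the coordinates over \<open>WU\<close> sum to 1 whenever
  \<open>\<phi> y\<close> has mass in \<open>U\<close>.\<close>

definition \<Psi> :: "('a hv \<Rightarrow> real) \<Rightarrow> 'b \<Rightarrow> real" where
  "\<Psi> y u = \<phi> y u / hL (\<phi> y)"

text \<open>On the strata outside \<open>U\<close> the map becomes the simplicial map \<open>g\<close>; the part in the strata of \<open>U\<close>
  is precomposed with the stretching away from the complementary subcomplex. The star condition
  keeps both parts in a common simplex, so that the stretching need not be small.\<close>

definition \<Phi> :: "real \<Rightarrow> ('a hv \<Rightarrow> real) \<Rightarrow> 'b \<Rightarrow> real" where
  "\<Phi> s x u = (if filt L u \<in> U then hE x * \<Psi> (stretch s x) u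
                     else \<Sum>v\<in>{v \<in> VN. g v = u}. x v)"

lemma finite_V: "finite (verts E)" "finite VU" "finite VN"
  using E(2) by (auto simp: VU_def VN_def fos_finite_def)

lemma finite_W: "finite W" "finite WU"
proof -
  obtain A where "finite A" "\<forall>x\<in>real_carrier E. supp (\<phi> x) \<subseteq> A"
    using strat_pres_finite_support[OF E L \<phi>] by blast
  then show "finite W" unfolding W_def by (auto intro: finite_subset)
  then show "finite WU" by (simp add: WU_def)
qed

lemma supp_\<phi>: "x \<in> real_carrier E \<Longrightarrow> supp (\<phi> x) \<subseteq> W"
  by (auto simp: W_def)

lemma sum_V: "sum x (verts E) = hE x + sum x VN" for x :: "'a hv \<Rightarrow> real"
proof -
  have "verts E = VU \<union> VN" "VU \<inter> VN = {}" by (auto simp: VU_def VN_def)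
  then show ?thesis using finite_V by (simp add: hE_def sum.union_disjoint)
qed

lemma sum_VN: "x \<in> real_carrier E \<Longrightarrow> sum x VN = 1 - hE x"
  using sum_V[of x] real_carrierD(3)[of x E] sum_supp_eq[OF finite_V(1) supp_verts(1)[OF E(1)], of x] by simp

lemma hE_bounds:
  assumes "x \<in> real_carrier E"
  shows "0 \<le> hE x" "hE x \<le> 1"
proof -
  show "0 \<le> hE x" using real_carrierD(1)[OF assms] by (simp add: hE_def sum_nonneg)
  have "0 \<le> sum x VN" using real_carrierD(1)[OF assms] by (simp add: sum_nonneg)
  then show "hE x \<le> 1" using sum_VN[OF assms] by simp
qed

lemma hE_pos_iff:
  assumes "x \<in> real_carrier E"
  shows "0 < hE x \<longleftrightarrow> (\<exists>v\<in>supp x. filt E v \<in> U)"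
proof -
  have "hE x = 0 \<longleftrightarrow> (\<forall>v\<in>VU. x v = 0)"
    unfolding hE_def using real_carrierD(1)[OF assms] finite_V by (simp add: sum_nonneg_eq_0_iff)
  then show ?thesis
    using hE_bounds(1)[OF assms] supp_verts(1)[OF E(1) assms] by (fastforce simp: VU_def supp_def less_le)
qed

lemma realp_in_U:
  assumes "fos_complex F" "y \<in> real_carrier F"
  shows "realp F y \<in> U \<longleftrightarrow> (\<exists>v\<in>supp y. filt F v \<in> U)"
  using realp_attained[OF assms] realp_upper[OF assms] up by metis

text \<open>For upward closed \<open>U\<close>, having mass in \<open>U\<close> is a condition on
  the stratum alone, so a stratum preserving map cannot lose it.\<close>

lemma hL_pos:
  assumes "x \<in> real_carrier E" "0 < hE x"
  shows "0 < hL (\<phi> x)"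
proof -
  have c: "\<phi> x \<in> real_carrier L" "realp L (\<phi> x) = realp E x"
    using strat_presD[OF E(1) L \<phi> assms(1)] by auto
  then obtain u where u: "u \<in> supp (\<phi> x)" "filt L u \<in> U"
    using assms realp_in_U[OF E(1) assms(1)] realp_in_U[OF L c(1)] hE_pos_iff by auto
  then have "u \<in> WU" using supp_\<phi>[OF assms(1)] by (auto simp: WU_def)
  moreover have "0 < \<phi> x u" using u real_carrierD(1)[OF c(1), of u] by (simp add: supp_def less_le)
  ultimately show ?thesis
    unfolding hL_def using real_carrierD(1)[OF c(1)] finite_W by (intro sum_pos2[of WU u]) auto
qed

lemma \<Psi>_props:
  assumes "x \<in> real_carrier E" "0 < hE x"
  shows "0 \<le> \<Psi> x u" "sum (\<Psi> x) WU = 1" "\<Psi> x u \<noteq> 0 \<longleftrightarrow> u \<in> supp (\<phi> x)"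
    and "filt L u \<in> U \<Longrightarrow> \<Psi> x u \<le> 1"
proof -
  note h = hL_pos[OF assms]
  have nn: "0 \<le> \<phi> x u" for u using real_carrierD(1)[OF strat_presD(1)[OF E(1) L \<phi> assms(1)]] .
  show nn': "0 \<le> \<Psi> x u" for u using nn h by (simp add: \<Psi>_def)
  show s: "sum (\<Psi> x) WU = 1" using h by (simp add: \<Psi>_def hL_def flip: sum_divide_distrib)
  show *: "\<Psi> x u \<noteq> 0 \<longleftrightarrow> u \<in> supp (\<phi> x)" using h by (simp add: \<Psi>_def supp_def)
  show "\<Psi> x u \<le> 1" if "filt L u \<in> U"
  proof (cases "u \<in> WU")
    case True
    then show ?thesis using member_le_sum[of u WU "\<Psi> x"] nn' finite_W s by simp
  next
    case False
    then have "\<Psi> x u = 0" using * supp_\<phi>[OF assms(1)] that by (auto simp: WU_def)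
    then show ?thesis by simp
  qed
qed

lemma stretch_props:
  assumes x: "x \<in> real_carrier E" "0 < hE x" and s: "0 \<le> s" "s < 1"
  shows "stretch s x \<in> real_carrier E" "supp (stretch s x) = supp x" "hE (stretch s x) = max (hE x) s"
proof -
  have m: "0 < max (1 - hE x) (1 - s)" using s by simp
  have nn: "0 \<le> stretch s x v" for v
    unfolding stretch_def using real_carrierD(1)[OF x(1), of v] x(2) s m by simp
  show s': "supp (stretch s x) = supp x"
    unfolding stretch_def supp_def using x(2) s m by auto
  have "hE (stretch s x) = (\<Sum>v\<in>VU. x v * (max (hE x) s / hE x))"
    unfolding hE_def[of "stretch s x"] by (rule sum.cong) (auto simp: stretch_def VU_def)
  also have "\<dots> = hE x * (max (hE x) s / hE x)" unfolding hE_def[of x] by (rule sum_distrib_right[symmetric])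
  finally show h: "hE (stretch s x) = max (hE x) s" using x(2) by simp
  have "sum (stretch s x) VN = (\<Sum>v\<in>VN. x v * ((1 - s) / max (1 - hE x) (1 - s)))"
    by (rule sum.cong) (auto simp: stretch_def VN_def)
  also have "\<dots> = (1 - hE x) * ((1 - s) / max (1 - hE x) (1 - s))"
    unfolding sum_VN[OF x(1), symmetric] by (rule sum_distrib_right[symmetric])
  also have "\<dots> = 1 - max (hE x) s" using s by (auto simp: max_def field_simps)
  finally have "sum (stretch s x) (verts E) = 1" unfolding sum_V h by simp
  then show "stretch s x \<in> real_carrier E"
    using real_carrierI[OF nn finite_V(1) _ _ E(1) real_carrierD(2)[OF x(1)]]
      s' supp_verts(1)[OF E(1) x(1)] by simp
qed

lemma stretch_0: "x \<in> real_carrier E \<Longrightarrow> 0 < hE x \<Longrightarrow> stretch 0 x = x"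
  unfolding stretch_def by (intro ext) (use hE_bounds[of x] in \<open>auto simp: max_def\<close>)

text \<open>The witness is the stretched point. It has the same support as \<open>x\<close>, so the
  star condition applies at it to the same vertices; thus the values of \<open>g\<close> and the
  upper part of the new map lie in one simplex.\<close>

lemma \<Phi>_supp:
  assumes x: "x \<in> real_carrier E" and s: "0 \<le> s" "s < 1"
  shows "\<exists>y\<in>real_carrier E. supp y = supp x \<and> supp (\<Phi> s x) \<subseteq> supp (\<phi> y) \<and>
    (\<forall>u. filt L u \<in> U \<longrightarrow> u \<in> supp (\<phi> y) \<longrightarrow> u \<in> supp (\<Phi> s x)) \<and> (s = 0 \<longrightarrow> y = x)"
proof -
  \<comment> \<open>Stretching divides by \<open>hE x\<close>; without mass in \<open>U\<close> the
    point itself serves.\<close>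
  let ?y = "if 0 < hE x then stretch s x else x"
  have y: "?y \<in> real_carrier E" "supp ?y = supp x" using stretch_props[OF x _ s] x by auto
  have N: "u \<in> supp (\<phi> ?y)" if "u \<in> supp (\<Phi> s x)" "filt L u \<notin> U" for u
  proof -
    have "(\<Sum>v\<in>{v \<in> VN. g v = u}. x v) \<noteq> 0" using that by (simp add: supp_def \<Phi>_def)
    then obtain v where "v \<in> VN" "g v = u" "v \<in> supp x"
      using sum.not_neutral_contains_not_neutral[of x "{v \<in> VN. g v = u}"] by (auto simp: supp_def)
    then show ?thesis using star y unfolding star_cond_def by (auto simp: VN_def)
  qed
  have U: "u \<in> supp (\<Phi> s x) \<longleftrightarrow> u \<in> supp (\<phi> ?y)" if "filt L u \<in> U" for u
  proof (cases "0 < hE x")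
    case True
    have "0 < hE (stretch s x)" using stretch_props(3)[OF x True s] True by simp
    then show ?thesis
      using True that \<Psi>_props(3)[OF stretch_props(1)[OF x True s], of u] by (simp add: \<Phi>_def supp_def)
  next
    case False
    have c: "\<phi> x \<in> real_carrier L" "realp L (\<phi> x) = realp E x"
      using strat_presD[OF E(1) L \<phi> x] by auto
    then have "u \<notin> supp (\<phi> x)"
      using False that realp_in_U[OF E(1) x] realp_in_U[OF L c(1)] hE_pos_iff[OF x] by auto
    moreover have "hE x = 0" using False hE_bounds[OF x] by simp
    ultimately show ?thesis using that by (simp add: \<Phi>_def supp_def)
  qed
  have "supp (\<Phi> s x) \<subseteq> supp (\<phi> ?y)" using N U by blast
  moreover have "s = 0 \<longrightarrow> ?y = x" using stretch_0[OF x] by simp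
  ultimately show ?thesis using y U by blast
qed

text \<open>The coordinate at \<open>g v\<close> sums \<open>x\<close> over a fibre of
  \<open>g\<close> that contains \<open>v\<close>. Hence the star condition for the lower strata
  survives the modification with the same \<open>g\<close>.\<close>

lemma \<Phi>_star:
  assumes x: "x \<in> real_carrier E" and v: "v \<in> supp x" "filt E v \<notin> U"
  shows "g v \<in> supp (\<Phi> s x)" "filt L (g v) = filt E v"
proof -
  have vN: "v \<in> VN" using v supp_verts(1)[OF E(1) x] by (auto simp: VN_def)
  then show f: "filt L (g v) = filt E v" using star by (simp add: star_cond_def VN_def)
  have "0 < (\<Sum>v'\<in>{v' \<in> VN. g v' = g v}. x v')"
    using vN v real_carrierD(1)[OF x] finite_V by (intro sum_pos2[of _ v]) (auto simp: supp_def less_le)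
  then show "g v \<in> supp (\<Phi> s x)" using f v by (simp add: supp_def \<Phi>_def)
qed

lemma \<Phi>_nonneg:
  assumes x: "x \<in> real_carrier E" and s: "0 \<le> s" "s < 1"
  shows "0 \<le> \<Phi> s x u"
proof (cases "0 < hE x")
  case True
  have "0 < hE (stretch s x)" using stretch_props(3)[OF x True s] True by simp
  then show ?thesis
    using \<Psi>_props(1)[OF stretch_props(1)[OF x True s]] True real_carrierD(1)[OF x]
    by (simp add: \<Phi>_def sum_nonneg)
next
  case False
  then show ?thesis using hE_bounds(1)[OF x] real_carrierD(1)[OF x] by (simp add: \<Phi>_def sum_nonneg)
qed

lemma \<Phi>_sum:
  assumes x: "x \<in> real_carrier E" and s: "0 \<le> s" "s < 1"
  shows "supp (\<Phi> s x) \<subseteq> W" "sum (\<Phi> s x) W = 1"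
proof -
  show sub: "supp (\<Phi> s x) \<subseteq> W" using \<Phi>_supp[OF x s] supp_\<phi> by blast
  have "W = WU \<union> (W - WU)" by (auto simp: WU_def)
  then have "sum (\<Phi> s x) W = sum (\<Phi> s x) WU + sum (\<Phi> s x) (W - WU)"
    using finite_W by (metis Diff_disjoint finite_Diff sum.union_disjoint)
  also have "sum (\<Phi> s x) WU = hE x"
  proof (cases "0 < hE x")
    case True
    have "0 < hE (stretch s x)" using stretch_props(3)[OF x True s] True by simp
    then have "sum (\<Psi> (stretch s x)) WU = 1" using \<Psi>_props(2)[OF stretch_props(1)[OF x True s]] by simp
    moreover have "sum (\<Phi> s x) WU = (\<Sum>u\<in>WU. hE x * \<Psi> (stretch s x) u)"
      by (rule sum.cong) (auto simp: \<Phi>_def WU_def)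
    ultimately show ?thesis by (simp flip: sum_distrib_left)
  next
    case False
    then have "hE x = 0" using hE_bounds[OF x] by simp
    then show ?thesis by (simp add: \<Phi>_def WU_def)
  qed
  also have "sum (\<Phi> s x) (W - WU) = (\<Sum>u\<in>W - WU. \<Sum>v\<in>{v \<in> VN \<inter> supp x. g v = u}. x v)"
  proof (rule sum.cong)
    fix u assume "u \<in> W - WU"
    then have "\<Phi> s x u = (\<Sum>v\<in>{v \<in> VN. g v = u}. x v)" by (auto simp: \<Phi>_def WU_def)
    also have "\<dots> = (\<Sum>v\<in>{v \<in> VN \<inter> supp x. g v = u}. x v)"
      using finite_V by (intro sum.mono_neutral_right) (auto simp: supp_def)
    finally show "\<Phi> s x u = (\<Sum>v\<in>{v \<in> VN \<inter> supp x. g v = u}. x v)" .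
  qed simp
  \<comment> \<open>Grouping by the fibres of \<open>g\<close>, whose values lie in
    \<open>W - WU\<close> because \<open>\<Phi>_star\<close> puts them into the support and outside
    \<open>U\<close>.\<close>
  also have "\<dots> = sum x (VN \<inter> supp x)"
  proof (rule sum.group)
    show "g ` (VN \<inter> supp x) \<subseteq> W - WU"
    proof
      fix u assume "u \<in> g ` (VN \<inter> supp x)"
      then obtain v where v: "v \<in> VN" "v \<in> supp x" "u = g v" by auto
      then have "u \<in> supp (\<Phi> s x)" "filt L u = filt E v" "filt E v \<notin> U"
        using \<Phi>_star[OF x, of v] by (auto simp: VN_def)
      then show "u \<in> W - WU" using sub by (auto simp: WU_def)
    qed
  qed (use finite_V finite_W in auto)
  also have "\<dots> = sum x VN"
    using finite_V by (intro sum.mono_neutral_left) (auto simp: supp_def)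
  finally show "sum (\<Phi> s x) W = 1" using sum_VN[OF x] by simp
qed

lemma \<Phi>_real_carrier:
  assumes x: "x \<in> real_carrier E" and s: "0 \<le> s" "s < 1"
  shows "\<Phi> s x \<in> real_carrier L" "realp L (\<Phi> s x) = realp E x"
proof -
  obtain y where y: "y \<in> real_carrier E" "supp y = supp x" "supp (\<Phi> s x) \<subseteq> supp (\<phi> y)"
    "\<And>u. filt L u \<in> U \<Longrightarrow> u \<in> supp (\<phi> y) \<Longrightarrow> u \<in> supp (\<Phi> s x)"
    using \<Phi>_supp[OF x s] by blast
  have c: "\<phi> y \<in> real_carrier L" "realp L (\<phi> y) = realp E y" using strat_presD[OF E(1) L \<phi> y(1)] by auto
  have ry: "realp E y = realp E x" using y(2) by (simp add: realp_def)
  show "\<Phi> s x \<in> real_carrier L"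
    using real_carrierI[OF \<Phi>_nonneg[OF x s] finite_W(1) \<Phi>_sum[OF x s] L real_carrierD(2)[OF c(1)] y(3)] .
  obtain u where u: "u \<in> supp (\<Phi> s x)" "filt L u = realp E x"
  proof (cases "realp E x \<in> U")
    case True
    obtain u where u: "u \<in> supp (\<phi> y)" "filt L u = realp E x"
      using realp_attained[OF L c(1)] c(2) ry by auto
    then have "u \<in> supp (\<Phi> s x)" using y(4) True by simp
    then show ?thesis using that u(2) by blast
  next
    case False
    obtain v where "v \<in> supp x" "filt E v = realp E x" using realp_attained[OF E(1) x] by blast
    then show ?thesis using that[of "g v"] \<Phi>_star[OF x, of v] False by simp
  qed
  show "realp L (\<Phi> s x) = realp E x"
    by (rule realp_eqI[OF u]) (use realp_upper[OF L c(1)] c(2) ry y(3) in auto)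
qed

lemma continuous_hE: "continuous_on T hE"
  unfolding hE_def by (intro continuous_intros continuous_on_subset[OF continuous_on_product_coordinates]) auto

lemma continuous_\<Psi>: "continuous_on {x \<in> real_carrier E. 0 < hE x} (\<lambda>x. \<Psi> x u)"
proof -
  have "continuous_on {x \<in> real_carrier E. 0 < hE x} (\<lambda>x. \<phi> x u)" for u
    by (rule continuous_on_subset[OF strat_pres_coordinate[OF E L \<phi>]]) auto
  then show ?thesis
    unfolding \<Psi>_def hL_def using hL_pos[unfolded hL_def] by (intro continuous_intros) (auto simp: less_le)
qed

text \<open>The bound \<open>b < 1\<close> keeps the outer denominator of \<open>stretch\<close>
  positive. Near the zeros of \<open>hE\<close> the normalized coordinates are merely bounded by 1,
  and the factor \<open>hE\<close> restores continuity.\<close>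

lemma continuous_\<Phi>:
  assumes "0 \<le> b" "b < 1"
  shows "continuous_on ({0..b} \<times> real_carrier E) (\<lambda>z. \<Phi> (fst z) (snd z) u)"
proof (cases "filt L u \<in> U")
  case False
  have "continuous_on T (\<lambda>z. snd z v)" for T :: "(real \<times> ('a hv \<Rightarrow> real)) set" and v
    by (rule continuous_on_compose2[OF continuous_on_product_coordinates[of v]])
      (auto intro: continuous_intros)
  then show ?thesis using False unfolding \<Phi>_def by (auto intro!: continuous_intros)
next
  case True
  let ?T = "{0..b} \<times> real_carrier E"
  have coord: "continuous_on T (\<lambda>z. snd z v)" for T :: "(real \<times> ('a hv \<Rightarrow> real)) set" and v
    by (rule continuous_on_compose2[OF continuous_on_product_coordinates[of v]])
      (auto intro: continuous_intros)
  have h: "continuous_on T (\<lambda>z. hE (snd z))" for T :: "(real \<times> ('a hv \<Rightarrow> real)) set"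
    by (rule continuous_on_compose2[OF continuous_hE[of UNIV]]) (auto intro: continuous_intros)
  have S: "continuous_on {z \<in> ?T. 0 < hE (snd z)} (\<lambda>z. stretch (fst z) (snd z))"
    unfolding stretch_def
  proof (rule continuous_on_coordinatewise_then_product)
    fix v
    show "continuous_on {z \<in> ?T. 0 < hE (snd z)} (\<lambda>z. snd z v * (if filt E v \<in> U
        then max (hE (snd z)) (fst z) / hE (snd z)
        else (1 - fst z) / max (1 - hE (snd z)) (1 - fst z)))"
    proof (cases "filt E v \<in> U")
      case True
      then show ?thesis by (auto intro!: continuous_intros coord h)
    next
      case False
      have "max (1 - hE (snd z)) (1 - fst z) \<noteq> 0" if "z \<in> {z \<in> ?T. 0 < hE (snd z)}" for z
        using that assms by (auto simp: max_def)
      then have "continuous_on {z \<in> ?T. 0 < hE (snd z)}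
          (\<lambda>z. snd z v * ((1 - fst z) / max (1 - hE (snd z)) (1 - fst z)))"
        by (intro continuous_intros coord h ballI)
      then show ?thesis using False by simp
    qed
  qed
  have "continuous_on ?T (\<lambda>z. hE (snd z) * \<Psi> (stretch (fst z) (snd z)) u)"
  proof (rule continuous_on_squeeze_zero[OF h])
    have "continuous_on {z \<in> ?T. 0 < hE (snd z)} (\<lambda>z. \<Psi> (stretch (fst z) (snd z)) u)"
    proof (rule continuous_on_compose2[OF continuous_\<Psi> S], safe)
      fix s x assume "s \<in> {0..b}" "x \<in> real_carrier E" "0 < hE (snd (s, x))"
      then show "stretch (fst (s, x)) (snd (s, x)) \<in> real_carrier E" "0 < hE (stretch (fst (s, x)) (snd (s, x)))"
        using stretch_props[of x s] assms by auto
    qed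
    then show "continuous_on {z \<in> ?T. 0 < hE (snd z)} (\<lambda>z. hE (snd z) * \<Psi> (stretch (fst z) (snd z)) u)"
      by (intro continuous_intros h)
  next
    fix z assume z: "z \<in> ?T"
    then have zx: "snd z \<in> real_carrier E" "0 \<le> fst z" "fst z < 1" using assms by auto
    show "0 \<le> hE (snd z) * \<Psi> (stretch (fst z) (snd z)) u \<and>
        hE (snd z) * \<Psi> (stretch (fst z) (snd z)) u \<le> hE (snd z)"
    proof (cases "0 < hE (snd z)")
      case h: True
      have "0 < hE (stretch (fst z) (snd z))" using stretch_props(3)[OF zx(1) h zx(2,3)] h by simp
      then show ?thesis
        using \<Psi>_props(1,4)[OF stretch_props(1)[OF zx(1) h zx(2,3)], of u] True h
        by (simp add: mult_left_le)
    next
      case False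
      then have "hE (snd z) = 0" using hE_bounds[OF zx(1)] by simp
      then show ?thesis by simp
    qed
  qed
  then show ?thesis using True by (simp add: \<Phi>_def)
qed

lemma \<Phi>_strat_pres:
  assumes "0 \<le> s" "s < 1"
  shows "strat_pres E L (\<Phi> s)"
proof (rule strat_presI[OF E L _ _ finite_W(1)])
  fix u
  show "continuous_on (real_carrier E) (\<lambda>x. \<Phi> s x u)"
  proof -
    have "continuous_on (real_carrier E) (\<lambda>x. \<Phi> (fst (s, x)) (snd (s, x)) u)"
      by (rule continuous_on_compose2[OF continuous_\<Phi>[OF assms, of u], of _ "\<lambda>x. (s, x)"])
        (use assms in \<open>auto intro!: continuous_intros\<close>)
    then show ?thesis by simp
  qed
qed (use \<Phi>_real_carrier \<Phi>_sum assms in auto)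

text \<open>The parameter is lowered to 0, where the stretched point is \<open>x\<close> itself and
  the support of \<open>\<Phi> 0 x\<close> lies in that of \<open>\<phi> x\<close>; a straight line
  finishes.\<close>

lemma \<Phi>_htpy:
  assumes "0 \<le> b" "b < 1"
  shows "strat_htpy E L (\<Phi> b) \<phi>"
proof -
  have "strat_htpy E L (\<Phi> 0) \<phi>"
  proof (rule straight_line_htpy[OF E L \<Phi>_strat_pres \<phi>])
    fix x assume x: "x \<in> real_carrier E"
    have "supp (\<Phi> 0 x) \<subseteq> supp (\<phi> x)" using \<Phi>_supp[OF x, of 0] by auto
    then have "supp (\<Phi> 0 x) \<union> supp (\<phi> x) = supp (\<phi> x)" by blast
    then show "supp (\<Phi> 0 x) \<union> supp (\<phi> x) \<in> simps L"
      using real_carrierD(2)[OF strat_presD(1)[OF E(1) L \<phi> x]] by simp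
  qed auto
  moreover have "strat_htpy E L (\<Phi> 0) (\<Phi> b)"
  proof (rule strat_htpyI[OF E L, of "\<lambda>s. \<Phi> (s * b)" W])
    fix u
    have "continuous_on ({0..1} \<times> real_carrier E) (\<lambda>z. \<Phi> (fst (fst z * b, snd z)) (snd (fst z * b, snd z)) u)"
      by (rule continuous_on_compose2[OF continuous_\<Phi>[OF assms, of u], of _ "\<lambda>z. (fst z * b, snd z)"])
        (use assms in \<open>auto intro!: continuous_on_Pair continuous_on_mult continuous_on_fst
            continuous_on_snd continuous_on_id continuous_on_const simp: mult_left_le_one_le\<close>)
    then show "continuous_on ({0..1} \<times> real_carrier E) (\<lambda>(s, x). \<Phi> (s * b) x u)"
      by (simp add: case_prod_unfold)
  next
    fix s :: real and x assume "0 \<le> s" "s \<le> 1" "x \<in> real_carrier E"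
    moreover from this have "0 \<le> s * b" "s * b < 1"
      using assms mult_left_le_one_le[of b s] by auto
    ultimately show "\<Phi> (s * b) x \<in> real_carrier L" "supp (\<Phi> (s * b) x) \<subseteq> W"
      "realp L (\<Phi> (s * b) x) = realp E x"
      using \<Phi>_real_carrier \<Phi>_sum by blast+
  qed (use finite_W in auto)
  ultimately show ?thesis using strat_htpy_sym strat_htpy_trans by blast
qed

end

section \<open>Simplicial approximation\<close>

text \<open>Both maps send every vertex into its carrier, so a straight line connects them.\<close>

lemma (in upper_fos) pos_htpy_lvn:
  "strat_htpy (sds m E) E (aff (pos q m)) (real_map (lvn E m))"
proof -
  have Em: "fos_complex (sds m E)" "fos_finite (sds m E)"
    using fos_complex_sds[OF E(1)] fos_finite_sds[OF E] by auto
  have "strat_simplicial (lvn E m) (sds m E) E"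
    using lvn_morphism[OF E(1)] by (simp add: fos_morphism_iff)
  then have l: "strat_pres (sds m E) E (real_map (lvn E m))" by (rule real_map_strat_pres[OF Em E(1)])
  show ?thesis
  proof (rule straight_line_htpy[OF Em E(1) pos_strat_pres l])
    fix x assume x: "x \<in> real_carrier (sds m E)"
    have "lvn E m ` supp x \<subseteq> (\<Union>w\<in>supp x. car m w)"
      using lvn_in_car[OF E(1)] supp_verts(1)[OF Em(1) x] by blast
    then show "supp (aff (pos q m) x) \<union> supp (real_map (lvn E m) x) \<in> simps E"
      using supp_aff_pos_car[OF x] supp_verts(3)[OF Em(1) x] unfolding supp_real_map[OF Em(1) x]
      by (intro fos_face[OF E(1) car_simplex[OF E(1) real_carrierD(2)[OF x]]]) auto
  qed
qed

section \<open>Treating one minimal stratum\<close>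

context star_step
begin

text \<open>The tolerance \<open>1 / card WU\<close> is a lower bound for the largest normalized
  coordinate. The bound 1/2 on the mass in \<open>U\<close> makes the domain compact and \<Psi>
  continuous on it.\<close>

lemma \<Psi>_uniform:
  "\<exists>\<epsilon>>0. \<forall>y\<in>{x \<in> real_carrier E. 1 / 2 \<le> hE x}. \<forall>y'\<in>{x \<in> real_carrier E. 1 / 2 \<le> hE x}.
     (\<forall>v\<in>verts E. \<bar>y v - y' v\<bar> < \<epsilon>) \<longrightarrow> (\<forall>u\<in>WU. \<bar>\<Psi> y u - \<Psi> y' u\<bar> < 1 / card WU)"
proof -
  let ?Y = "{x \<in> real_carrier E. 1 / 2 \<le> hE x}"
  have "closedin (top_of_set (real_carrier E)) (real_carrier E \<inter> hE -` {1/2..})"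
    by (rule continuous_closedin_preimage[OF continuous_hE]) simp
  moreover have "real_carrier E \<inter> hE -` {1/2..} = ?Y" by auto
  ultimately have Y: "compact ?Y" using closedin_compact[OF compact_real_carrier[OF E]] by simp
  have sub: "supp y \<subseteq> verts E" if "y \<in> ?Y" for y using supp_verts(1)[OF E(1)] that by simp
  have "\<forall>u\<in>WU. \<exists>\<epsilon>. 0 < \<epsilon> \<and> (\<forall>y\<in>?Y. \<forall>y'\<in>?Y.
      (\<forall>v\<in>verts E. \<bar>y v - y' v\<bar> < \<epsilon>) \<longrightarrow> \<bar>\<Psi> y u - \<Psi> y' u\<bar> < 1 / card WU)"
  proof
    fix u assume "u \<in> WU"
    then have "0 < 1 / real (card WU)" using finite_W by (auto simp: card_gt_0_iff)
    moreover have "continuous_on ?Y (\<lambda>y. \<Psi> y u)" by (rule continuous_on_subset[OF continuous_\<Psi>]) auto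
    ultimately show "\<exists>\<epsilon>. 0 < \<epsilon> \<and> (\<forall>y\<in>?Y. \<forall>y'\<in>?Y.
        (\<forall>v\<in>verts E. \<bar>y v - y' v\<bar> < \<epsilon>) \<longrightarrow> \<bar>\<Psi> y u - \<Psi> y' u\<bar> < 1 / card WU)"
      by (intro uniform_continuity_on_compact[OF Y finite_V(1) sub])
  qed
  from bchoice[OF this] obtain e where e: "\<forall>u\<in>WU. 0 < e u \<and> (\<forall>y\<in>?Y. \<forall>y'\<in>?Y.
      (\<forall>v\<in>verts E. \<bar>y v - y' v\<bar> < e u) \<longrightarrow> \<bar>\<Psi> y u - \<Psi> y' u\<bar> < 1 / card WU)" ..
  \<comment> \<open>Inserting 1 keeps the set nonempty when \<open>WU\<close> is empty.\<close>
  let ?e = "Min (insert 1 (e ` WU))"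
  have "0 < ?e" using finite_W e by (subst Min_gr_iff) auto
  moreover have "?e \<le> e u" if "u \<in> WU" for u using finite_W that by (intro Min_le) auto
  ultimately show ?thesis
  proof (intro exI[of _ ?e] conjI ballI impI)
    fix y y' u
    assume y: "y \<in> ?Y" "y' \<in> ?Y" "\<forall>v\<in>verts E. \<bar>y v - y' v\<bar> < ?e" and u: "u \<in> WU"
    then have "\<forall>v\<in>verts E. \<bar>y v - y' v\<bar> < e u"
      using \<open>\<And>u. u \<in> WU \<Longrightarrow> ?e \<le> e u\<close>[OF u] by (auto intro: less_le_trans)
    then show "\<bar>\<Psi> y u - \<Psi> y' u\<bar> < 1 / card WU" using e y(1,2) u by blast
  qed
qed

text \<open>One stage of the induction. As \<open>p\<close> is minimal in \<open>U\<close>, a vertex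
  of L with stratum in \<open>U\<close> that supports the value at a point of stratum
  \<open>p\<close> must itself have stratum \<open>p\<close>.\<close>

lemma refine:
  assumes p: "p \<in> U" "\<And>a. a \<in> U \<Longrightarrow> a \<le> p \<Longrightarrow> a = p"
  shows "\<exists>m \<phi>' g' d. strat_pres (sds m E) L \<phi>' \<and>
    strat_htpy (sds m E) L \<phi>' (\<phi> \<circ> real_map (lvn E m)) \<and>
    star_cond (sds m E) L (U - {p}) \<phi>' g' \<and> carried E m d \<phi> \<phi>'"
proof -
  let ?Y = "{x \<in> real_carrier E. 1 / 2 \<le> hE x}"
  obtain \<epsilon> where \<epsilon>: "0 < \<epsilon>" "\<And>y y' u. y \<in> ?Y \<Longrightarrow> y' \<in> ?Y \<Longrightarrow> (\<forall>v\<in>verts E. \<bar>y v - y' v\<bar> < \<epsilon>) \<Longrightarrow>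
      u \<in> WU \<Longrightarrow> \<bar>\<Psi> y u - \<Psi> y' u\<bar> < 1 / card WU"
    using \<Psi>_uniform by blast
  \<comment> \<open>\<open>b \<ge> 1 / 2\<close> puts stretched points into \<open>?Y\<close>;
    \<open>1 - b \<le> \<epsilon> / 2\<close> bounds both the remaining lower mass and the shrinking
    of the normalized coordinates.\<close>
  define b where "b = 1 - min (1/2) (\<epsilon> / 2)"
  have b: "0 \<le> b" "b < 1" "1 / 2 \<le> b" "1 - b \<le> \<epsilon> / 2" using \<epsilon>(1) by (auto simp: b_def)
  let ?r = "1 - 1 / real (card (verts E))"
  \<comment> \<open>For an empty complex the factor is 1 and its powers do not tend to 0; hence the
    guard.\<close>
  obtain m where m: "verts E \<noteq> {} \<Longrightarrow> ?r ^ m < \<epsilon> / 2"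
  proof (cases "verts E = {}")
    case False
    then have "0 < card (verts E)" using finite_V by (simp add: card_gt_0_iff)
    then have "0 \<le> ?r" "?r < 1" by simp_all
    then show ?thesis using real_arch_pow_inv[of "\<epsilon> / 2" ?r] \<epsilon>(1) that by auto
  qed blast
  let ?F = "sds m E" and ?P = "pos q m"
  have F: "fos_complex ?F" "fos_finite ?F" using fos_complex_sds[OF E(1)] fos_finite_sds[OF E] by auto
  have A: "aff ?P x \<in> real_carrier E" "realp E (aff ?P x) = realp ?F x" if "x \<in> real_carrier ?F" for x
    using strat_presD[OF F(1) E(1) pos_strat_pres that] by auto
  have Fv: "w \<in> verts ?F" if "x \<in> real_carrier ?F" "w \<in> supp x" for x w
    using supp_verts(1)[OF F(1)] that by blast
  have outer: "\<exists>c. c \<in> supp (?P v) \<and> filt E c = filt ?F v" if "v \<in> verts ?F" for v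
    using realp_attained[OF E(1) pos_real_carrier[OF that]] realp_pos[OF that] by auto
  have hE_pos: "hE (?P w) = 1" if "w \<in> verts ?F" "active q m w" for w
  proof -
    have "sum (?P w) VN = 0" using supp_pos_active[OF that] by (intro sum.neutral) (auto simp: VN_def supp_def)
    then show ?thesis using sum_VN[OF pos_real_carrier[OF that(1)]] by simp
  qed
  have pos_inact: "?P w c = 0" if "w \<in> verts ?F" "\<not> active q m w" "q c" for w c
    using supp_pos_inactive[OF that(1,2)] that(2,3) by (auto simp: active_def supp_def)
  have inner: "\<exists>u. filt L u = p \<and> (\<forall>x\<in>real_carrier ?F. v \<in> supp x \<longrightarrow> u \<in> supp (\<Phi> b (aff ?P x)))"
    if v: "v \<in> verts ?F" "filt ?F v = p" for v
  proof -
    let ?y = "?P v"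
    have act: "active q m v" using active_iff[OF v(1)] v(2) p(1) by simp
    have y: "?y \<in> real_carrier E" "hE ?y = 1" "realp E ?y = p"
      using pos_real_carrier[OF v(1)] hE_pos[OF v(1) act] realp_pos[OF v(1)] v(2) by auto
    have ne: "verts E \<noteq> {}" using supp_verts(1,3)[OF E(1) y(1)] by blast
    have c: "\<phi> ?y \<in> real_carrier L" "realp L (\<phi> ?y) = p"
      using strat_presD[OF E(1) L \<phi> y(1)] y(3) by auto
    have s1: "sum (\<Psi> ?y) WU = 1" using \<Psi>_props(2)[OF y(1)] y(2) by simp
    \<comment> \<open>A coordinate that is not below the mean of the normalized coordinates at the
      position of \<open>v\<close>.\<close>
    obtain u where u: "u \<in> WU" "1 / card WU \<le> \<Psi> ?y u"
    proof (rule ccontr)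
      assume "\<not> thesis"
      then have "\<Psi> ?y u < 1 / card WU" if "u \<in> WU" for u using that \<open>\<And>u. u \<in> WU \<Longrightarrow> _ \<Longrightarrow> thesis\<close> by force
      moreover have "WU \<noteq> {}" using s1 by auto
      ultimately have "sum (\<Psi> ?y) WU < (\<Sum>u\<in>WU. 1 / card WU)" using finite_W by (intro sum_strict_mono) auto
      then show False using s1 \<open>WU \<noteq> {}\<close> finite_W by simp
    qed
    have wu: "0 < 1 / real (card WU)" using u(1) finite_W by (auto simp: card_gt_0_iff)
    then have "u \<in> supp (\<phi> ?y)" using u(2) \<Psi>_props(3)[OF y(1), of u] y(2) by auto
    then have "filt L u \<le> p" using realp_upper[OF L c(1)] c(2) by metis
    then have fu: "filt L u = p" using p(2) u(1) by (simp add: WU_def)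
    have "u \<in> supp (\<Phi> b (aff ?P x))" if x: "x \<in> real_carrier ?F" "v \<in> supp x" for x
    proof -
      let ?z = "aff ?P x"
      let ?A = "{w \<in> supp x. active q m w}"
      have fin: "finite (supp x)" by (rule supp_verts(2)[OF F(1) x(1)])
      have xnn: "0 \<le> x w" for w by (rule real_carrierD(1)[OF x(1)])
      \<comment> \<open>The mass of \<open>?z\<close> in \<open>U\<close> is the total weight of the
        active vertices, since each of them has all its mass there and the others have none.\<close>
      have "hE ?z = (\<Sum>w\<in>supp x. x w * hE (?P w))"
        unfolding hE_def by (rule sum_aff[OF fin finite_V(2)])
      also have "\<dots> = sum x ?A"
      proof (rule sum.mono_neutral_cong_right[OF fin])
        show "\<forall>w\<in>supp x - ?A. x w * hE (?P w) = 0"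
          using pos_inact Fv[OF x(1)] by (auto simp: hE_def VU_def intro!: sum.neutral)
      qed (use hE_pos Fv[OF x(1)] in auto)
      finally have hz: "hE ?z = sum x ?A" .
      have "0 < x v" using x(2) xnn[of v] by (simp add: supp_def less_le)
      then have pz: "0 < hE ?z"
        unfolding hz using fin x(2) act xnn by (intro sum_pos2[of _ v]) auto
      let ?z' = "stretch b ?z"
      note zc = A(1)[OF x(1)]
      have z': "?z' \<in> real_carrier E" "hE ?z' = max (hE ?z) b"
        using stretch_props[OF zc pz b(1,2)] by auto
      \<comment> \<open>For \<open>k\<close> in the upper strata the comparison passes through
        \<open>?z k / hE ?z\<close>: the mesh puts it within \<open>\<epsilon> / 2\<close> of
        \<open>?y k\<close>, and stretching to mass at least \<open>b\<close> leaves
        \<open>?z' k\<close> within \<open>1 - b\<close> of it. The other coordinates of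
        \<open>?z'\<close> are bounded by the lower mass, and those of \<open>?y\<close>
        vanish.\<close>
      have "\<bar>?z' k - ?y k\<bar> < \<epsilon>" if k: "k \<in> verts E" for k
      proof (cases "q k")
        case True
        have "?z k = (\<Sum>w\<in>supp x. x w * ?P w k)" by (simp add: aff_def)
        also have "\<dots> = (\<Sum>w\<in>?A. x w * ?P w k)"
          using pos_inact Fv[OF x(1)] True by (intro sum.mono_neutral_right[OF fin]) auto
        finally have zk: "?z k = (\<Sum>w\<in>?A. x w * ?P w k)" .
        have "?z k - hE ?z * ?y k = (\<Sum>w\<in>?A. x w * (?P w k - ?y k))"
          by (simp add: zk hz sum_distrib_right sum_subtractf right_diff_distrib)
        also have "\<bar>\<dots>\<bar> \<le> (\<Sum>w\<in>?A. x w * ?r ^ m)"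
        proof (intro order_trans[OF sum_abs] sum_mono)
          fix w assume w: "w \<in> ?A"
          then have "\<bar>?P w k - ?y k\<bar> \<le> ?r ^ m"
            using pos_mesh[OF real_carrierD(2)[OF x(1)]] x(2) act by blast
          then show "\<bar>x w * (?P w k - ?y k)\<bar> \<le> x w * ?r ^ m"
            using xnn[of w] by (simp add: abs_mult mult_left_mono)
        qed
        also have "\<dots> = hE ?z * ?r ^ m" by (simp add: hz sum_distrib_right)
        finally have "\<bar>?z k / hE ?z - ?y k\<bar> \<le> ?r ^ m"
          using pz by (simp add: abs_le_iff field_simps)
        then have d1: "\<bar>?z k / hE ?z - ?y k\<bar> < \<epsilon> / 2" using m[OF ne] by linarith
        have "k \<in> VU" using True k by (simp add: VU_def)
        then have "?z k \<le> hE ?z"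
          unfolding hE_def using finite_V real_carrierD(1)[OF zc] by (intro member_le_sum) auto
        then have r01: "0 \<le> ?z k / hE ?z" "?z k / hE ?z \<le> 1" using pz real_carrierD(1)[OF zc, of k] by auto
        have "?z' k = ?z k / hE ?z * max (hE ?z) b" using True by (simp add: stretch_def)
        then have "?z k / hE ?z - ?z' k = ?z k / hE ?z * (1 - max (hE ?z) b)" by (simp add: right_diff_distrib)
        moreover have "0 \<le> 1 - max (hE ?z) b" "1 - max (hE ?z) b \<le> 1 - b"
          using hE_bounds(2)[OF zc] b(2) by auto
        ultimately have "0 \<le> ?z k / hE ?z - ?z' k" "?z k / hE ?z - ?z' k \<le> 1 * (1 - b)"
          using r01 by (auto simp only: intro!: mult_nonneg_nonneg mult_mono)
        moreover have "\<bar>z - y\<bar> < e" if "0 \<le> a - z" "a - z \<le> 1 * (1 - b)" "\<bar>a - y\<bar> < e / 2" "1 - b \<le> e / 2"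
          for a y z e :: real using that(1,2,4) that(3)[unfolded abs_less_iff] unfolding abs_less_iff by auto
        ultimately show ?thesis using d1 b(4) by blast
      next
        case False
        then have "k \<in> VN" using k by (simp add: VN_def)
        then have "?z' k \<le> sum ?z' VN" using finite_V real_carrierD(1)[OF z'(1)] by (intro member_le_sum) auto
        also have "\<dots> \<le> 1 - b" using sum_VN[OF z'(1)] z'(2) by simp
        finally have "?z' k \<le> 1 - b" .
        moreover have "?y k = 0" using supp_pos_active[OF v(1) act] False by (auto simp: supp_def)
        moreover have "0 \<le> ?z' k" by (rule real_carrierD(1)[OF z'(1)])
        ultimately show ?thesis using b(4) \<epsilon>(1) by simp
      qed
      then have "\<bar>\<Psi> ?z' u - \<Psi> ?y u\<bar> < 1 / card WU"
        using z' y b(3) u(1) by (intro \<epsilon>(2)) auto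
      then have "0 < \<Psi> ?z' u" using u(2) by linarith
      then show ?thesis using pz fu p(1) by (simp add: \<Phi>_def supp_def)
    qed
    then show ?thesis using fu by blast
  qed
  \<comment> \<open>In stratum \<open>p\<close> the vertex found by pigeonhole is used. Outside
    \<open>U\<close> the old \<open>g\<close> is evaluated at a vertex of the position of
    \<open>v\<close> in the same stratum; that vertex supports the image of every point in the star
    of \<open>v\<close>.\<close>
  define g' where "g' v = (if filt ?F v = p
      then SOME u. filt L u = p \<and> (\<forall>x\<in>real_carrier ?F. v \<in> supp x \<longrightarrow> u \<in> supp (\<Phi> b (aff ?P x)))
      else g (SOME c. c \<in> supp (?P v) \<and> filt E c = filt ?F v))" for v
  let ?\<phi>' = "\<Phi> b \<circ> aff ?P"
  have g'p: "filt L (g' v) = p" "x \<in> real_carrier ?F \<Longrightarrow> v \<in> supp x \<Longrightarrow> g' v \<in> supp (?\<phi>' x)"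
    if "v \<in> verts ?F" "filt ?F v = p" for v x
    using someI_ex[OF inner[OF that]] that(2) by (simp_all add: g'_def)
  have g'N: "filt L (g' v) = filt ?F v" "x \<in> real_carrier ?F \<Longrightarrow> v \<in> supp x \<Longrightarrow> g' v \<in> supp (?\<phi>' x)"
    if v: "v \<in> verts ?F" "filt ?F v \<notin> U" for v x
  proof -
    define c where "c = (SOME c. c \<in> supp (?P v) \<and> filt E c = filt ?F v)"
    have c: "c \<in> supp (?P v)" "filt E c = filt ?F v" using someI_ex[OF outer[OF v(1)]] by (simp_all add: c_def)
    have g'c: "g' v = g c" using v(2) p(1) by (auto simp: g'_def c_def)
    show "filt L (g' v) = filt ?F v"
      unfolding g'c using \<Phi>_star(2)[OF pos_real_carrier[OF v(1)] c(1)] c(2) v(2) by simp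
    assume x: "x \<in> real_carrier ?F" "v \<in> supp x"
    have "c \<in> supp (aff ?P x)" unfolding supp_aff_pos[OF x(1)] using c(1) x(2) by blast
    then show "g' v \<in> supp (?\<phi>' x)"
      unfolding g'c using \<Phi>_star(1)[OF A(1)[OF x(1)], of c b] c(2) v(2) by simp
  qed
  have "strat_pres ?F L ?\<phi>'"
    by (rule strat_pres_compose[OF F(1) E(1) pos_strat_pres \<Phi>_strat_pres[OF b(1,2)]])
  moreover have "strat_htpy ?F L ?\<phi>' (\<phi> \<circ> real_map (lvn E m))"
    using strat_htpy_compose_right[OF F(1) E(1) \<Phi>_htpy[OF b(1,2)] pos_strat_pres]
      strat_htpy_compose_left[OF F(1) E(1) pos_htpy_lvn \<phi> pos_strat_pres]
    by (rule strat_htpy_trans)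
  moreover have "star_cond ?F L (U - {p}) ?\<phi>' g'"
    unfolding star_cond_def
  proof (intro conjI ballI impI)
    show "filt L (g' v) = filt ?F v" if "v \<in> verts ?F" "filt ?F v \<notin> U - {p}" for v
      using that g'p(1) g'N(1) by (cases "filt ?F v = p") auto
    show "g' v \<in> supp (?\<phi>' x)"
      if "x \<in> real_carrier ?F" "v \<in> supp x" "filt ?F v \<notin> U - {p}" for x v
      using that g'p(2) g'N(2) Fv[OF that(1,2)] by (cases "filt ?F v = p") blast+
  qed
  moreover have "carried E m (\<lambda>w. supp (?P w)) \<phi> ?\<phi>'"
    unfolding carried_def
  proof (intro conjI ballI)
    show "supp (?P w) \<noteq> {}" "supp (?P w) \<subseteq> car m w" if "w \<in> verts ?F" for w
      using supp_verts(3)[OF E(1) pos_real_carrier[OF that]] supp_pos_car[OF that] by auto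
    fix x assume x: "x \<in> real_carrier ?F"
    then show "\<exists>y\<in>real_carrier E. supp y = (\<Union>w\<in>supp x. supp (?P w)) \<and> supp (?\<phi>' x) \<subseteq> supp (\<phi> y)"
      using \<Phi>_supp[OF A(1)[OF x] b(1,2)] supp_aff_pos[OF x] by auto
  qed
  ultimately show ?thesis by blast
qed

end

text \<open>The induction removes minimal elements from the finite set \<open>R\<close>, not from
  its up-closure, which may be infinite. The last hypothesis keeps the two in step on the strata of
  vertices.\<close>

lemma iterated_refine:
  fixes E :: "('a hv, 'p::order) fos" and L :: "('b, 'p) fos"
  assumes "fos_complex E" "fos_finite E" "fos_complex L" "strat_pres E L \<phi>"
    and "finite R" "star_cond E L {a. \<exists>r\<in>R. r \<le> a} \<phi> g"
    and "\<And>v. v \<in> verts E \<Longrightarrow> \<exists>r\<in>R. r \<le> filt E v \<Longrightarrow> filt E v \<in> R"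
  shows "\<exists>m \<phi>' g' d. strat_pres (sds m E) L \<phi>' \<and>
    strat_htpy (sds m E) L \<phi>' (\<phi> \<circ> real_map (lvn E m)) \<and>
    star_cond (sds m E) L {} \<phi>' g' \<and> carried E m d \<phi> \<phi>'"
  using assms(5,1,2,4,6,7)
proof (induction "card R" arbitrary: R E \<phi> g)
  case 0
  then have R: "R = {}" by simp
  have id: "real_map id x = x" if "x \<in> real_carrier E" for x
    using supp_verts(2)[OF \<open>fos_complex E\<close> that] by (simp add: real_map_eq_aff aff_pt_id)
  have "strat_htpy E L \<phi> (\<phi> \<circ> real_map (lvn E 0))"
  proof (rule strat_htpy_cong[OF _ straight_line_htpy[of E L \<phi> \<phi>]])
    show "supp (\<phi> x) \<union> supp (\<phi> x) \<in> simps L" if "x \<in> real_carrier E" for x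
      using real_carrierD(2)[OF strat_presD(1)[OF \<open>fos_complex E\<close> assms(3) \<open>strat_pres E L \<phi>\<close> that]] by simp
  qed (use 0 assms(3) id in auto)
  then have "strat_htpy (sds 0 E) L \<phi> (\<phi> \<circ> real_map (lvn E 0))" by simp
  moreover have "carried E 0 (\<lambda>w. {w}) \<phi> \<phi>" by (auto simp: carried_def)
  moreover have "star_cond (sds 0 E) L {} \<phi> g" using 0 R by simp
  ultimately show ?case using \<open>strat_pres E L \<phi>\<close> by (metis funpow_0)
next
  case (Suc n)
  let ?U = "{a. \<exists>r\<in>R. r \<le> a}"
  have "R \<noteq> {}" using Suc.hyps(2) by auto
  then obtain p where p: "p \<in> R" "\<And>r. r \<in> R \<Longrightarrow> r \<le> p \<Longrightarrow> r = p"
    using finite_has_minimal[OF Suc.prems(1)] by metis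
  interpret star_step E ?U L \<phi> g
    by unfold_locales (use Suc.prems assms(3) in \<open>auto intro: order_trans\<close>)
  have pU: "p \<in> ?U" using p(1) by auto
  have pm: "a = p" if a: "a \<in> ?U" "a \<le> p" for a
  proof -
    obtain r where r: "r \<in> R" "r \<le> a" using a(1) by blast
    then have "r = p" using p(2) a(2) order_trans by blast
    then show "a = p" using r(2) a(2) by simp
  qed
  from refine[OF pU pm] obtain m \<phi>1 g1 d1 where 1: "strat_pres (sds m E) L \<phi>1"
    "strat_htpy (sds m E) L \<phi>1 (\<phi> \<circ> real_map (lvn E m))"
    "star_cond (sds m E) L (?U - {p}) \<phi>1 g1" "carried E m d1 \<phi> \<phi>1"
    by blast
  let ?E = "sds m E" and ?R = "R - {p}"
  have Em: "fos_complex ?E" "fos_finite ?E" using fos_complex_sds fos_finite_sds E by auto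
  \<comment> \<open>Subdivision creates no new vertex strata, because the last vertex map preserves
    them.\<close>
  have Rv: "filt ?E v \<in> R" if "v \<in> verts ?E" "\<exists>r\<in>R. r \<le> filt ?E v" for v
  proof -
    have "lvn E m v \<in> verts E" "filt E (lvn E m v) = filt ?E v"
      using lvn_morphism[OF E(1), of m] that(1) by (auto simp: fos_morphism_def)
    then show ?thesis using Suc.prems(6)[of "lvn E m v"] that(2) by simp
  qed
  have R': "filt ?E v \<in> ?R" if "v \<in> verts ?E" "\<exists>r\<in>?R. r \<le> filt ?E v" for v
    using Rv[OF that(1)] that(2) p(2) by auto
  \<comment> \<open>In the poset \<open>?U - {p}\<close> may exceed the up-closure of
    \<open>?R\<close>, but a vertex stratum in it belongs to \<open>R\<close>, hence to
    \<open>?R\<close>.\<close>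
  have sc: "star_cond ?E L {a. \<exists>r\<in>?R. r \<le> a} \<phi>1 g1"
  proof -
    have "filt ?E v \<notin> ?U - {p}" if "v \<in> verts ?E" "filt ?E v \<notin> {a. \<exists>r\<in>?R. r \<le> a}" for v
      using Rv[OF that(1)] that(2) by auto
    then show ?thesis
      using 1(3) supp_verts(1)[OF Em(1)] unfolding star_cond_def by blast
  qed
  have "n = card ?R" using Suc.hyps(2) p(1) Suc.prems(1) by simp
  from Suc.hyps(1)[OF this _ Em 1(1) sc] R' Suc.prems(1)
  obtain k \<phi>2 g2 d2 where 2: "strat_pres (sds k ?E) L \<phi>2"
    "strat_htpy (sds k ?E) L \<phi>2 (\<phi>1 \<circ> real_map (lvn ?E k))"
    "star_cond (sds k ?E) L {} \<phi>2 g2" "carried ?E k d2 \<phi>1 \<phi>2"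
    by blast
  let ?G = "sds k ?E"
  have G: "fos_complex ?G" "fos_finite ?G" using fos_complex_sds fos_finite_sds Em by auto
  have l: "strat_pres ?G ?E (real_map (lvn ?E k))"
    by (rule real_map_strat_pres[OF G Em(1)]) (use lvn_morphism[OF Em(1)] in \<open>simp add: fos_morphism_iff\<close>)
  have "strat_htpy ?G L \<phi>2 (\<phi> \<circ> real_map (lvn E m) \<circ> real_map (lvn ?E k))"
    using 2(2) strat_htpy_compose_right[OF G(1) Em(1) 1(2) l] by (rule strat_htpy_trans)
  then have h: "strat_htpy ?G L \<phi>2 (\<phi> \<circ> real_map (lvn E (m + k)))"
    by (rule strat_htpy_cong[OF G(1)]) (simp_all add: lvn_add real_map_comp supp_verts(2)[OF G(1)])
  \<comment> \<open>The sets recorded by two stages compose in the same way as carriers do in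
    \<open>car_add\<close>.\<close>
  have "carried E (m + k) (\<lambda>w. \<Union>w'\<in>d2 w. d1 w') \<phi> \<phi>2"
    unfolding carried_def sds_add[symmetric]
  proof (intro conjI ballI)
    fix w assume w: "w \<in> verts ?G"
    have d2: "d2 w \<noteq> {}" "d2 w \<subseteq> car k w" using 2(4) w by (auto simp: carried_def)
    have cv: "car k w \<subseteq> verts ?E" using fos_simplexD(3)[OF Em(1) car_vertex[OF Em(1) w]] .
    have d1: "d1 w' \<noteq> {} \<and> d1 w' \<subseteq> car m w'" if "w' \<in> d2 w" for w'
      using 1(4) that d2 cv by (auto simp: carried_def)
    show "(\<Union>w'\<in>d2 w. d1 w') \<noteq> {}" using d1 d2 by fast
    show "(\<Union>w'\<in>d2 w. d1 w') \<subseteq> car (m + k) w" unfolding car_add using d1 d2 by fast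
  next
    fix x assume "x \<in> real_carrier ?G"
    then obtain y where y: "y \<in> real_carrier ?E" "supp y = (\<Union>w\<in>supp x. d2 w)" "supp (\<phi>2 x) \<subseteq> supp (\<phi>1 y)"
      using 2(4) unfolding carried_def by blast
    then obtain z where z: "z \<in> real_carrier E" "supp z = (\<Union>w\<in>supp y. d1 w)" "supp (\<phi>1 y) \<subseteq> supp (\<phi> z)"
      using 1(4) unfolding carried_def by blast
    have "supp z = (\<Union>w\<in>supp x. \<Union>w'\<in>d2 w. d1 w')" unfolding z(2) y(2) by auto
    then show "\<exists>z\<in>real_carrier E. supp z = (\<Union>w\<in>supp x. \<Union>w'\<in>d2 w. d1 w') \<and> supp (\<phi>2 x) \<subseteq> supp (\<phi> z)"
      using z(1,3) y(3) by blast
  qed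
  then show ?case using 2(1,3) h unfolding sds_add by blast
qed

lemma strat_simplicial_approximation:
  fixes E :: "('a hv, 'p::order) fos" and L :: "('b, 'p) fos"
  assumes E: "fos_complex E" "fos_finite E" and L: "fos_complex L" and \<phi>: "strat_pres E L \<phi>"
  shows "\<exists>m g d. strat_simplicial g (sds m E) L \<and>
    strat_htpy (sds m E) L (real_map g) (\<phi> \<circ> real_map (lvn E m)) \<and>
    (\<forall>w\<in>verts (sds m E). d w \<noteq> {} \<and> d w \<subseteq> car m w) \<and>
    (\<forall>T\<in>simps (sds m E). \<exists>y\<in>real_carrier E. supp y = (\<Union>w\<in>T. d w) \<and> g ` T \<subseteq> supp (\<phi> y))"
proof -
  let ?R = "filt E ` verts E"
  have fin: "finite ?R" using E(2) by (simp add: fos_finite_def)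
  \<comment> \<open>Initially every vertex stratum lies in the up-closure of \<open>?R\<close>, so
    the star condition is vacuous and the vertex map arbitrary.\<close>
  have sc: "star_cond E L {a. \<exists>r\<in>?R. r \<le> a} \<phi> undefined"
    using supp_verts(1)[OF E(1)] unfolding star_cond_def by blast
  have "filt E v \<in> ?R" if "v \<in> verts E" for v using that by simp
  from iterated_refine[OF E L \<phi> fin sc this] obtain m \<phi>' g d where 1: "strat_pres (sds m E) L \<phi>'"
    "strat_htpy (sds m E) L \<phi>' (\<phi> \<circ> real_map (lvn E m))"
    "star_cond (sds m E) L {} \<phi>' g" "carried E m d \<phi> \<phi>'"
    by blast
  let ?F = "sds m E"
  have F: "fos_complex ?F" "fos_finite ?F" using fos_complex_sds[OF E(1)] fos_finite_sds[OF E] by auto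
  have gs: "g ` supp x \<subseteq> supp (\<phi>' x)" if "x \<in> real_carrier ?F" for x
    using 1(3) that by (auto simp: star_cond_def)
  have simp: "supp (\<phi>' x) \<in> simps L" if "x \<in> real_carrier ?F" for x
    using real_carrierD(2)[OF strat_presD(1)[OF F(1) L 1(1) that]] .
  \<comment> \<open>The barycenter of \<open>T\<close> has all of \<open>T\<close> as support, so
    the star condition at this single point already shows that \<open>g\<close> maps
    \<open>T\<close> into a simplex.\<close>
  have u: "unif T \<in> real_carrier ?F" "supp (unif T) = T" if "T \<in> simps ?F" for T
    using unif_real_carrier[OF F(1) that] supp_unif[OF fos_simplexD(1)[OF F(1) that]] by auto
  have gT: "g ` T \<in> simps L" if T: "T \<in> simps ?F" for T
    using fos_face[OF L simp[OF u(1)[OF T]], of "g ` T"] gs[OF u(1)[OF T]] u(2)[OF T]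
      fos_simplexD(2)[OF F(1) T] by simp
  have g: "strat_simplicial g ?F L"
    unfolding strat_simplicial_def
  proof (intro conjI ballI)
    fix v assume v: "v \<in> verts ?F"
    show "filt L (g v) = filt ?F v" using 1(3) v by (simp add: star_cond_def)
    show "g v \<in> verts L" using fos_simplexD(3)[OF L gT[OF fos_vertex[OF F(1) v]]] by simp
  qed (rule gT)
  have "strat_htpy ?F L (real_map g) \<phi>'"
  proof (rule straight_line_htpy[OF F L real_map_strat_pres[OF F L g] 1(1)])
    fix x assume x: "x \<in> real_carrier ?F"
    then have "supp (real_map g x) \<union> supp (\<phi>' x) = supp (\<phi>' x)"
      unfolding supp_real_map[OF F(1) x] by (intro Un_absorb1 gs)
    then show "supp (real_map g x) \<union> supp (\<phi>' x) \<in> simps L" using simp[OF x] by simp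
  qed
  then have h: "strat_htpy ?F L (real_map g) (\<phi> \<circ> real_map (lvn E m))"
    using 1(2) by (rule strat_htpy_trans)
  have c: "\<forall>w\<in>verts ?F. d w \<noteq> {} \<and> d w \<subseteq> car m w"
    using 1(4) unfolding carried_def by (rule conjunct1)
  have s: "\<exists>y\<in>real_carrier E. supp y = (\<Union>w\<in>T. d w) \<and> g ` T \<subseteq> supp (\<phi> y)" if T: "T \<in> simps ?F" for T
  proof -
    obtain y where "y \<in> real_carrier E" "supp y = (\<Union>w\<in>T. d w)" "supp (\<phi>' (unif T)) \<subseteq> supp (\<phi> y)"
      using 1(4) u(1)[OF T] unfolding carried_def by (metis u(2)[OF T])
    then show ?thesis using gs[OF u(1)[OF T]] unfolding u(2)[OF T] by (meson subset_trans)
  qed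
  show ?thesis
    by (rule exI[of _ m], rule exI[of _ g], rule exI[of _ d]) (use g h c s in simp)
qed

section \<open>Restoring the order\<close>

definition last_vertex_map :: "('w, 'p) fos \<Rightarrow> ('a hv \<Rightarrow> 'w) \<Rightarrow> 'a hv \<Rightarrow> 'w" where
  "last_vertex_map L g w = top_vertex L (g ` elts w)"

text \<open>Nested simplices have nested images under \<open>g\<close>, so the last vertices
  increase. On both sides the stratum is the maximum over the simplex, and \<open>g\<close>
  preserves the strata of vertices.\<close>

lemma last_vertex_map_morphism:
  assumes E: "fos_complex E" and L: "fos_complex L" and g: "strat_simplicial g E L"
  shows "fos_morphism (last_vertex_map L g) (sd E) L"
    and "w \<in> verts (sd E) \<Longrightarrow> last_vertex_map L g w \<in> g ` elts w"
proof -
  let ?f = "last_vertex_map L g"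
  have ge: "g ` elts w \<in> simps L" if "w \<in> verts (sd E)" for w
    using g sd_vertexD(1)[OF E that] by (simp add: strat_simplicial_def)
  have f: "?f w \<in> g ` elts w" if "w \<in> verts (sd E)" for w
    unfolding last_vertex_map_def by (rule top_vertex_in[OF L ge[OF that]])
  then show "w \<in> verts (sd E) \<Longrightarrow> ?f w \<in> g ` elts w" .
  show "fos_morphism ?f (sd E) L"
    unfolding fos_morphism_def
  proof (intro conjI ballI allI impI)
    show "?f w \<in> verts L" if "w \<in> verts (sd E)" for w
      using f[OF that] fos_simplexD(3)[OF L ge[OF that]] by blast
    show "filt L (?f w) = filt (sd E) w" if w: "w \<in> verts (sd E)" for w
    proof -
      have "filt L (g v) = filt E v" if "v \<in> elts w" for v
        using strat_simplicialD(2)[OF g] fos_simplexD(3)[OF E sd_vertexD(1)[OF E w]] that by auto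
      then have "filt L ` g ` elts w = filt E ` elts w"
        unfolding image_image by (rule image_cong[OF refl])
      then show ?thesis
        using pmax_simplex[OF L ge[OF w]] sd_filt(1)[OF E w] by (simp add: last_vertex_map_def)
    qed
    fix T assume T: "T \<in> simps (sd E)"
    have "?f w \<in> g ` (\<Union>w\<in>T. elts w)" if "w \<in> T" for w
    proof -
      have "w \<in> verts (sd E)" using that T by (auto simp: sd_simplex_iff[OF E])
      then show ?thesis using f[of w] that by blast
    qed
    then have "?f ` T \<subseteq> g ` (\<Union>w\<in>T. elts w)" by (rule image_subsetI)
    moreover have "?f ` T \<noteq> {}" using T by (simp add: sd_simplex_iff[OF E])
    ultimately show "?f ` T \<in> simps L"
      by (rule fos_face[OF L strat_simplicialD(3)[OF g elts_top_of_chain(3)[OF E T]]])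
  next
    fix x y assume "ord (sd E) x y"
    then have v: "x \<in> verts (sd E)" "y \<in> verts (sd E)" "elts x \<subseteq> elts y"
      unfolding sd_ord_iff[OF E] by auto
    then have "?f x \<in> g ` elts y" using f[OF v(1)] by blast
    then show "?f x = ?f y \<or> ord L (?f x) (?f y)"
      using top_vertex_ord[OF L ge[OF v(2)], of "?f x"] by (auto simp: last_vertex_map_def)
  qed
qed

text \<open>On a chain both maps take their values in the image under \<open>g\<close> of its union,
  which is a simplex of \<open>L\<close>.\<close>

lemma last_vertex_map_htpy:
  assumes E: "fos_complex E" "fos_finite E" and L: "fos_complex L" and g: "strat_simplicial g E L"
  shows "strat_htpy (sd E) L (real_map (last_vertex_map L g)) (real_map g \<circ> real_map (lv E))"
proof -
  let ?f = "last_vertex_map L g"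
  note S = fos_complex_sd[OF E(1)] fos_finite_sd[OF E]
  have lv: "strat_simplicial (lv E) (sd E) E" using lv_morphism[OF E(1)] by (simp add: fos_morphism_iff)
  have "strat_simplicial ?f (sd E) L"
    using last_vertex_map_morphism(1)[OF E(1) L g] by (simp add: fos_morphism_iff)
  then have f: "strat_pres (sd E) L (real_map ?f)" by (rule real_map_strat_pres[OF S L])
  have gl: "strat_pres (sd E) L (real_map (g \<circ> lv E))"
    by (rule real_map_strat_pres[OF S L strat_simplicial_comp[OF lv g]])
  have "strat_htpy (sd E) L (real_map ?f) (real_map (g \<circ> lv E))"
  proof (rule straight_line_htpy[OF S L f gl])
    fix x assume x: "x \<in> real_carrier (sd E)"
    have T: "supp x \<in> simps (sd E)" by (rule real_carrierD(2)[OF x])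
    have lve: "lv E w \<in> elts w" if "w \<in> verts (sd E)" for w
      using sd_filt(4)[OF E(1) that] top_vertex_in[OF E(1) sd_vertexD(1)[OF E(1) that]] by simp
    have sub: "?f ` supp x \<union> (g \<circ> lv E) ` supp x \<subseteq> g ` (\<Union>w\<in>supp x. elts w)"
      using lve last_vertex_map_morphism(2)[OF E(1) L g] supp_verts(1)[OF S(1) x] by fastforce
    have "g ` (\<Union>w\<in>supp x. elts w) \<in> simps L"
      by (rule strat_simplicialD(3)[OF g elts_top_of_chain(3)[OF E(1) T]])
    from fos_face[OF L this sub]
    show "supp (real_map ?f x) \<union> supp (real_map (g \<circ> lv E) x) \<in> simps L"
      unfolding supp_real_map[OF S(1) x] using supp_verts(3)[OF S(1) x] by simp
  qed
  then show ?thesis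
    by (rule strat_htpy_cong[OF S(1)]) (simp_all add: real_map_comp supp_verts(2)[OF S(1)])
qed

section \<open>Cylinders and homotopies\<close>

lemma emb_simps [simp]:
  "verts (emb K) = V ` verts K" "simps (emb K) = (`) V ` simps K" "filt (emb K) (V a) = filt K a"
  "ord (emb K) (V a) (V b) = ord K a b" "unV (V a) = a"
  by (auto simp: emb_def unV_def)

lemma emb_ordD: "ord (emb K) x y \<Longrightarrow> \<exists>a b. x = V a \<and> y = V b \<and> ord K a b"
  by (auto simp: emb_def)

lemma fos_complex_emb:
  assumes K: "fos_complex K"
  shows "fos_complex (emb K)"
proof -
  have 1: "\<forall>\<sigma>\<in>simps (emb K). \<sigma> \<noteq> {} \<and> finite \<sigma> \<and> \<sigma> \<subseteq> verts (emb K)"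
    using fos_simplexD[OF K] by fastforce
  have 2: "\<forall>v\<in>verts (emb K). {v} \<in> simps (emb K)"
  proof
    fix v assume "v \<in> verts (emb K)"
    then obtain a where a: "a \<in> verts K" "v = V a" by auto
    then show "{v} \<in> simps (emb K)"
      using imageI[OF fos_vertex[OF K a(1)], of "(`) V"] by simp
  qed
  have 3: "\<forall>\<sigma>\<in>simps (emb K). \<forall>\<tau>. \<tau> \<subseteq> \<sigma> \<and> \<tau> \<noteq> {} \<longrightarrow> \<tau> \<in> simps (emb K)"
  proof (intro ballI allI impI)
    fix \<sigma> \<tau> assume "\<sigma> \<in> simps (emb K)" and \<tau>: "\<tau> \<subseteq> \<sigma> \<and> \<tau> \<noteq> {}"
    then obtain \<sigma>' where \<sigma>': "\<sigma>' \<in> simps K" "\<sigma> = V ` \<sigma>'" by auto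
    then obtain \<tau>' where \<tau>': "\<tau>' \<subseteq> \<sigma>'" "\<tau> = V ` \<tau>'" using \<tau> subset_image_iff by metis
    then have "\<tau>' \<in> simps K" using fos_face[OF K \<sigma>'(1)] \<tau> by auto
    then show "\<tau> \<in> simps (emb K)" using \<tau>' by simp
  qed
  have 4: "\<forall>x y. ord (emb K) x y \<longrightarrow> x \<noteq> y \<and> {x, y} \<in> simps (emb K)"
  proof (intro allI impI)
    fix x y assume "ord (emb K) x y"
    then obtain a b where ab: "x = V a" "y = V b" "ord K a b" using emb_ordD by blast
    then show "x \<noteq> y \<and> {x, y} \<in> simps (emb K)"
      using fos_ordD(1)[OF K ab(3)] imageI[OF fos_ordD(2)[OF K ab(3)], of "(`) V"] by simp
  qed
  have 5: "\<forall>\<sigma>\<in>simps (emb K). \<forall>x\<in>\<sigma>. \<forall>y\<in>\<sigma>. x \<noteq> y \<longrightarrow> ord (emb K) x y \<or> ord (emb K) y x"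
    using fos_ord_linear(1)[OF K] by auto
  have 6: "\<forall>\<sigma>\<in>simps (emb K). \<forall>x\<in>\<sigma>. \<forall>y\<in>\<sigma>. \<not> (ord (emb K) x y \<and> ord (emb K) y x)"
    using fos_ord_linear(2)[OF K] by auto
  have 7: "\<forall>\<sigma>\<in>simps (emb K). \<forall>x\<in>\<sigma>. \<forall>y\<in>\<sigma>. \<forall>z\<in>\<sigma>. ord (emb K) x y \<and> ord (emb K) y z \<longrightarrow> ord (emb K) x z"
  proof (intro ballI)
    fix \<sigma> x y z assume "\<sigma> \<in> simps (emb K)" and xyz: "x \<in> \<sigma>" "y \<in> \<sigma>" "z \<in> \<sigma>"
    then obtain \<sigma>' where \<sigma>': "\<sigma>' \<in> simps K" "\<sigma> = V ` \<sigma>'" by auto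
    obtain a b c where abc: "x = V a" "a \<in> \<sigma>'" "y = V b" "b \<in> \<sigma>'" "z = V c" "c \<in> \<sigma>'"
      using xyz unfolding \<sigma>'(2) by (elim imageE)
    show "ord (emb K) x y \<and> ord (emb K) y z \<longrightarrow> ord (emb K) x z"
      using fos_ord_linear(3)[OF K \<sigma>'(1) abc(2,4,6)] abc(1,3,5) by simp
  qed
  have 8: "\<forall>x y. ord (emb K) x y \<longrightarrow> filt (emb K) x \<le> filt (emb K) y"
  proof (intro allI impI)
    fix x y assume "ord (emb K) x y"
    then obtain a b where ab: "x = V a" "y = V b" "ord K a b" using emb_ordD by blast
    then show "filt (emb K) x \<le> filt (emb K) y" using fos_ordD(3)[OF K ab(3)] by simp
  qed
  show ?thesis unfolding fos_complex_def using 1 2 3 4 5 6 7 8 by (intro conjI)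
qed

lemma fos_finite_emb: "fos_finite K \<Longrightarrow> fos_finite (emb K)"
  by (simp add: fos_finite_def)

lemma unV_morphism: "fos_morphism unV (emb K) K"
  unfolding fos_morphism_def
proof (intro conjI ballI allI impI)
  show "unV ` \<sigma> \<in> simps K" if "\<sigma> \<in> simps (emb K)" for \<sigma> using that by (auto simp: image_image)
  fix x y assume "ord (emb K) x y"
  then show "unV x = unV y \<or> ord K (unV x) (unV y)" using emb_ordD by fastforce
qed auto

lemma unV_simplicial: "strat_simplicial unV (emb K) K"
  using unV_morphism fos_morphism_iff by blast

lemma sdn_complex:
  assumes "fos_complex K"
  shows "fos_complex (sdn K n)" "fos_finite K \<Longrightarrow> fos_finite (sdn K n)"
  unfolding sdn_def
  by (simp_all add: fos_complex_sds fos_finite_sds fos_complex_emb fos_finite_emb assms)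

lemma lvK_morphism: "fos_complex K \<Longrightarrow> fos_morphism (lvK K n) (sdn K n) K"
  unfolding lvK_def sdn_def by (rule fos_morphism_comp[OF lvn_morphism[OF fos_complex_emb] unV_morphism])

text \<open>\<open>hn\<close> reads the coordinate at \<open>V x\<close>, while
  \<open>real_map unV\<close> sums over a fibre of \<open>unV\<close>. They agree since carriers in
  the embedded complex consist of vertices of the form \<open>V a\<close>.\<close>

lemma hn_eq:
  assumes K: "fos_complex K" and t: "t \<in> real_carrier (sdn K n)"
  shows "hn n t = real_map unV ((bary_sd ^^ n) t)"
proof
  fix c
  let ?y = "(bary_sd ^^ n) t"
  have "\<exists>W. finite W \<and> supp ?y \<subseteq> V ` W"
  proof -
    have E: "fos_complex (emb K)" by (rule fos_complex_emb[OF K])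
    have t': "t \<in> real_carrier (sds n (emb K))" using t by (simp add: sdn_def)
    let ?W = "(\<Union>w\<in>supp t. car n w)"
    have W: "?W \<in> simps (emb K)" using car_simplex[OF E real_carrierD(2)[OF t']] .
    have "pos (\<lambda>_. True) n w c = 0" if "c \<notin> car n w" for w :: "'a hv" and c
      using that
    proof (induction n arbitrary: w)
      case (Suc n)
      have "pos (\<lambda>_. True) n x c = 0" if "x \<in> core (\<lambda>_. True) n w" for x
        using that Suc core_props(1)[of "\<lambda>_. True" n w] by auto
      then show ?case
        by (cases "finite (core (\<lambda>_. True) n w)") (simp_all add: aff_unif aff_def unif_def supp_def)
    qed (simp add: pt_def)
    then have "?y c = 0" if "c \<notin> ?W" for c
      unfolding bary_sd_funpow[OF E t'] aff_def using that by (intro sum.neutral) auto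
    then have "supp ?y \<subseteq> ?W" unfolding supp_def by blast
    moreover obtain \<sigma> where "\<sigma> \<in> simps K" "?W = V ` \<sigma>" using W by auto
    ultimately show ?thesis using fos_simplexD(1)[OF K] by metis
  qed
  then obtain W where W: "supp ?y \<subseteq> V ` W" by blast
  have "{v. ?y v \<noteq> 0 \<and> unV v = c} \<subseteq> {V c}"
  proof
    fix v assume v: "v \<in> {v. ?y v \<noteq> 0 \<and> unV v = c}"
    then have "v \<in> V ` W" using W by (auto simp: supp_def)
    then show "v \<in> {V c}" using v by auto
  qed
  then have "sum ?y {v. ?y v \<noteq> 0 \<and> unV v = c} = sum ?y {V c}"
    by (intro sum.mono_neutral_left) auto
  then show "hn n t c = real_map unV ?y c" by (simp add: hn_def real_map_def)
qed

lemma lvK_htpy_hn: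
  assumes K: "fos_complex K" "fos_finite K"
  shows "strat_htpy (sdn K n) K (real_map (lvK K n)) (hn n)" "strat_pres (sdn K n) K (real_map (lvK K n))"
proof -
  let ?E = "emb K" and ?F = "sdn K n"
  have E: "fos_complex ?E" "fos_finite ?E" using K fos_complex_emb fos_finite_emb by auto
  have F: "fos_complex ?F" "fos_finite ?F" using sdn_complex K by auto
  \<comment> \<open>With all strata counted as upper, the modified barycenters are the usual
    ones.\<close>
  interpret upper_fos ?E UNIV by unfold_locales (use E in auto)
  have u: "strat_pres ?E K (real_map unV)" by (rule real_map_strat_pres[OF E K(1) unV_simplicial])
  have "strat_htpy ?F K (real_map unV \<circ> aff (pos (\<lambda>_. True) n)) (real_map unV \<circ> real_map (lvn ?E n))"
    using strat_htpy_compose_left[OF _ _ pos_htpy_lvn u pos_strat_pres] E F by (simp add: sdn_def)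
  then have "strat_htpy ?F K (real_map unV \<circ> real_map (lvn ?E n)) (real_map unV \<circ> aff (pos (\<lambda>_. True) n))"
    by (rule strat_htpy_sym)
  then show "strat_htpy ?F K (real_map (lvK K n)) (hn n)"
  proof (rule strat_htpy_cong[OF F(1)])
    fix t assume t: "t \<in> real_carrier ?F"
    show "real_map (lvK K n) t = (real_map unV \<circ> real_map (lvn ?E n)) t"
      unfolding lvK_def using real_map_comp[OF supp_verts(2)[OF F(1) t]] by simp
    have "t \<in> real_carrier (sds n ?E)" using t by (simp add: sdn_def)
    then show "hn n t = (real_map unV \<circ> aff (pos (\<lambda>_. True) n)) t"
      using hn_eq[OF K(1) t] bary_sd_funpow[OF E(1)] by simp
  qed
  show "strat_pres ?F K (real_map (lvK K n))"
    by (rule real_map_strat_pres[OF F K(1)]) (use lvK_morphism[OF K(1)] fos_morphism_iff in blast)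
qed

text \<open>One subdivision beyond the simplicial approximation makes the map order preserving, and
  the two homotopies compose along \<open>lv\<close>.\<close>

lemma morphism_approximation:
  fixes K :: "('a, 'p::order) fos" and L :: "('b, 'p) fos"
  assumes K: "fos_complex K" "fos_finite K" and L: "fos_complex L" and \<phi>: "strat_pres K L \<phi>"
  shows "\<exists>n f. fos_morphism f (sdn K n) L \<and>
    strat_htpy (sdn K n) L (real_map f) (\<phi> \<circ> real_map (lvK K n))"
proof -
  let ?E = "emb K"
  have E: "fos_complex ?E" "fos_finite ?E" using K fos_complex_emb fos_finite_emb by auto
  have "strat_pres ?E L (\<phi> \<circ> real_map unV)"
    by (rule strat_pres_compose[OF E(1) K(1) real_map_strat_pres[OF E K(1) unV_simplicial] \<phi>])
  from strat_simplicial_approximation[OF E L this] obtain m g where g: "strat_simplicial g (sds m ?E) L"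
    "strat_htpy (sds m ?E) L (real_map g) (\<phi> \<circ> real_map unV \<circ> real_map (lvn ?E m))" by (elim exE conjE) (erule (1) that)
  let ?F = "sds m ?E"
  have F: "fos_complex ?F" "fos_finite ?F" using fos_complex_sds[OF E(1)] fos_finite_sds[OF E] by auto
  note S = fos_complex_sd[OF F(1)] fos_finite_sd[OF F]
  have "strat_simplicial (lv ?F) (sd ?F) ?F" using lv_morphism[OF F(1)] fos_morphism_iff by blast
  then have "strat_pres (sd ?F) ?F (real_map (lv ?F))" by (rule real_map_strat_pres[OF S F(1)])
  from strat_htpy_trans[OF last_vertex_map_htpy[OF F L g(1)] strat_htpy_compose_right[OF S(1) F(1) g(2) this]]
  have "strat_htpy (sd ?F) L (real_map (last_vertex_map L g)) (\<phi> \<circ> real_map (lvK K (Suc m)))"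
  proof (rule strat_htpy_cong[OF S(1)])
    fix t assume "t \<in> real_carrier (sd ?F)"
    then have fin: "finite (supp t)" by (rule supp_verts(2)[OF S(1)])
    have "lvK K (Suc m) = (unV \<circ> lvn ?E m) \<circ> lv ?F" by (simp add: lvK_def o_assoc)
    then have "real_map (lvK K (Suc m)) t = real_map (unV \<circ> lvn ?E m) (real_map (lv ?F) t)"
      using real_map_comp[OF fin] by metis
    also have "\<dots> = real_map unV (real_map (lvn ?E m) (real_map (lv ?F) t))"
    proof (rule real_map_comp)
      have "supp (real_map (lv ?F) t) = lv ?F ` supp t"
        by (rule supp_real_map[OF S(1)]) fact
      then show "finite (supp (real_map (lv ?F) t))" using fin by simp
    qed
    finally show "(\<phi> \<circ> real_map (lvK K (Suc m))) t =
        (\<phi> \<circ> real_map unV \<circ> real_map (lvn ?E m) \<circ> real_map (lv ?F)) t" by simp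
  qed simp
  moreover have "fos_morphism (last_vertex_map L g) (sd ?F) L"
    by (rule last_vertex_map_morphism(1)[OF F(1) L g(1)])
  ultimately show ?thesis
    by (intro exI[of _ "Suc m"] exI[of _ "last_vertex_map L g"]) (simp add: sdn_def)
qed

section \<open>The cylinder as an ordered complex\<close>

lemma prodI_simplex_iff:
  "C \<in> simps (prodI K) \<longleftrightarrow> C \<noteq> {} \<and> finite C \<and> C \<subseteq> verts K \<times> {0, 1} \<and> fst ` C \<in> simps K \<and>
    (\<forall>a\<in>C. \<forall>b\<in>C. (fst a = fst b \<or> ord K (fst a) (fst b)) \<and> snd a \<le> snd b \<or>
      (fst b = fst a \<or> ord K (fst b) (fst a)) \<and> snd b \<le> snd a)"
  by (simp add: prodI_def)

lemma prodI_ord_iff: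
  "ord (prodI K) a b \<longleftrightarrow> a \<noteq> b \<and> a \<in> verts K \<times> {0, 1} \<and> b \<in> verts K \<times> {0, 1} \<and>
    (fst a = fst b \<or> ord K (fst a) (fst b)) \<and> snd a \<le> snd b"
  by (simp add: prodI_def)

lemma prodI_verts: "verts (prodI K) = verts K \<times> {0, 1}" and prodI_filt: "filt (prodI K) a = filt K (fst a)"
  by (simp_all add: prodI_def)

lemma fos_complex_prodI:
  assumes K: "fos_complex K"
  shows "fos_complex (prodI K)"
proof -
  note s = prodI_simplex_iff[of _ K] and o = prodI_ord_iff[of K] and v = prodI_verts[of K] and f = prodI_filt[of K]
  have 1: "\<forall>\<sigma>\<in>simps (prodI K). \<sigma> \<noteq> {} \<and> finite \<sigma> \<and> \<sigma> \<subseteq> verts (prodI K)" by (simp add: s v)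
  have 2: "\<forall>v\<in>verts (prodI K). {v} \<in> simps (prodI K)"
    unfolding v s using fos_vertex[OF K] by auto
  have 3: "\<forall>\<sigma>\<in>simps (prodI K). \<forall>\<tau>. \<tau> \<subseteq> \<sigma> \<and> \<tau> \<noteq> {} \<longrightarrow> \<tau> \<in> simps (prodI K)"
  proof (intro ballI allI impI)
    fix \<sigma> \<tau> assume \<sigma>: "\<sigma> \<in> simps (prodI K)" and \<tau>: "\<tau> \<subseteq> \<sigma> \<and> \<tau> \<noteq> {}"
    have "fst ` \<tau> \<in> simps K"
    proof (rule fos_face[OF K])
      show "fst ` \<sigma> \<in> simps K" using \<sigma> unfolding s by (elim conjE)
      show "fst ` \<tau> \<subseteq> fst ` \<sigma>" "fst ` \<tau> \<noteq> {}" using \<tau> by (auto intro: image_mono)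
    qed
    moreover have "finite \<tau>" using \<sigma> \<tau> finite_subset[of \<tau> \<sigma>] unfolding s by blast
    ultimately show "\<tau> \<in> simps (prodI K)" using \<sigma> \<tau> unfolding s by (meson subsetD subset_trans)
  qed
  have 4: "\<forall>x y. ord (prodI K) x y \<longrightarrow> x \<noteq> y \<and> {x, y} \<in> simps (prodI K)"
  proof (intro allI impI)
    fix x y assume xy: "ord (prodI K) x y"
    have "{fst x, fst y} \<in> simps K"
    proof (cases "fst x = fst y")
      case True
      then show ?thesis using xy fos_vertex[OF K, of "fst x"] by (auto simp: o)
    next
      case False
      then show ?thesis using xy fos_ordD(2)[OF K, of "fst x" "fst y"] by (simp add: o)
    qed
    then show "x \<noteq> y \<and> {x, y} \<in> simps (prodI K)" using xy unfolding s o by auto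
  qed
  have 5: "\<forall>\<sigma>\<in>simps (prodI K). \<forall>x\<in>\<sigma>. \<forall>y\<in>\<sigma>. x \<noteq> y \<longrightarrow> ord (prodI K) x y \<or> ord (prodI K) y x"
  proof (intro ballI impI)
    fix \<sigma> x y assume "\<sigma> \<in> simps (prodI K)" "x \<in> \<sigma>" "y \<in> \<sigma>" "x \<noteq> y"
    moreover from this have "x \<in> verts K \<times> {0, 1}" "y \<in> verts K \<times> {0, 1}" by (auto simp: s)
    ultimately show "ord (prodI K) x y \<or> ord (prodI K) y x" unfolding s o by metis
  qed
  have lin: "\<not> (ord K (fst x) (fst y) \<and> ord K (fst y) (fst x))"
    "z \<in> \<sigma> \<Longrightarrow> ord K (fst x) (fst y) \<Longrightarrow> ord K (fst y) (fst z) \<Longrightarrow> ord K (fst x) (fst z)"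
    if "\<sigma> \<in> simps (prodI K)" "x \<in> \<sigma>" "y \<in> \<sigma>" for \<sigma> x y z
  proof -
    have \<sigma>: "fst ` \<sigma> \<in> simps K" using that(1) unfolding s by (elim conjE)
    note xy = imageI[OF that(2), of fst] imageI[OF that(3), of fst]
    show "\<not> (ord K (fst x) (fst y) \<and> ord K (fst y) (fst x))" by (rule fos_ord_linear(2)[OF K \<sigma> xy])
    show "z \<in> \<sigma> \<Longrightarrow> ord K (fst x) (fst y) \<Longrightarrow> ord K (fst y) (fst z) \<Longrightarrow> ord K (fst x) (fst z)"
      using fos_ord_linear(3)[OF K \<sigma> xy, of "fst z"] by simp
  qed
  have 6: "\<forall>\<sigma>\<in>simps (prodI K). \<forall>x\<in>\<sigma>. \<forall>y\<in>\<sigma>. \<not> (ord (prodI K) x y \<and> ord (prodI K) y x)"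
  proof (intro ballI notI)
    fix \<sigma> x y assume \<sigma>: "\<sigma> \<in> simps (prodI K)" "x \<in> \<sigma>" "y \<in> \<sigma>" and a: "ord (prodI K) x y \<and> ord (prodI K) y x"
    have "fst x = fst y" "snd x = snd y" using a lin(1)[OF \<sigma>] by (auto simp: o)
    then show False using a by (auto simp: o prod_eq_iff)
  qed
  have 7: "\<forall>\<sigma>\<in>simps (prodI K). \<forall>x\<in>\<sigma>. \<forall>y\<in>\<sigma>. \<forall>z\<in>\<sigma>. ord (prodI K) x y \<and> ord (prodI K) y z \<longrightarrow> ord (prodI K) x z"
  proof (intro ballI impI)
    fix \<sigma> x y z assume \<sigma>: "\<sigma> \<in> simps (prodI K)" "x \<in> \<sigma>" "y \<in> \<sigma>" "z \<in> \<sigma>"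
      and a: "ord (prodI K) x y \<and> ord (prodI K) y z"
    have "x \<noteq> z" using a 6 \<sigma> by blast
    moreover have "fst x = fst z \<or> ord K (fst x) (fst z)" using a lin(2)[OF \<sigma>(1-4)] unfolding o by metis
    ultimately show "ord (prodI K) x z" using a by (auto simp: o)
  qed
  have 8: "\<forall>x y. ord (prodI K) x y \<longrightarrow> filt (prodI K) x \<le> filt (prodI K) y"
    unfolding o f using fos_ordD(3)[OF K] by auto
  show ?thesis unfolding fos_complex_def using 1 2 3 4 5 6 7 8 by (intro conjI)
qed

lemma fos_finite_prodI: "fos_finite K \<Longrightarrow> fos_finite (prodI K)"
  by (simp add: fos_finite_def prodI_verts)

lemma fst_simplicial: "strat_simplicial fst (prodI K) K"
  unfolding strat_simplicial_def by (auto simp: prodI_verts prodI_filt prodI_simplex_iff)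

lemma inclusion_morphism:
  assumes K: "fos_complex K" and j: "j \<in> {0, 1}"
  shows "fos_morphism (\<lambda>x. (x, j)) K (prodI K)"
  unfolding fos_morphism_def
proof (intro conjI ballI allI impI)
  fix \<sigma> assume \<sigma>: "\<sigma> \<in> simps K"
  have "(fst a = fst b \<or> ord K (fst a) (fst b)) \<and> snd a \<le> snd b \<or>
      (fst b = fst a \<or> ord K (fst b) (fst a)) \<and> snd b \<le> snd a"
    if "a \<in> (\<lambda>x. (x, j)) ` \<sigma>" "b \<in> (\<lambda>x. (x, j)) ` \<sigma>" for a b
    using that fos_ord_linear(1)[OF K \<sigma>, of "fst a" "fst b"] by auto
  then show "(\<lambda>x. (x, j)) ` \<sigma> \<in> simps (prodI K)"
    unfolding prodI_simplex_iff using fos_simplexD[OF K \<sigma>] j \<sigma> by (auto simp: image_image)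
next
  fix x y assume "ord K x y"
  then show "(x, j) = (y, j) \<or> ord (prodI K) (x, j) (y, j)"
    using fos_ordD[OF K] fos_simplexD(3)[OF K fos_ordD(2)[OF K]] j by (auto simp: prodI_ord_iff)
qed (use j in \<open>auto simp: prodI_verts prodI_filt\<close>)

section \<open>Functoriality of subdivision and of the last vertex map\<close>

lemma emb_map_morphism:
  assumes "fos_morphism f K K'"
  shows "fos_morphism (emb_map f) (emb K) (emb K')"
proof -
  have e: "emb_map f (V a) = V (f a)" for a by (simp add: emb_map_def)
  show ?thesis
    unfolding fos_morphism_def
  proof (intro conjI ballI allI impI)
    show "emb_map f v \<in> verts (emb K')" "filt (emb K') (emb_map f v) = filt (emb K) v" if "v \<in> verts (emb K)" for v
      using that assms by (auto simp: e fos_morphism_def)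
    show "emb_map f ` \<sigma> \<in> simps (emb K')" if "\<sigma> \<in> simps (emb K)" for \<sigma>
    proof -
      obtain \<sigma>' where \<sigma>': "\<sigma>' \<in> simps K" "\<sigma> = V ` \<sigma>'" using \<open>\<sigma> \<in> simps (emb K)\<close> by auto
      have "emb_map f ` \<sigma> = V ` f ` \<sigma>'" unfolding \<sigma>'(2) image_image e ..
      moreover have "f ` \<sigma>' \<in> simps K'" using assms \<sigma>'(1) by (simp add: fos_morphism_def)
      ultimately show ?thesis by simp
    qed
    fix x y assume "ord (emb K) x y"
    then obtain a b where ab: "x = V a" "y = V b" "ord K a b" using emb_ordD by blast
    then show "emb_map f x = emb_map f y \<or> ord (emb K') (emb_map f x) (emb_map f y)"
      using assms by (simp add: e fos_morphism_def)
  qed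
qed

lemma sd_map_elts:
  assumes "fos_complex E" "w \<in> verts (sd E)"
  shows "elts (sd_map G w) = G ` elts w" "sd_map G w = sdv (G ` elts w)"
proof -
  obtain A where "w = S A" using sd_vertexD(3)[OF assms] by blast
  then show "elts (sd_map G w) = G ` elts w" "sd_map G w = sdv (G ` elts w)"
    by (simp_all add: sd_map_def sdv_def) (metis fimage.rep_eq fset_inverse)
qed

lemma sd_map_morphism:
  assumes E: "fos_complex E" "fos_complex E'" and G: "fos_morphism G E E'"
  shows "fos_morphism (sd_map G) (sd E) (sd E')"
  unfolding fos_morphism_def
proof (intro conjI ballI allI impI)
  note Gs = G[unfolded fos_morphism_iff, THEN conjunct1]
  have vert: "sd_map G w \<in> verts (sd E')" if "w \<in> verts (sd E)" for w
    using strat_simplicialD(3)[OF Gs sd_vertexD(1)[OF E(1) that]] sd_map_elts(2)[OF E(1) that, of G]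
      sdv_vertex[OF E(2)] by simp
  then show "w \<in> verts (sd E) \<Longrightarrow> sd_map G w \<in> verts (sd E')" for w .
  show "filt (sd E') (sd_map G w) = filt (sd E) w" if w: "w \<in> verts (sd E)" for w
  proof -
    have "filt E' (G v) = filt E v" if "v \<in> elts w" for v
      using strat_simplicialD(2)[OF Gs] fos_simplexD(3)[OF E(1) sd_vertexD(1)[OF E(1) w]] that by auto
    then have "filt E' ` G ` elts w = filt E ` elts w"
      unfolding image_image by (rule image_cong[OF refl])
    then show ?thesis
      using sd_filt(1)[OF E(1) w] sd_filt(1)[OF E(2) vert[OF w]] sd_map_elts(1)[OF E(1) w, of G] by simp
  qed
  fix T assume T: "T \<in> simps (sd E)"
  have Tv: "w \<in> verts (sd E)" if "w \<in> T" for w using T that by (auto simp: sd_simplex_iff[OF E(1)])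
  show "sd_map G ` T \<in> simps (sd E')"
    unfolding sd_simplex_iff[OF E(2)]
  proof (intro conjI ballI)
    fix w w' assume "w \<in> sd_map G ` T" "w' \<in> sd_map G ` T"
    then obtain x x' where x: "x \<in> T" "x' \<in> T" "w = sd_map G x" "w' = sd_map G x'" by blast
    moreover have "elts x \<subseteq> elts x' \<or> elts x' \<subseteq> elts x" using T x by (auto simp: sd_simplex_iff[OF E(1)])
    ultimately show "elts w \<subseteq> elts w' \<or> elts w' \<subseteq> elts w"
      using sd_map_elts(1)[OF E(1) Tv, of x G] sd_map_elts(1)[OF E(1) Tv, of x' G] by auto
  qed (use T vert Tv in \<open>auto simp: sd_simplex_iff[OF E(1)]\<close>)
next
  note Gs = G[unfolded fos_morphism_iff, THEN conjunct1]
  fix x y assume "ord (sd E) x y"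
  then have v: "x \<in> verts (sd E)" "y \<in> verts (sd E)" "elts x \<subset> elts y" by (auto simp: sd_ord_iff[OF E(1)])
  have vert: "sd_map G w \<in> verts (sd E')" if "w \<in> verts (sd E)" for w
    using strat_simplicialD(3)[OF Gs sd_vertexD(1)[OF E(1) that]] sd_map_elts(2)[OF E(1) that, of G]
      sdv_vertex[OF E(2)] by simp
  have "elts (sd_map G x) \<subseteq> elts (sd_map G y)"
    using v sd_map_elts(1)[OF E(1) v(1), of G] sd_map_elts(1)[OF E(1) v(2), of G] by auto
  then show "sd_map G x = sd_map G y \<or> ord (sd E') (sd_map G x) (sd_map G y)"
    using vert v elts_inj[OF E(2)] unfolding sd_ord_iff[OF E(2)] by (meson inj_onD psubsetI)
qed

lemma sd_map_funpow_morphism: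
  assumes "fos_complex E" "fos_complex E'" "fos_morphism G E E'"
  shows "fos_morphism ((sd_map ^^ n) G) (sds n E) (sds n E')"
  by (induction n) (use assms in \<open>auto intro: sd_map_morphism fos_complex_sds\<close>)

lemma sd_map_funpow_car:
  assumes "fos_complex E" "w \<in> verts (sds n E)"
  shows "car n ((sd_map ^^ n) G w) = G ` car n w"
  using assms(2)
proof (induction n arbitrary: w)
  case (Suc n)
  have w: "w \<in> verts (sd (sds n E))" using Suc.prems by simp
  note F = fos_complex_sds[OF assms(1), of n]
  have "car n ((sd_map ^^ n) G x) = G ` car n x" if "x \<in> elts w" for x
    using Suc.IH fos_simplexD(3)[OF F sd_vertexD(1)[OF F w]] that by blast
  then have "(\<Union>x\<in>elts w. car n ((sd_map ^^ n) G x)) = (\<Union>x\<in>elts w. G ` car n x)" by (rule SUP_cong[OF refl])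
  then show ?case
    using sd_map_elts(1)[OF F w, of "(sd_map ^^ n) G"] by (simp add: image_UN)
qed simp

text \<open>Order preserving maps commute with taking the last vertex of a simplex.\<close>

lemma lvn_natural:
  assumes "fos_complex E" "fos_complex E'" "fos_morphism G E E'" "w \<in> verts (sds n E)"
  shows "lvn E' n ((sd_map ^^ n) G w) = G (lvn E n w)"
  using assms(4)
proof (induction n arbitrary: w)
  case (Suc n)
  let ?F = "sds n E" and ?F' = "sds n E'" and ?G = "(sd_map ^^ n) G"
  have w: "w \<in> verts (sd ?F)" using Suc.prems by simp
  have F: "fos_complex ?F" "fos_complex ?F'" using fos_complex_sds assms by auto
  have G: "fos_morphism ?G ?F ?F'" by (rule sd_map_funpow_morphism[OF assms(1-3)])
  have "sd_map ?G w \<in> verts (sd ?F')"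
    using sd_map_morphism[OF F G] w by (simp add: fos_morphism_def)
  then have "lv ?F' (sd_map ?G w) = ?G (lv ?F w)"
    using sd_filt(4)[OF F(2)] sd_filt(4)[OF F(1) w] sd_map_elts(1)[OF F(1) w, of ?G]
      top_vertex_image[OF F G sd_vertexD(1)[OF F(1) w]] by simp
  moreover have "lv ?F w \<in> verts ?F" using lv_morphism[OF F(1)] w by (simp add: fos_morphism_def)
  ultimately show ?case using Suc.IH by simp
qed simp

text \<open>Produces the collars on which the homotopy is constant. Two members of a chain share an
  element \<open>x\<close>, carried by end \<open>j\<close>; an element of \<open>w\<close> carried
  by end 1 has a carrier comparable with that of \<open>x\<close>, so it cannot occur when
  \<open>j = 0\<close>. With a single subdivision this fails: a vertex whose carrier meets both ends
  can be adjacent to vertices carried by either.\<close>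

lemma endpoint_time:
  fixes E0 :: "(('a \<times> nat) hv, 'p::order) fos"
  defines "En \<equiv> \<lambda>j::nat. {c :: ('a \<times> nat) hv. snd (unV c) = j}"
  defines "\<theta> \<equiv> \<lambda>w. if \<exists>x\<in>elts w. car 1 x \<subseteq> En 1 then 1 else 0 :: real"
  assumes E0: "fos_complex E0" and T: "T \<in> simps (sds 2 E0)" and z: "z \<in> T" "car 2 z \<subseteq> En j"
    and j: "j \<in> {0, 1}" and w: "w \<in> T"
  shows "\<theta> w = real j"
proof -
  let ?F = "sd E0"
  have F: "fos_complex ?F" by (rule fos_complex_sd[OF E0])
  have T': "T \<in> simps (sd ?F)" using T by (simp add: numeral_2_eq_2)
  have ch: "elts z \<subseteq> elts w \<or> elts w \<subseteq> elts z" and v: "z \<in> verts (sd ?F)" "w \<in> verts (sd ?F)"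
    using T' z(1) w by (auto simp: sd_simplex_iff[OF F])
  note ez = sd_vertexD(1)[OF F v(1)] and ew = sd_vertexD(1)[OF F v(2)]
  have "elts z \<inter> elts w \<noteq> {}"
    using ch fos_simplexD(2)[OF F ez] fos_simplexD(2)[OF F ew] by blast
  then obtain x where x: "x \<in> elts z" "x \<in> elts w" by blast
  have xj: "car 1 x \<subseteq> En j" using z(2) x(1) by (auto simp: numeral_2_eq_2)
  show ?thesis
  proof (cases "j = 1")
    case True
    then show ?thesis using xj x(2) by (auto simp: \<theta>_def)
  next
    case False
    then have j0: "j = 0" using j by simp
    have "\<not> car 1 y \<subseteq> En 1" if y: "y \<in> elts w" for y
    proof
      assume y1: "car 1 y \<subseteq> En 1"
      have ew': "elts w \<in> simps (sds 1 E0)" using ew by simp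
      have "car 1 x \<subseteq> car 1 y \<or> car 1 y \<subseteq> car 1 x"
        by (rule car_chain[OF E0 ew' x(2) y]) simp
      moreover have "car 1 v \<noteq> {}" if "v \<in> elts w" for v
        using fos_simplexD(2)[OF E0 car_vertex[OF E0, of v 1]] fos_simplexD(3)[OF F ew] that by auto
      ultimately have "car 1 x \<inter> car 1 y \<noteq> {}" using x(2) y by blast
      then obtain c where "c \<in> car 1 x" "c \<in> car 1 y" by blast
      then have "c \<in> En j" "c \<in> En 1" using xj y1 by blast+
      then show False using j0 by (simp add: En_def)
    qed
    then show ?thesis using j0 by (simp add: \<theta>_def)
  qed
qed

lemma homotopic_morphisms:
  fixes K :: "('a, 'p::order) fos" and L :: "('b, 'p) fos" and f :: "nat \<Rightarrow> 'a \<Rightarrow> 'b"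
  assumes K: "fos_complex K" "fos_finite K" and L: "fos_complex L"
    and f: "\<And>j. j \<in> {0, 1} \<Longrightarrow> fos_morphism (f j) K L"
    and hty: "strat_htpy K L (real_map (f 0)) (real_map (f 1))"
  shows "\<exists>n H. fos_morphism H (sdn (prodI K) n) L \<and>
    (\<forall>j\<in>{0, 1}. \<forall>w\<in>verts (sdn K n). H (sdn_map (\<lambda>x. (x, j)) n w) = f j (lvK K n w))"
proof -
  let ?B = "emb (prodI K)"
  let ?E = "sds 2 ?B"
  let ?pr = "fst \<circ> unV :: ('a \<times> nat) hv \<Rightarrow> 'a"
  let ?En = "\<lambda>j::nat. {c :: ('a \<times> nat) hv. snd (unV c) = j}"
  let ?\<theta> = "\<lambda>w. if \<exists>x\<in>elts w. car 1 x \<subseteq> ?En 1 then 1 else 0 :: real"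
  have E0: "fos_complex ?B" "fos_finite ?B"
    using fos_complex_emb[OF fos_complex_prodI[OF K(1)]] fos_finite_emb[OF fos_finite_prodI[OF K(2)]] by auto
  have E: "fos_complex ?E" "fos_finite ?E"
    by (rule fos_complex_sds[OF E0(1)] fos_finite_sds[OF E0])+
  have pr: "strat_simplicial ?pr ?B K" by (rule strat_simplicial_comp[OF unV_simplicial fst_simplicial])
  have lvs: "strat_simplicial (lvn ?B n) (sds n ?B) ?B" for n
    using lvn_morphism[OF E0(1)] by (simp add: fos_morphism_iff)
  have fs: "strat_simplicial (f j) K L" if "j \<in> {0, 1}" for j
    using f[OF that] by (simp add: fos_morphism_iff)
  \<comment> \<open>The projection uses the last vertex map instead of the subdivision
    homeomorphism: being simplicial, it makes the support of \<open>?\<pi> y\<close> the image of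
    the support of \<open>y\<close>.\<close>
  let ?\<pi> = "real_map (?pr \<circ> lvn ?B 2)"
  have \<pi>: "strat_pres ?E K ?\<pi>"
    by (rule real_map_strat_pres[OF E K(1) strat_simplicial_comp[OF lvs pr]])
  obtain h where h: "continuous_map (prod_topology (top_of_set {0..1::real}) (geom_top K)) (geom_top L) h"
    "\<forall>x. h (0, x) = real_map (f 0) x" "\<forall>x. h (1, x) = real_map (f 1) x"
    "\<forall>s\<in>{0..1}. \<forall>t\<in>real_carrier K. realp L (h (s, t)) = realp K t"
    using hty unfolding strat_htpy_def homotopic_with_def by (elim exE conjE)
  \<comment> \<open>Time is the affine extension of \<open>?\<theta>\<close>; by
    \<open>endpoint_time\<close> it is constant on every simplex with a vertex carried by an
    end.\<close>
  let ?t = "\<lambda>x. \<Sum>w\<in>verts ?E. x w * ?\<theta> w"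
  have finv: "finite (verts ?E)" using E(2) by (simp add: fos_finite_def)
  have sum1: "(\<Sum>w\<in>verts ?E. x w) = 1" if x: "x \<in> real_carrier ?E" for x
    using real_carrierD(3)[OF x] sum_supp_eq[OF finv supp_verts(1)[OF E(1) x]] by simp
  have t01: "?t x \<in> {0..1}" if x: "x \<in> real_carrier ?E" for x
  proof -
    have "?t x \<le> (\<Sum>w\<in>verts ?E. x w)" using real_carrierD(1)[OF x] by (intro sum_mono) simp
    moreover have "0 \<le> ?t x" using real_carrierD(1)[OF x] by (intro sum_nonneg) simp
    ultimately show ?thesis using sum1[OF x] by simp
  qed
  let ?\<phi> = "\<lambda>x. h (?t x, ?\<pi> x)"
  have \<phi>: "strat_pres ?E L ?\<phi>"
    unfolding strat_pres_def
  proof (intro conjI ballI)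
    have "continuous_on (real_carrier ?E) ?t"
      by (intro continuous_intros continuous_on_subset[OF continuous_on_product_coordinates]) auto
    then have "continuous_map (geom_top ?E) (top_of_set {0..1}) ?t"
      unfolding geom_top_finite[OF E] using t01 by (simp add: image_subset_iff Pi_iff)
    moreover have "continuous_map (geom_top ?E) (geom_top K) ?\<pi>" using \<pi> by (simp add: strat_pres_def)
    ultimately have "continuous_map (geom_top ?E) (prod_topology (top_of_set {0..1}) (geom_top K)) (\<lambda>x. (?t x, ?\<pi> x))"
      by (rule continuous_map_pairedI)
    from continuous_map_compose[OF this h(1)]
    show "continuous_map (geom_top ?E) (geom_top L) ?\<phi>" by (simp add: o_def)
  next
    fix x assume x: "x \<in> real_carrier ?E"
    have "realp L (?\<phi> x) = realp K (?\<pi> x)"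
      using h(4) t01[OF x] strat_presD(1)[OF E(1) K(1) \<pi> x] by blast
    then show "realp L (?\<phi> x) = realp ?E x" using strat_presD(2)[OF E(1) K(1) \<pi> x] by simp
  qed
  from strat_simplicial_approximation[OF E L \<phi>] obtain m g d where
    g: "strat_simplicial g (sds m ?E) L" and
    d: "\<forall>w\<in>verts (sds m ?E). d w \<noteq> {} \<and> d w \<subseteq> car m w" and
    gd: "\<forall>T\<in>simps (sds m ?E). \<exists>y\<in>real_carrier ?E. supp y = (\<Union>w\<in>T. d w) \<and> g ` T \<subseteq> supp (?\<phi> y)"
    by (elim exE conjE) (erule (2) that)
  define n where "n = 2 + m"
  have n: "sds m ?E = sds n ?B" unfolding n_def by (rule sds_add)
  let ?F = "sds n ?B"
  note g = g[unfolded n] and d = d[unfolded n] and gd = gd[unfolded n]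
  have F: "fos_complex ?F" "fos_finite ?F" using fos_complex_sds[OF E0(1)] fos_finite_sds[OF E0] by auto
  let ?b = "?pr \<circ> lvn ?B n"
  have b: "strat_simplicial ?b ?F K" by (rule strat_simplicial_comp[OF lvs pr])
  \<comment> \<open>On vertices carried by an end the value is prescribed; elsewhere the
    approximation is kept.\<close>
  define g' where "g' w = (if car n w \<subseteq> ?En 0 then f 0 (?b w) else if car n w \<subseteq> ?En 1 then f 1 (?b w) else g w)" for w
  have car_ne: "car n w \<noteq> {}" if "w \<in> verts ?F" for w
    by (rule fos_simplexD(2)[OF E0(1) car_vertex[OF E0(1) that]])
  have En_disj: "?En j \<inter> ?En k = {}" if "j \<noteq> k" for j k using that by auto
  have g'_end: "g' w = f j (?b w)" if w: "w \<in> verts ?F" "car n w \<subseteq> ?En j" and j: "j \<in> {0, 1}" for w j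
  proof -
    obtain c where "c \<in> car n w" using car_ne[OF w(1)] by blast
    then have "snd (unV c) = j" "c \<in> ?En k" if "car n w \<subseteq> ?En k" for k
      using w(2) that by blast+
    then have "k = j" if "car n w \<subseteq> ?En k" for k using that by force
    then have "car n w \<subseteq> ?En k \<longleftrightarrow> k = j" for k using w(2) by blast
    then show ?thesis using j unfolding g'_def by auto
  qed
  have g'_other: "g' w = g w" if "\<not> car n w \<subseteq> ?En 0" "\<not> car n w \<subseteq> ?En 1" for w
    using that by (simp add: g'_def)
  have g'T: "g' ` T \<in> simps L" if T: "T \<in> simps ?F" for T
  \<comment> \<open>When \<open>T\<close> has a vertex carried by end \<open>j\<close>, both the
    approximation and the prescribed values lie in the simplex obtained by applying
    \<open>f j\<close> to the projected carrier of \<open>T\<close>.\<close>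
  proof (cases "\<exists>z\<in>T. \<exists>j\<in>{0, 1}. car n z \<subseteq> ?En j")
    case False
    then have "g' w = g w" if "w \<in> T" for w using that by (intro g'_other) auto
    then have "g' ` T = g ` T" by (rule image_cong[OF refl])
    then show ?thesis using strat_simplicialD(3)[OF g T] by simp
  next
    case True
    then obtain z j where z: "z \<in> T" "car n z \<subseteq> ?En j" and j: "j \<in> {0, 1}" by blast
    have Tv: "w \<in> verts ?F" if "w \<in> T" for w using fos_simplexD(3)[OF F(1) T] that by blast
    let ?C = "\<Union>w\<in>T. car n w"
    have C: "f j ` ?pr ` ?C \<in> simps L"
      by (rule strat_simplicialD(3)[OF fs[OF j] strat_simplicialD(3)[OF pr car_simplex[OF E0(1) T]]])
    obtain y where y: "y \<in> real_carrier ?E" "supp y = (\<Union>w\<in>T. d w)" "g ` T \<subseteq> supp (?\<phi> y)"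
      using bspec[OF gd T] by (elim bexE conjE) (erule (2) that)
    have dw: "d w \<noteq> {}" "d w \<subseteq> car m w" if "w \<in> T" for w using d Tv[OF that] by auto
    have car2: "car 2 v \<subseteq> car n w" if "w \<in> T" "v \<in> d w" for v w
      unfolding n_def car_add using dw(2)[OF that(1)] that(2) by blast
    \<comment> \<open>Any \<open>v\<close> in \<open>d z\<close> is a vertex of the support of
      \<open>y\<close> carried by end \<open>j\<close>, which forces the time of \<open>y\<close> to
      be exactly \<open>j\<close>.\<close>
    obtain v where v: "v \<in> d z" using dw(1)[OF z(1)] by blast
    have vy: "v \<in> supp y" unfolding y(2) using z(1) v by blast
    have v2: "car 2 v \<subseteq> ?En j" using car2[OF z(1) v] z(2) by (rule subset_trans)
    have "?\<theta> w = real j" if "w \<in> supp y" for w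
      by (rule endpoint_time[OF E0(1) real_carrierD(2)[OF y(1)] vy v2 j that])
    then have "y w * ?\<theta> w = y w * real j" for w by (cases "w \<in> supp y") (auto simp: supp_def)
    then have "?t y = (\<Sum>w\<in>verts ?E. y w * real j)" by (intro sum.cong refl)
    also have "\<dots> = real j" using sum1[OF y(1)] by (simp flip: sum_distrib_right)
    finally have "?\<phi> y = real_map (f j) (?\<pi> y)" using h(2,3) j by auto
    then have "supp (?\<phi> y) = f j ` (?pr \<circ> lvn ?B 2) ` supp y"
      using supp_real_map[OF K(1) strat_presD(1)[OF E(1) K(1) \<pi> y(1)], of "f j"]
        supp_real_map[OF E(1) y(1), of "?pr \<circ> lvn ?B 2"] by simp
    also have "\<dots> = f j ` ?pr ` lvn ?B 2 ` supp y" by (simp only: image_comp)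
    also have "\<dots> \<subseteq> f j ` ?pr ` ?C"
    proof (intro image_mono image_subsetI)
      fix u assume u: "u \<in> supp y"
      then obtain w where w: "w \<in> T" "u \<in> d w" unfolding y(2) by blast
      have "u \<in> verts ?E" using supp_verts(1)[OF E(1) y(1)] u by blast
      then have "lvn ?B 2 u \<in> car 2 u" by (rule lvn_in_car[OF E0(1)])
      then show "lvn ?B 2 u \<in> ?C" using car2[OF w] w(1) by blast
    qed
    finally have gC: "g ` T \<subseteq> f j ` ?pr ` ?C" using y(3) by (rule subset_trans[rotated])
    have "g' w \<in> f j ` ?pr ` ?C" if w: "w \<in> T" for w
    proof (cases "car n w \<subseteq> ?En j")
      case True
      have "lvn ?B n w \<in> ?C" using lvn_in_car[OF E0(1) Tv[OF w]] w by blast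
      then show ?thesis using g'_end[OF Tv[OF w] True j] by simp
    next
      case False
      \<comment> \<open>A vertex of \<open>T\<close> is never carried by the opposite end: its
        carrier is comparable with that of \<open>z\<close>, and the ends are disjoint.\<close>
      have "\<not> car n w \<subseteq> ?En k" if k: "k \<in> {0, 1}" for k
      proof (cases "k = j")
        case neq: False
        have "0 < n" by (simp add: n_def)
        then have "car n z \<subseteq> car n w \<or> car n w \<subseteq> car n z" by (rule car_chain[OF E0(1) T z(1) w])
        then have "car n z \<inter> car n w \<noteq> {}" using car_ne[OF Tv[OF w]] car_ne[OF Tv[OF z(1)]] by blast
        then show ?thesis using z(2) En_disj[OF neq] by blast
      qed (use False in simp)
      then have "g' w = g w" by (intro g'_other) auto
      then show ?thesis using gC w by auto
    qed
    then have "g' ` T \<subseteq> f j ` ?pr ` ?C" by (rule image_subsetI)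
    then show ?thesis using fos_face[OF L C] fos_simplexD(2)[OF F(1) T] by simp
  qed
  have g'F: "filt L (g' w) = filt ?F w" if w: "w \<in> verts ?F" for w
  proof (cases "\<exists>j\<in>{0, 1}. car n w \<subseteq> ?En j")
    case True
    then obtain j where j: "j \<in> {0, 1}" "car n w \<subseteq> ?En j" by blast
    show ?thesis
      using g'_end[OF w j(2,1)] strat_simplicialD(2)[OF fs[OF j(1)] strat_simplicialD(1)[OF b w]]
        strat_simplicialD(2)[OF b w] by simp
  next
    case False
    then show ?thesis using g'_other[of w] strat_simplicialD(2)[OF g w] by simp
  qed
  have g': "strat_simplicial g' ?F L"
    unfolding strat_simplicial_def
  proof (intro conjI ballI)
    fix w assume w: "w \<in> verts ?F"
    show "g' w \<in> verts L" using fos_simplexD(3)[OF L g'T[OF fos_vertex[OF F(1) w]]] by simp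
  qed (use g'F g'T in auto)
  let ?H = "last_vertex_map L g'"
  have "?H (sdn_map (\<lambda>x. (x, j)) (Suc n) w) = f j (lvK K (Suc n) w)"
    if j: "j \<in> {0, 1}" and w: "w \<in> verts (sdn K (Suc n))" for j w
  proof -
    let ?i = "emb_map (\<lambda>x. (x, j)) :: 'a hv \<Rightarrow> ('a \<times> nat) hv" and ?G = "sdn K n" and ?EK = "emb K"
    have EK: "fos_complex ?EK" by (rule fos_complex_emb[OF K(1)])
    have G: "fos_complex ?G" by (rule sdn_complex(1)[OF K(1)])
    have Gs: "?G = sds n ?EK" by (simp add: sdn_def)
    have i: "fos_morphism ?i ?EK ?B" by (rule emb_map_morphism[OF inclusion_morphism[OF K(1) j]])
    have w': "w \<in> verts (sd ?G)" using w by (simp add: sdn_def)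
    note ew = sd_vertexD(1)[OF G w']
    have g'x: "g' ((sd_map ^^ n) ?i x) = f j (lvK K n x)" if x: "x \<in> elts w" for x
    proof -
      have xv: "x \<in> verts (sds n ?EK)" using fos_simplexD(3)[OF G ew] x Gs by auto
      have iV: "unV (?i c) = (unV c, j)" if "c \<in> verts ?EK" for c
        using that by (auto simp: emb_map_def)
      have "car n ((sd_map ^^ n) ?i x) = ?i ` car n x" by (rule sd_map_funpow_car[OF EK xv])
      moreover have "car n x \<subseteq> verts ?EK" by (rule fos_simplexD(3)[OF EK car_vertex[OF EK xv]])
      ultimately have "car n ((sd_map ^^ n) ?i x) \<subseteq> ?En j" using iV by auto
      moreover have "(sd_map ^^ n) ?i x \<in> verts ?F"
        using sd_map_funpow_morphism[OF EK E0(1) i] xv by (simp add: fos_morphism_def)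
      ultimately have "g' ((sd_map ^^ n) ?i x) = f j (?b ((sd_map ^^ n) ?i x))" by (intro g'_end j)
      also have "lvn ?B n ((sd_map ^^ n) ?i x) = ?i (lvn ?EK n x)" by (rule lvn_natural[OF EK E0(1) i xv])
      then have "?b ((sd_map ^^ n) ?i x) = lvK K n x"
        using iV[of "lvn ?EK n x"] lvn_morphism[OF EK, of n] xv by (simp add: lvK_def fos_morphism_def)
      finally show ?thesis .
    qed
    have "elts (sdn_map (\<lambda>x. (x, j)) (Suc n) w) = (sd_map ^^ n) ?i ` elts w"
      using sd_map_elts(1)[OF G w', of "(sd_map ^^ n) ?i"] by (simp add: sdn_map_def)
    then have "?H (sdn_map (\<lambda>x. (x, j)) (Suc n) w) = top_vertex L ((\<lambda>x. g' ((sd_map ^^ n) ?i x)) ` elts w)"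
      by (simp add: last_vertex_map_def image_image)
    \<comment> \<open>On the end all elements have prescribed values. Since
      \<open>f j \<circ> lvK K n\<close> is order preserving, taking the last vertex of the image
      commutes with it and contributes the final \<open>lv\<close>.\<close>
    also have "(\<lambda>x. g' ((sd_map ^^ n) ?i x)) ` elts w = (f j \<circ> lvK K n) ` elts w"
      by (rule image_cong) (use g'x in auto)
    also have "top_vertex L \<dots> = (f j \<circ> lvK K n) (top_vertex ?G (elts w))"
      by (rule top_vertex_image[OF G L fos_morphism_comp[OF lvK_morphism[OF K(1)] f[OF j]] ew])
    also have "\<dots> = f j (lvK K (Suc n) w)"
      using sd_filt(4)[OF G w'] by (simp add: lvK_def Gs)
    finally show ?thesis .
  qed
  moreover have "fos_morphism ?H (sdn (prodI K) (Suc n)) L"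
    using last_vertex_map_morphism(1)[OF F(1) L g'] by (simp add: sdn_def)
  ultimately show ?thesis by blast
qed

theorem theorem1p4p26:
  fixes K :: "('a, 'p::order) fos" and L :: "('b, 'p) fos"
  assumes "fos_complex K" and "fos_complex L" and "fos_finite K"
  shows
   "(\<forall>\<phi>. strat_pres K L \<phi> \<longrightarrow>
        (\<exists>n (f :: 'a hv \<Rightarrow> 'b).
           fos_morphism f (sdn K n) L \<and>
           strat_htpy (sdn K n) L (real_map f) (\<phi> \<circ> real_map (lvK K n)) \<and>
           strat_htpy (sdn K n) L (\<phi> \<circ> real_map (lvK K n)) (\<phi> \<circ> hn n))) \<and>
    (\<forall>(f0 :: 'a \<Rightarrow> 'b) f1. fos_morphism f0 K L \<and> fos_morphism f1 K L \<and>
        strat_htpy K L (real_map f0) (real_map f1) \<longrightarrow>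
        (\<exists>n (H :: ('a \<times> nat) hv \<Rightarrow> 'b).
           fos_morphism H (sdn (prodI K) n) L \<and>
           (\<forall>w\<in>verts (sdn K n). H (sdn_map (\<lambda>x. (x, 0)) n w) = f0 (lvK K n w)) \<and>
           (\<forall>w\<in>verts (sdn K n). H (sdn_map (\<lambda>x. (x, 1)) n w) = f1 (lvK K n w))))"
proof (intro conjI allI impI)
  note K = assms(1,3)
  fix \<phi> assume \<phi>: "strat_pres K L \<phi>"
  obtain n and f :: "'a hv \<Rightarrow> 'b" where f: "fos_morphism f (sdn K n) L"
    "strat_htpy (sdn K n) L (real_map f) (\<phi> \<circ> real_map (lvK K n))"
    using morphism_approximation[OF K assms(2) \<phi>] by (elim exE conjE) (erule (1) that)
  have "strat_htpy (sdn K n) L (\<phi> \<circ> real_map (lvK K n)) (\<phi> \<circ> hn n)"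
    by (rule strat_htpy_compose_left[OF sdn_complex(1)[OF K(1)] K(1) lvK_htpy_hn(1)[OF K] \<phi> lvK_htpy_hn(2)[OF K]])
  with f show "\<exists>n (f :: 'a hv \<Rightarrow> 'b).
      fos_morphism f (sdn K n) L \<and>
      strat_htpy (sdn K n) L (real_map f) (\<phi> \<circ> real_map (lvK K n)) \<and>
      strat_htpy (sdn K n) L (\<phi> \<circ> real_map (lvK K n)) (\<phi> \<circ> hn n)"
    by (intro exI[of _ n] exI[of _ f] conjI)
next
  fix f0 f1 :: "'a \<Rightarrow> 'b"
  assume f: "fos_morphism f0 K L \<and> fos_morphism f1 K L \<and> strat_htpy K L (real_map f0) (real_map f1)"
  obtain n and H :: "('a \<times> nat) hv \<Rightarrow> 'b" where H: "fos_morphism H (sdn (prodI K) n) L"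
    "\<forall>j\<in>{0, 1}. \<forall>w\<in>verts (sdn K n).
      H (sdn_map (\<lambda>x. (x, j)) n w) = (if j = 0 then f0 else f1) (lvK K n w)"
  proof -
    have "\<exists>n H. fos_morphism H (sdn (prodI K) n) L \<and> (\<forall>j\<in>{0, 1}. \<forall>w\<in>verts (sdn K n).
        H (sdn_map (\<lambda>x. (x, j)) n w) = (if j = 0 then f0 else f1) (lvK K n w))"
      by (rule homotopic_morphisms[OF assms(1,3,2)]) (use f in auto)
    then show ?thesis by (elim exE conjE) (erule (1) that)
  qed
  then show "\<exists>n (H :: ('a \<times> nat) hv \<Rightarrow> 'b).
      fos_morphism H (sdn (prodI K) n) L \<and>
      (\<forall>w\<in>verts (sdn K n). H (sdn_map (\<lambda>x. (x, 0)) n w) = f0 (lvK K n w)) \<and>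
      (\<forall>w\<in>verts (sdn K n). H (sdn_map (\<lambda>x. (x, 1)) n w) = f1 (lvK K n w))"
    by (intro exI[of _ n] exI[of _ H] conjI) simp_all
qed

end
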